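(* Let $B$ be a finite effectively listable premise base with $m=|B|$, let $q\in\mathrm{Cn}(B)$ be a Boolean conjunctive query, and put $d:=\mathrm{Dd}_\Sigma(q\mid B)$, assumed to satisfy $d\ge1$ and $\log m\le d\le\mathrm{poly}(m)$. Put $L:=d\log(m+d)$. (i) There is a constant $c_1>0$, depending only on $\mathcal P$, $U$ and the encoding conventions, such that $K(q\mid\langle B\rangle)\le c_1\,d\log(m+d)=c_1L$; equivalently $\mathrm{Dd}_\Sigma(q\mid B)\ge\dfrac{K(q\mid\langle B\rangle)}{c_1\log(m+\mathrm{Dd}_\Sigma(q\mid B))}$. (ii) Suppose $\mathcal P$ satisfies the richness condition with parameter $\delta_0>0$, and that, with $n:=N(q\mid B)$, $K(q\mid\langle B\rangle)\ge(1-\delta)n\log(m+n)$ for some $\delta>\delta_0$. Then there is a constant $c_2>0$ such that $\mathrm{Dd}_\Sigma(q\mid B)\le\dfrac{K(q\mid\langle B\rangle)}{c_2(1-\delta)\log(m+\mathrm{Dd}_\Sigma(q\mid B))}$. Consequently, for Boolean conjunctive queries that are generic/incompressible in the sense of (ii), $$\mathrm{Dd}_\Sigma(q\mid B)=\Theta\!\left(\frac{K(q\mid\langle B\rangle)}{\log(m+\mathrm{Dd}_\Sigma(q\mid B))}\right),$$ equivalently $\mathrm{Dd}_\Sigma(q\mid B)\ln2=\Theta\!\left(\dfrac{K(q\mid\langle B\rangle)\ln2}{\log(m+\mathrm{Dd}_\Sigma(q\mid B))}\right)$, and equivalently $K(q\mid\langle B\rangle)=\Theta\bigl(\mathrm{Dd}_\Sigma(q\mid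 B)\log(m+\mathrm{Dd}_\Sigma(q\mid B))\bigr)$.
   Context: $\log=\log_2$; $\mathrm{poly}(m)$ denotes a fixed polynomial bound; constants do not depend on the particular instance $(q,B)$. $\mathcal L$ is many-sorted FO(LFP) (first-order logic with least fixed points) over finite structures. $\mathcal P$ is a fixed effective proof system for $\mathcal L$ with decidable proof checking and a finite rule set, each rule having at most $k$ premises ($k$ constant); $\mathrm{Cn}(\Gamma)$ is the set of formulas derivable in $\mathcal P$ from the finite set $\Gamma$. $\mathbb S_O$ is a fixed ambient set of formulas with finite binary encodings, decidable equality and effectively evaluable predicates. A premise base is a finite effectively listable $B\subseteq\mathbb S_O$, with a canonical computable encoding $\langle B\rangle\in\{0,1\}^*$ (e.g. a length-prefixed list in a fixed order). A Boolean conjunctive query (BCQ) is a formula $q=\bigwedge_{j=1}^t a_j$, $t\ge1$, with each $a_j$ an atomic formula of $\mathcal L$ (or designated atomic query form). Traces: a derivation trace of $q$ from $B$ is $\pi=((r_1,\vec p_1),\dots,(r_\ell,\vec p_\ell);o)$ with $r_i$ rule identifiers, $\vec p_i$ vectors of indices, $o$ an index, such that the following replay outputs $q$: $P_0$ is the list of elements of $B$ in the canonical order; at step $i$ rule $r_i$ is applied to the formulas of the pool $P_{i-1}$ indexed by $\vec p_i$, and its conclusion is appended to give $P_i$; the output is the formula at index $o$ of $P_\ell$. It is valid if each rule application is correct in $\mathcal P$. Length $|\pi|=\ell$ ($\ell=0$ allowed). $N(q\mid B)$ is the minimum length of a valid trace deriving $q$ from $B$. For a BCQ $q$ derivable from $B$,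 the compositional depth is $\mathrm{Dd}_\Sigma(q\mid B):=N(q\mid B)$. $U$ is a fixed universal Turing machine, $K(\cdot\mid\cdot)$ is prefix-free conditional Kolmogorov complexity with respect to $U$, and $q$ is identified with its encoding $\langle q\rangle$. Richness with parameter $\delta_0>0$: there is $m_0>0$ such that for all $m\ge m_0$, all integers $n$ with $\log m\le n\le\mathrm{poly}(m)$, and all premise bases $B$ with $|B|=m$, $|\{\langle q\rangle:N(q\mid B)=n\}|\ge2^{(1-\delta_0)n\log(m+n)}$.
   Formalization: The formal statement adds δ < 1 in (ii) and in the Θ-consequence (for δ > 1 the stated upper bound is non-positive while d ≥ 1; for δ = 1 it divides by zero), and requires B nonempty, since log m is undefined for m = 0. *)

theory Defs
  imports Complex_Main "HOL-Library.Extended_Nat" "HOL-Library.Sublist"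
    "HOL-Library.Landau_Symbols" "HOL-Computational_Algebra.Polynomial"
begin

section \<open>Deterministic multi-tape Turing machines\<close>

datatype move = MoveLeft | Stay | MoveRight

text \<open>
  States are \<open>{..<num_states}\<close> with initial state 0, tape symbols are \<open>{..<num_symbols}\<close>
  with blank 0 and the bits False, True written as 1, 2.  The machine halts when the
  transition function is undefined.
\<close>

record tm =
  num_states :: nat
  num_symbols :: nat
  num_tapes :: nat
  trans :: "nat \<Rightarrow> nat list \<Rightarrow> (nat \<times> (nat \<times> move) list) option"

definition wf_tm :: "tm \<Rightarrow> bool" where
  "wf_tm M \<longleftrightarrow> 0 < num_states M \<and> 3 \<le> num_symbols M \<and> 0 < num_tapes M \<and>
     (\<forall>s as s' acts.
        s < num_states M \<and> length as = num_tapes M \<and> set as \<subseteq> {..<num_symbols M} \<and>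
        trans M s as = Some (s', acts) \<longrightarrow>
        s' < num_states M \<and> length acts = num_tapes M \<and> fst ` set acts \<subseteq> {..<num_symbols M})"

type_synonym tape = "(int \<Rightarrow> nat) \<times> int"
type_synonym config = "nat \<times> tape list"

definition cells :: "bool list \<Rightarrow> int \<Rightarrow> nat" where
  "cells x i = (if 0 \<le> i \<and> i < int (length x) then (if x ! nat i then 2 else 1) else 0)"

definition init_config :: "tm \<Rightarrow> bool list list \<Rightarrow> config" where
  "init_config M xs =
     (0, map (\<lambda>j. (cells (if j < length xs then xs ! j else []), 0)) [0..<num_tapes M])"

primrec shift :: "move \<Rightarrow> int \<Rightarrow> int" where
  "shift MoveLeft h = h - 1"
| "shift Stay h = h"
| "shift MoveRight h = h + 1"

definition act :: "nat \<times> move \<Rightarrow> tape \<Rightarrow> tape" where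
  "act a t = ((fst t)(snd t := fst a), shift (snd a) (snd t))"

definition tm_step :: "tm \<Rightarrow> config \<Rightarrow> config option" where
  "tm_step M c =
     (case trans M (fst c) (map (\<lambda>t. fst t (snd t)) (snd c)) of
        None \<Rightarrow> None
      | Some (s', acts) \<Rightarrow> Some (s', map2 act acts (snd c)))"

text \<open>
  Inputs are placed on the first tapes; the output is the exact content of the last tape on
  halting.  A run that halts with any other content of that tape has no output.
\<close>

definition tm_computes :: "tm \<Rightarrow> bool list list \<Rightarrow> bool list \<Rightarrow> bool" where
  "tm_computes M xs z \<longleftrightarrow>
     (\<exists>c. (\<lambda>c c'. tm_step M c = Some c')\<^sup>*\<^sup>* (init_config M xs) c \<and>
          tm_step M c = None \<and> fst (last (snd c)) = cells z)"

definition tm_decidable :: "bool list set \<Rightarrow> bool" where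
  "tm_decidable A \<longleftrightarrow> (\<exists>M. wf_tm M \<and> (\<forall>x. tm_computes M [x] [x \<in> A]))"


section \<open>Prefix-free conditional Kolmogorov complexity\<close>

definition prefix_free_tm :: "tm \<Rightarrow> bool" where
  "prefix_free_tm M \<longleftrightarrow>
     (\<forall>y p p' z z'. tm_computes M [p, y] z \<and> tm_computes M [p', y] z' \<and> prefix p p' \<longrightarrow> p = p')"

definition universal_prefix_tm :: "tm \<Rightarrow> bool" where
  "universal_prefix_tm U \<longleftrightarrow> wf_tm U \<and> prefix_free_tm U \<and>
     (\<forall>V. wf_tm V \<and> prefix_free_tm V \<longrightarrow>
        (\<exists>w. \<forall>p y z. tm_computes U [w @ p, y] z \<longleftrightarrow> tm_computes V [p, y] z))"

text \<open>
  For universal \<open>U\<close> every \<open>x\<close> has a program, so the minimum is over a nonempty set.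
\<close>

definition kolm :: "tm \<Rightarrow> bool list \<Rightarrow> bool list \<Rightarrow> nat" where
  "kolm U x y = (LEAST n. \<exists>p. length p = n \<and> tm_computes U [p, y] x)"


section \<open>Many-sorted first-order logic with least fixed points\<close>

record ('s, 'f, 'r) signature =
  sorts :: "'s set"
  fun_sig :: "'f \<rightharpoonup> 's list \<times> 's"
  rel_sig :: "'r \<rightharpoonup> 's list"

text \<open>
  Individual variables carry their sort; relation variables carry the list of sorts of
  their argument places.
\<close>

datatype ('s, 'f) trm = Var 's nat | Fun 'f "('s, 'f) trm list"

type_synonym 's rvar = "nat \<times> 's list"

datatype ('s, 'f, 'r) fm =
  Rel 'r "('s, 'f) trm list"
| Eq "('s, 'f) trm" "('s, 'f) trm"
| RVar "'s rvar" "('s, 'f) trm list"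
| Neg "('s, 'f, 'r) fm"
| And "('s, 'f, 'r) fm" "('s, 'f, 'r) fm"
| Or "('s, 'f, 'r) fm" "('s, 'f, 'r) fm"
| Ex 's nat "('s, 'f, 'r) fm"
| All 's nat "('s, 'f, 'r) fm"
| Lfp "'s rvar" "('s \<times> nat) list" "('s, 'f, 'r) fm" "('s, 'f) trm list"

inductive has_sort :: "('s, 'f, 'r) signature \<Rightarrow> ('s, 'f) trm \<Rightarrow> 's \<Rightarrow> bool" for sg where
  "s \<in> sorts sg \<Longrightarrow> has_sort sg (Var s x) s"
| "fun_sig sg f = Some (ss, s) \<Longrightarrow> s \<in> sorts sg \<Longrightarrow> list_all2 (has_sort sg) ts ss \<Longrightarrow>
     has_sort sg (Fun f ts) s"

text \<open>
  \<open>polar b X \<phi>\<close>: all free occurrences of \<open>X\<close> in \<open>\<phi>\<close> are positive (for \<open>b\<close>), respectively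
  negative (for \<open>\<not> b\<close>).
\<close>

primrec polar :: "bool \<Rightarrow> 's rvar \<Rightarrow> ('s, 'f, 'r) fm \<Rightarrow> bool" where
  "polar b X (Rel R ts) = True"
| "polar b X (Eq t u) = True"
| "polar b X (RVar Y ts) = (X = Y \<longrightarrow> b)"
| "polar b X (Neg \<phi>) = polar (\<not> b) X \<phi>"
| "polar b X (And \<phi> \<psi>) = (polar b X \<phi> \<and> polar b X \<psi>)"
| "polar b X (Or \<phi> \<psi>) = (polar b X \<phi> \<and> polar b X \<psi>)"
| "polar b X (Ex s x \<phi>) = polar b X \<phi>"
| "polar b X (All s x \<phi>) = polar b X \<phi>"
| "polar b X (Lfp Y vs \<phi> ts) = (X = Y \<or> polar b X \<phi>)"

text \<open>\<open>V\<close> is the set of relation variables that may occur free.\<close>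

primrec wf_fm :: "('s, 'f, 'r) signature \<Rightarrow> 's rvar set \<Rightarrow> ('s, 'f, 'r) fm \<Rightarrow> bool" where
  "wf_fm sg V (Rel R ts) =
     (\<exists>ss. rel_sig sg R = Some ss \<and> list_all2 (has_sort sg) ts ss)"
| "wf_fm sg V (Eq t u) = (\<exists>s. has_sort sg t s \<and> has_sort sg u s)"
| "wf_fm sg V (RVar X ts) = (X \<in> V \<and> list_all2 (has_sort sg) ts (snd X))"
| "wf_fm sg V (Neg \<phi>) = wf_fm sg V \<phi>"
| "wf_fm sg V (And \<phi> \<psi>) = (wf_fm sg V \<phi> \<and> wf_fm sg V \<psi>)"
| "wf_fm sg V (Or \<phi> \<psi>) = (wf_fm sg V \<phi> \<and> wf_fm sg V \<psi>)"
| "wf_fm sg V (Ex s x \<phi>) = (s \<in> sorts sg \<and> wf_fm sg V \<phi>)"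
| "wf_fm sg V (All s x \<phi>) = (s \<in> sorts sg \<and> wf_fm sg V \<phi>)"
| "wf_fm sg V (Lfp X vs \<phi> ts) =
     (distinct vs \<and> snd X = map fst vs \<and> set (snd X) \<subseteq> sorts sg \<and>
      polar True X \<phi> \<and> wf_fm sg (insert X V) \<phi> \<and> list_all2 (has_sort sg) ts (snd X))"

definition language :: "('s, 'f, 'r) signature \<Rightarrow> ('s, 'f, 'r) fm set" where
  "language sg = {\<phi>. wf_fm sg {} \<phi>}"

fun is_atom :: "('s, 'f, 'r) fm \<Rightarrow> bool" where
  "is_atom (Rel R ts) = True"
| "is_atom (Eq t u) = True"
| "is_atom _ = False"

text \<open>\<open>AQ\<close> is the set of designated atomic query forms.\<close>

definition atomic_query ::
  "('s, 'f, 'r) signature \<Rightarrow> ('s, 'f, 'r) fm set \<Rightarrow> ('s, 'f, 'r) fm \<Rightarrow> bool" where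
  "atomic_query sg AQ a \<longleftrightarrow> (a \<in> language sg \<and> is_atom a) \<or> a \<in> AQ"

text \<open>Nonempty conjunctions of atomic queries, with any bracketing.\<close>

inductive bcq ::
  "('s, 'f, 'r) signature \<Rightarrow> ('s, 'f, 'r) fm set \<Rightarrow> ('s, 'f, 'r) fm \<Rightarrow> bool" for sg AQ where
  "atomic_query sg AQ a \<Longrightarrow> bcq sg AQ a"
| "bcq sg AQ \<phi> \<Longrightarrow> bcq sg AQ \<psi> \<Longrightarrow> bcq sg AQ (And \<phi> \<psi>)"


section \<open>Proof systems, derivability and traces\<close>

text \<open>
  A trace records only rule identifiers and premise indices, so a rule is a partial function
  from premise lists to conclusions, undefined where it does not apply.
\<close>

record ('s, 'f, 'r) proof_system =
  rule_ids :: "nat set"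
  rule_app :: "nat \<Rightarrow> ('s, 'f, 'r) fm list \<Rightarrow> ('s, 'f, 'r) fm option"

inductive_set Cn :: "('s, 'f, 'r) proof_system \<Rightarrow> ('s, 'f, 'r) fm set \<Rightarrow> ('s, 'f, 'r) fm set"
  for P \<Gamma> where
  premise: "\<phi> \<in> \<Gamma> \<Longrightarrow> \<phi> \<in> Cn P \<Gamma>"
| rule: "r \<in> rule_ids P \<Longrightarrow> \<forall>\<psi> \<in> set \<psi>s. \<psi> \<in> Cn P \<Gamma> \<Longrightarrow> rule_app P r \<psi>s = Some \<phi> \<Longrightarrow>
     \<phi> \<in> Cn P \<Gamma>"

type_synonym trace = "(nat \<times> nat list) list \<times> nat"

text \<open>\<open>replay\<close> yields the final pool, or \<open>None\<close> if some rule application is incorrect.\<close>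

fun replay ::
  "('s, 'f, 'r) proof_system \<Rightarrow> ('s, 'f, 'r) fm list \<Rightarrow> (nat \<times> nat list) list \<Rightarrow>
   ('s, 'f, 'r) fm list option" where
  "replay P pool [] = Some pool"
| "replay P pool ((r, is) # steps) =
     (if r \<in> rule_ids P \<and> (\<forall>i \<in> set is. i < length pool)
      then (case rule_app P r (map (\<lambda>i. pool ! i) is) of
              None \<Rightarrow> None
            | Some \<phi> \<Rightarrow> replay P (pool @ [\<phi>]) steps)
      else None)"

text \<open>\<open>lst B\<close> is the list of the elements of \<open>B\<close> in the canonical order.\<close>

definition valid_trace ::
  "('s, 'f, 'r) proof_system \<Rightarrow> (('s, 'f, 'r) fm set \<Rightarrow> ('s, 'f, 'r) fm list) \<Rightarrow>
   ('s, 'f, 'r) fm set \<Rightarrow> ('s, 'f, 'r) fm \<Rightarrow> trace \<Rightarrow> bool" where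
  "valid_trace P lst B q \<pi> \<longleftrightarrow>
     (\<exists>pool. replay P (lst B) (fst \<pi>) = Some pool \<and>
             snd \<pi> < length pool \<and> pool ! snd \<pi> = q)"

definition trace_length :: "trace \<Rightarrow> nat" where
  "trace_length \<pi> = length (fst \<pi>)"

text \<open>\<open>min_trace\<close> is infinite for formulas without a valid trace.\<close>

definition min_trace ::
  "('s, 'f, 'r) proof_system \<Rightarrow> (('s, 'f, 'r) fm set \<Rightarrow> ('s, 'f, 'r) fm list) \<Rightarrow>
   ('s, 'f, 'r) fm set \<Rightarrow> ('s, 'f, 'r) fm \<Rightarrow> enat" where
  "min_trace P lst B q = (INF \<pi> \<in> {\<pi>. valid_trace P lst B q \<pi>}. enat (trace_length \<pi>))"

definition Dd ::
  "('s, 'f, 'r) proof_system \<Rightarrow> (('s, 'f, 'r) fm set \<Rightarrow> ('s, 'f, 'r) fm list) \<Rightarrow>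
   ('s, 'f, 'r) fm set \<Rightarrow> ('s, 'f, 'r) fm \<Rightarrow> nat" where
  "Dd P lst B q = the_enat (min_trace P lst B q)"


section \<open>Effectiveness conventions\<close>

definition list_code :: "bool list list \<Rightarrow> bool list" where
  "list_code xs = concat (map (\<lambda>x. replicate (length x) True @ [False] @ x) xs)"

fun option_code :: "bool list option \<Rightarrow> bool list" where
  "option_code None = []"
| "option_code (Some x) = True # x"

text \<open>
  Since \<open>enc\<close> is injective, equality of formulas is equality of their codes and hence decidable.
\<close>

definition formula_encoding ::
  "('s, 'f, 'r) signature \<Rightarrow> (('s, 'f, 'r) fm \<Rightarrow> bool list) \<Rightarrow> bool" where
  "formula_encoding sg enc \<longleftrightarrow> inj_on enc (language sg)"

definition ambient_formulas ::
  "('s, 'f, 'r) signature \<Rightarrow> (('s, 'f, 'r) fm \<Rightarrow> bool list) \<Rightarrow> ('s, 'f, 'r) fm set \<Rightarrow>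
   ('s, 'f, 'r) fm set \<Rightarrow> bool" where
  "ambient_formulas sg enc AQ S \<longleftrightarrow>
     S \<subseteq> language sg \<and> AQ \<subseteq> language sg \<and>
     tm_decidable (enc ` S) \<and>
     tm_decidable (enc ` {\<phi> \<in> S. atomic_query sg AQ \<phi>}) \<and>
     tm_decidable (enc ` {\<phi> \<in> S. bcq sg AQ \<phi>})"

text \<open>
  Each rule is computable on codes, including the test whether it applies at all; this is
  what makes proof checking decidable.
\<close>

definition effective_proof_system ::
  "('s, 'f, 'r) signature \<Rightarrow> (('s, 'f, 'r) fm \<Rightarrow> bool list) \<Rightarrow> ('s, 'f, 'r) proof_system \<Rightarrow>
   nat \<Rightarrow> bool" where
  "effective_proof_system sg enc P k \<longleftrightarrow>
     finite (rule_ids P) \<and>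
     (\<forall>r \<in> rule_ids P.
        (\<forall>\<psi>s \<phi>. rule_app P r \<psi>s = Some \<phi> \<longrightarrow> length \<psi>s \<le> k) \<and>
        (\<forall>\<psi>s \<phi>. set \<psi>s \<subseteq> language sg \<and> rule_app P r \<psi>s = Some \<phi> \<longrightarrow> \<phi> \<in> language sg) \<and>
        (\<exists>M. wf_tm M \<and>
           (\<forall>\<psi>s. set \<psi>s \<subseteq> language sg \<longrightarrow>
              tm_computes M [list_code (map enc \<psi>s)]
                (option_code (map_option enc (rule_app P r \<psi>s))))))"

definition premise_base :: "('s, 'f, 'r) fm set \<Rightarrow> ('s, 'f, 'r) fm set \<Rightarrow> bool" where
  "premise_base S B \<longleftrightarrow> finite B \<and> B \<subseteq> S"

text \<open>
  \<open>encB B\<close> is computable from any listing of \<open>B\<close>, and the canonical listing of \<open>B\<close> is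
  computable from \<open>encB B\<close>.
\<close>

definition canonical_base_encoding ::
  "(('s, 'f, 'r) fm \<Rightarrow> bool list) \<Rightarrow> ('s, 'f, 'r) fm set \<Rightarrow>
   (('s, 'f, 'r) fm set \<Rightarrow> ('s, 'f, 'r) fm list) \<Rightarrow> (('s, 'f, 'r) fm set \<Rightarrow> bool list) \<Rightarrow> bool"
  where
  "canonical_base_encoding enc S lst encB \<longleftrightarrow>
     (\<forall>B. premise_base S B \<longrightarrow> set (lst B) = B \<and> distinct (lst B)) \<and>
     (\<exists>M. wf_tm M \<and>
        (\<forall>\<phi>s. set \<phi>s \<subseteq> S \<longrightarrow> tm_computes M [list_code (map enc \<phi>s)] (encB (set \<phi>s)))) \<and>
     (\<exists>M. wf_tm M \<and>
        (\<forall>B. premise_base S B \<longrightarrow> tm_computes M [encB B] (list_code (map enc (lst B)))))"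


section \<open>Query instances, richness and incompressibility\<close>

text \<open>
  \<open>pb\<close> is the polynomial bound.  Nonemptiness of \<open>B\<close> is implicit in the use of
  \<open>log 2 (card B)\<close>, which the library totalises to 0 at 0.
\<close>

definition query_instance ::
  "('s, 'f, 'r) signature \<Rightarrow> ('s, 'f, 'r) proof_system \<Rightarrow> ('s, 'f, 'r) fm set \<Rightarrow>
   ('s, 'f, 'r) fm set \<Rightarrow> (('s, 'f, 'r) fm set \<Rightarrow> ('s, 'f, 'r) fm list) \<Rightarrow> real poly \<Rightarrow>
   ('s, 'f, 'r) fm set \<Rightarrow> ('s, 'f, 'r) fm \<Rightarrow> bool" where
  "query_instance sg P AQ S lst pb B q \<longleftrightarrow>
     premise_base S B \<and> B \<noteq> {} \<and> bcq sg AQ q \<and> q \<in> Cn P B \<and>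
     1 \<le> Dd P lst B q \<and>
     log 2 (real (card B)) \<le> real (Dd P lst B q) \<and>
     real (Dd P lst B q) \<le> poly pb (real (card B))"

definition rich ::
  "('s, 'f, 'r) proof_system \<Rightarrow> (('s, 'f, 'r) fm \<Rightarrow> bool list) \<Rightarrow> ('s, 'f, 'r) fm set \<Rightarrow>
   (('s, 'f, 'r) fm set \<Rightarrow> ('s, 'f, 'r) fm list) \<Rightarrow> real poly \<Rightarrow> real \<Rightarrow> bool" where
  "rich P enc S lst pb \<delta>\<^sub>0 \<longleftrightarrow>
     (\<exists>m\<^sub>0>0. \<forall>m\<ge>m\<^sub>0. \<forall>n::nat.
        log 2 (real m) \<le> real n \<and> real n \<le> poly pb (real m) \<longrightarrow>
        (\<forall>B. premise_base S B \<and> card B = m \<longrightarrow>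
           2 powr ((1 - \<delta>\<^sub>0) * real n * log 2 (real m + real n))
             \<le> real (card {enc q | q. min_trace P lst B q = enat n})))"

definition incompressible ::
  "tm \<Rightarrow> ('s, 'f, 'r) proof_system \<Rightarrow> (('s, 'f, 'r) fm \<Rightarrow> bool list) \<Rightarrow>
   (('s, 'f, 'r) fm set \<Rightarrow> ('s, 'f, 'r) fm list) \<Rightarrow> (('s, 'f, 'r) fm set \<Rightarrow> bool list) \<Rightarrow>
   real \<Rightarrow> ('s, 'f, 'r) fm set \<Rightarrow> ('s, 'f, 'r) fm \<Rightarrow> bool" where
  "incompressible U P enc lst encB \<delta> B q \<longleftrightarrow>
     (\<exists>n. min_trace P lst B q = enat n \<and>
        (1 - \<delta>) * real n * log 2 (real (card B) + real n) \<le> real (kolm U (enc q) (encB B)))"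

end

theory Submission imports Defs begin

text \<open>
  The upper bound is a compression argument: a trace of length \<open>d\<close> over \<open>m\<close> premises is a
  sequence of \<open>O(d)\<close> rule names and pool indices below \<open>m + d\<close>, hence has a self-delimiting code
  of \<open>O(d log (m + d))\<close> bits, and some prefix machine turns this code and \<open>\<langle>B\<rangle>\<close> into \<open>q\<close>.
  Universality makes the complexity at most the length of the code plus a constant.  That machine
  has to be exhibited as a multi-tape Turing machine containing the given machines for the rules
  and for the canonical listing.  It is programmed in a while language on stacks, one stack per
  tape; a given machine is run by keeping each of its tapes on two stacks and its state on a third,
  so that the stacks can be emptied again after the run.  Only failure on inputs outside the prefix
  code and correctness on codes of valid traces matter.  The lower bound is incompressibility itself.
\<close>

section \<open>A while language on stacks and its compilation\<close>

text \<open>Prefix-freeness constrains every program, including those on which a given machine would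
  diverge or return nonsense. The whole program tape is therefore checked by a finite automaton
  before any given machine is started. A failed check leaves a symbol that is not a bit on the
  output, and such a run counts as having no output. After the check nothing else can spoil
  prefix-freeness: whatever an accepted program does, no proper extension of it is accepted.

  The logarithmic cost comes from the instruction set: an index is built by doubling, so it takes as
  many tokens as it has binary digits, while the tokens themselves may be unary because there are
  only finitely many rules. Finite data are kept in single tape symbols: the alphabet is chosen
  large enough to hold a state, a pending action or a token count for every machine involved, so
  that one push of a function of the tops performs any finite computation.\<close>

text \<open>The two inputs of a machine lie on the tapes of \<open>Aux 0\<close> and \<open>Rgt 0\<close>.\<close>

datatype reg = Aux nat | Rgt nat | Lft nat | Cmd nat

primrec tape_of :: "reg \<Rightarrow> nat" where
  "tape_of (Aux n) = 4 * n"
| "tape_of (Rgt n) = 4 * n + 1"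
| "tape_of (Lft n) = 4 * n + 2"
| "tape_of (Cmd n) = 4 * n + 3"

lemma tape_of_inject [simp]: "tape_of i = tape_of j \<longleftrightarrow> i = j"
  by (cases i; cases j; simp; presburger)

text \<open>0 stands for the empty stack and never occurs on a stack.\<close>

type_synonym store = "reg \<Rightarrow> nat list"

primrec peek :: "nat list \<Rightarrow> nat" where
  "peek [] = 0"
| "peek (x # xs) = x"

text \<open>Values and tests are arbitrary functions of all tops, because a transition table is an
  arbitrary function of the symbols under the heads. This lets the transition function of a given
  machine serve as an expression.\<close>

datatype com =
  Skip
| Push reg "(reg \<Rightarrow> nat) \<Rightarrow> nat"
| Pop reg
| Seq com com (infixr ";;" 60)
| Cond "(reg \<Rightarrow> nat) \<Rightarrow> bool" com com
| Loop "(reg \<Rightarrow> nat) \<Rightarrow> bool" com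

text \<open>\<open>G\<close> is the size of the tape alphabet; pushing 0 or a value outside it has no effect.\<close>

inductive exec :: "nat \<Rightarrow> com \<Rightarrow> store \<Rightarrow> store \<Rightarrow> bool" for G where
  Skip: "exec G Skip \<sigma> \<sigma>"
| Push: "v = f (\<lambda>r. peek (\<sigma> r)) \<Longrightarrow> 0 < v \<Longrightarrow> v < G \<Longrightarrow> exec G (Push i f) \<sigma> (\<sigma>(i := v # \<sigma> i))"
| NoPush: "v = f (\<lambda>r. peek (\<sigma> r)) \<Longrightarrow> \<not> (0 < v \<and> v < G) \<Longrightarrow> exec G (Push i f) \<sigma> \<sigma>"
| Pop: "exec G (Pop i) \<sigma> (\<sigma>(i := tl (\<sigma> i)))"
| Seq: "exec G c \<sigma> \<sigma>' \<Longrightarrow> exec G d \<sigma>' \<sigma>'' \<Longrightarrow> exec G (c ;; d) \<sigma> \<sigma>''"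
| CondT: "b (\<lambda>r. peek (\<sigma> r)) \<Longrightarrow> exec G c \<sigma> \<sigma>' \<Longrightarrow> exec G (Cond b c d) \<sigma> \<sigma>'"
| CondF: "\<not> b (\<lambda>r. peek (\<sigma> r)) \<Longrightarrow> exec G d \<sigma> \<sigma>' \<Longrightarrow> exec G (Cond b c d) \<sigma> \<sigma>'"
| LoopF: "\<not> b (\<lambda>r. peek (\<sigma> r)) \<Longrightarrow> exec G (Loop b c) \<sigma> \<sigma>"
| LoopT: "b (\<lambda>r. peek (\<sigma> r)) \<Longrightarrow> exec G c \<sigma> \<sigma>' \<Longrightarrow> exec G (Loop b c) \<sigma>' \<sigma>'' \<Longrightarrow>
    exec G (Loop b c) \<sigma> \<sigma>''"

primrec width :: "com \<Rightarrow> nat" where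
  "width Skip = 0"
| "width (Push i f) = Suc (tape_of i)"
| "width (Pop i) = Suc (tape_of i)"
| "width (c ;; d) = max (width c) (width d)"
| "width (Cond b c d) = max (width c) (width d)"
| "width (Loop b c) = width c"

type_synonym table = "nat \<Rightarrow> nat list \<Rightarrow> nat \<times> (nat \<times> move) list"

definition idle :: "nat list \<Rightarrow> (nat \<times> move) list" where
  "idle as = map (\<lambda>a. (a, Stay)) as"

text \<open>The default 0 makes a register without a tape look like an empty stack, in agreement
  with \<open>store_tapes\<close>.\<close>

definition tops :: "nat list \<Rightarrow> reg \<Rightarrow> nat" where
  "tops as r = (if tape_of r < length as then as ! tape_of r else 0)"

text \<open>
  Control flow graphs with states below the first component, entry state 0 and the number of
  states itself as exit.
\<close>

primrec compile :: "nat \<Rightarrow> com \<Rightarrow> nat \<times> table" where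
  "compile G Skip = (0, \<lambda>s as. (0, idle as))"
| "compile G (Push i f) = (G, \<lambda>s as.
     if s = 0 then
       (let v = f (tops as) in
        if 0 < v \<and> v < G then (v, (idle as)[tape_of i := (as ! tape_of i, MoveLeft)])
        else (G, idle as))
     else (G, (idle as)[tape_of i := (s, Stay)]))"
| "compile G (Pop i) = (1, \<lambda>s as.
     (1, if as ! tape_of i = 0 then idle as else (idle as)[tape_of i := (0, MoveRight)]))"
| "compile G (c ;; d) = (case compile G c of (n, \<delta>) \<Rightarrow> case compile G d of (n', \<delta>') \<Rightarrow>
     (n + n', \<lambda>s as. if s < n then \<delta> s as else map_prod ((+) n) id (\<delta>' (s - n) as)))"
| "compile G (Cond b c d) = (case compile G c of (n, \<delta>) \<Rightarrow> case compile G d of (n', \<delta>') \<Rightarrow>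
     (Suc (n + n'), \<lambda>s as.
        if s = 0 then (if b (tops as) then (if n = 0 then Suc n' else 1) else Suc n, idle as)
        else if s \<le> n then map_prod (\<lambda>t. if t = n then Suc (n + n') else Suc t) id (\<delta> (s - 1) as)
        else map_prod (\<lambda>t. Suc (n + t)) id (\<delta>' (s - Suc n) as)))"
| "compile G (Loop b c) = (case compile G c of (n, \<delta>) \<Rightarrow>
     (Suc n, \<lambda>s as.
        if s = 0 then (if b (tops as) then (if n = 0 then 0 else 1) else Suc n, idle as)
        else map_prod (\<lambda>t. if t = n then 0 else Suc t) id (\<delta> (s - 1) as)))"

definition step :: "table \<Rightarrow> config \<Rightarrow> config" where
  "step \<delta> c = (case \<delta> (fst c) (map (\<lambda>t. fst t (snd t)) (snd c)) of
     (s', acts) \<Rightarrow> (s', map2 act acts (snd c)))"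

text \<open>No step starts at the exit, so a run of a subprogram ends there and can be continued by
  whatever the enclosing program places at that state.\<close>

definition flow :: "nat \<times> table \<Rightarrow> config \<Rightarrow> config \<Rightarrow> bool" where
  "flow M c c' \<longleftrightarrow> fst c < fst M \<and> c' = step (snd M) c"

text \<open>The tables need to agree only below \<open>n\<close>, as runs take steps from these
  states alone; \<open>\<rho>\<close> may thus send the exit to wherever the enclosing program goes
  on.\<close>

lemma flow_embed:
  assumes "(flow (n, \<delta>))\<^sup>*\<^sup>* c c'"
    and tab: "\<And>s as. s < n \<Longrightarrow> \<rho> s < n' \<and> \<delta>' (\<rho> s) as = map_prod \<rho> id (\<delta> s as)"
  shows "(flow (n', \<delta>'))\<^sup>*\<^sup>* (\<rho> (fst c), snd c) (\<rho> (fst c'), snd c')"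
  using assms(1)
proof induction
  case base
  then show ?case by simp
next
  case (step c' c'')
  then have "flow (n', \<delta>') (\<rho> (fst c'), snd c') (\<rho> (fst c''), snd c'')"
    using tab[of "fst c'"]
    by (auto simp: flow_def step_def map_prod_def split: prod.splits)
  with step.IH show ?case
    by (rule rtranclp.rtrancl_into_rtrancl)
qed

lemma map2_act_idle [simp]:
  "map2 act (idle (map (\<lambda>t. fst t (snd t)) ts)) ts = ts"
  by (rule nth_equalityI) (auto simp: idle_def act_def)

lemma map2_act_idle_update [simp]:
  assumes "j < length ts"
  shows "map2 act ((idle (map (\<lambda>t. fst t (snd t)) ts))[j := a]) ts = ts[j := act a (ts ! j)]"
  using assms by (intro nth_equalityI) (auto simp: idle_def act_def nth_list_update)

lemma length_idle [simp]: "length (idle as) = length as"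
  by (simp add: idle_def)

text \<open>A stack occupies the cells from the head rightwards, top first.\<close>

definition stack_tape :: "nat list \<Rightarrow> tape \<Rightarrow> bool" where
  "stack_tape xs t \<longleftrightarrow> 0 \<notin> set xs \<and>
     (\<forall>k. fst t k = (if snd t \<le> k \<and> k < snd t + int (length xs) then xs ! nat (k - snd t) else 0))"

lemma stack_tape_read: "stack_tape xs t \<Longrightarrow> fst t (snd t) = peek xs"
  by (cases xs) (auto simp: stack_tape_def)

lemma stack_tape_push:
  assumes "stack_tape xs t" "0 < v"
  shows "stack_tape (v # xs) (act (v, Stay) (act (fst t (snd t), MoveLeft) t))"
  using assms by (auto simp: stack_tape_def act_def nth_Cons' nat_diff_distrib algebra_simps
      intro!: arg_cong[where f = "(!) xs"])

lemma stack_tape_pop: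
  assumes "stack_tape (x # xs) t"
  shows "stack_tape xs (act (0, MoveRight) t)"
  using assms by (auto simp: stack_tape_def act_def nth_Cons' nat_diff_distrib algebra_simps
      intro!: arg_cong[where f = "(!) xs"])

text \<open>Tape \<open>N\<close> is kept blank with its head at 0 for the final output. A register
  whose tape would be \<open>N\<close> or beyond has to be empty.\<close>

definition store_tapes :: "nat \<Rightarrow> store \<Rightarrow> tape list \<Rightarrow> bool" where
  "store_tapes N \<sigma> ts \<longleftrightarrow> length ts = Suc N \<and> ts ! N = (\<lambda>_. 0, 0) \<and>
     (\<forall>i. if tape_of i < N then stack_tape (\<sigma> i) (ts ! tape_of i) else \<sigma> i = [])"

lemma store_tapes_tops:
  assumes "store_tapes N \<sigma> ts"
  shows "tops (map (\<lambda>t. fst t (snd t)) ts) = (\<lambda>r. peek (\<sigma> r))"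
proof
  fix r
  consider "tape_of r < N" | "tape_of r = N" | "tape_of r > N"
    by linarith
  then show "tops (map (\<lambda>t. fst t (snd t)) ts) r = peek (\<sigma> r)"
    using assms stack_tape_read
    by cases (auto simp: store_tapes_def tops_def split: if_splits
      dest!: spec[where x = r] dest: stack_tape_read)
qed

lemma store_tapes_update:
  assumes "store_tapes N \<sigma> ts" "tape_of i < N" "stack_tape xs t"
  shows "store_tapes N (\<sigma>(i := xs)) (ts[tape_of i := t])"
  using assms by (auto simp: store_tapes_def nth_list_update)

text \<open>Induction on the execution: the derivation unrolls loops, and the run of each subprogram
  is transported by \<open>flow_embed\<close> along the renaming of states that
  \<open>compile\<close> uses for it.\<close>

lemma compile_correct:
  assumes "exec G c \<sigma> \<sigma>'" "width c \<le> N" "store_tapes N \<sigma> ts"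
  shows "\<exists>ts'. store_tapes N \<sigma>' ts' \<and>
    (flow (compile G c))\<^sup>*\<^sup>* (0, ts) (fst (compile G c), ts')"
  using assms
proof (induction arbitrary: ts rule: exec.induct)
  case (Skip \<sigma>)
  then show ?case by auto
next
  case (Push v f \<sigma> i)
  let ?t = "ts ! tape_of i"
  \<comment> \<open>A push takes two steps: the head moves left onto a free cell while state
    \<open>v\<close> remembers the value, which is then written.\<close>
  define t1 where "t1 = act (fst ?t (snd ?t), MoveLeft) ?t"
  define t2 where "t2 = act (v, Stay) t1"
  have i: "tape_of i < N" and len: "length ts = Suc N"
    using Push.prems by (auto simp: store_tapes_def)
  have "stack_tape (\<sigma> i) ?t"
    using Push.prems i by (auto simp: store_tapes_def split: if_splits)
  then have st: "stack_tape (v # \<sigma> i) t2"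
    unfolding t1_def t2_def using Push.hyps(2) by (rule stack_tape_push)
  have f1: "flow (compile G (Push i f)) (0, ts) (v, ts[tape_of i := t1])"
    using Push.hyps i len Push.prems
    by (simp add: flow_def step_def Let_def store_tapes_tops t1_def)
  have f2: "flow (compile G (Push i f)) (v, ts[tape_of i := t1])
      (fst (compile G (Push i f)), ts[tape_of i := t2])"
    using Push.hyps(2,3) i len by (simp add: flow_def step_def t2_def)
  have "store_tapes N (\<sigma>(i := v # \<sigma> i)) (ts[tape_of i := t2])"
    using Push.prems(2) i st by (rule store_tapes_update)
  then show ?case
    using f1 f2 by (meson converse_rtranclp_into_rtranclp rtranclp.rtrancl_refl)
next
  case (NoPush v f \<sigma> i)
  show ?case
  \<comment> \<open>For \<open>G = 0\<close> the program has no states, so its entry is already its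
    exit and the empty run suffices.\<close>
  proof (cases "G = 0")
    case True
    then show ?thesis using NoPush by auto
  next
    case False
    then have "flow (compile G (Push i f)) (0, ts) (fst (compile G (Push i f)), ts)"
      using NoPush by (auto simp: flow_def step_def Let_def store_tapes_tops)
    then show ?thesis using NoPush by blast
  qed
next
  case (Pop i \<sigma>)
  let ?t = "ts ! tape_of i"
  have i: "tape_of i < N" and len: "length ts = Suc N"
    using Pop.prems by (auto simp: store_tapes_def)
  have st: "stack_tape (\<sigma> i) ?t"
    using Pop.prems i by (auto simp: store_tapes_def split: if_splits)
  show ?case
  proof (cases "\<sigma> i")
    case Nil
    then have "\<sigma>(i := tl (\<sigma> i)) = \<sigma>" by auto
    moreover have "flow (compile G (Pop i)) (0, ts) (fst (compile G (Pop i)), ts)"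
      using stack_tape_read[OF st] Nil i len by (simp add: flow_def step_def)
    ultimately show ?thesis using Pop.prems by auto
  next
    case (Cons x xs)
    then have "x \<noteq> 0" using st by (auto simp: stack_tape_def)
    then have "flow (compile G (Pop i)) (0, ts)
        (fst (compile G (Pop i)), ts[tape_of i := act (0, MoveRight) ?t])"
      using stack_tape_read[OF st] Cons i len by (simp add: flow_def step_def)
    moreover have "store_tapes N (\<sigma>(i := tl (\<sigma> i))) (ts[tape_of i := act (0, MoveRight) ?t])"
      using Pop.prems(2) i by (rule store_tapes_update) (use st Cons stack_tape_pop in auto)
    ultimately show ?thesis by blast
  qed
next
  case (Seq c \<sigma> \<sigma>' d \<sigma>'')
  obtain n \<delta> n' \<delta>' where cd: "compile G c = (n, \<delta>)" "compile G d = (n', \<delta>')"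
    by fastforce
  obtain ts1 where 1: "store_tapes N \<sigma>' ts1" "(flow (n, \<delta>))\<^sup>*\<^sup>* (0, ts) (n, ts1)"
    using Seq.IH(1)[of ts] Seq.prems cd by auto
  obtain ts2 where 2: "store_tapes N \<sigma>'' ts2" "(flow (n', \<delta>'))\<^sup>*\<^sup>* (0, ts1) (n', ts2)"
    using Seq.IH(2)[of ts1] Seq.prems cd 1 by auto
  have "(flow (compile G (c ;; d)))\<^sup>*\<^sup>* (0, ts) (n, ts1)"
    using flow_embed[OF 1(2), of id "n + n'" "snd (compile G (c ;; d))"] cd
    by (simp add: map_prod.id)
  moreover have "(flow (compile G (c ;; d)))\<^sup>*\<^sup>* (n, ts1) (n + n', ts2)"
    using flow_embed[OF 2(2), of "(+) n" "n + n'" "snd (compile G (c ;; d))"] cd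
    by simp
  ultimately show ?case
    using 2 cd by (auto intro: rtranclp_trans)
next
  case (CondT b \<sigma> c \<sigma>' d)
  obtain n \<delta> n' \<delta>' where cd: "compile G c = (n, \<delta>)" "compile G d = (n', \<delta>')"
    by fastforce
  let ?M = "compile G (Cond b c d)"
  \<comment> \<open>The exit of \<open>c\<close> becomes the exit of the whole, the other states
    move up by one past the test. If \<open>c\<close> has no states, its entry is its exit and the
    test leads to \<open>\<rho> 0\<close>, not to 1.\<close>
  define \<rho> where "\<rho> t = (if t = n then Suc (n + n') else Suc t)" for t
  obtain ts1 where 1: "store_tapes N \<sigma>' ts1" "(flow (n, \<delta>))\<^sup>*\<^sup>* (0, ts) (n, ts1)"
    using CondT.IH[of ts] CondT.prems cd by auto
  have "flow ?M (0, ts) (\<rho> 0, ts)"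
    using CondT.hyps CondT.prems cd by (simp add: flow_def step_def store_tapes_tops \<rho>_def)
  moreover have "\<rho> s < Suc (n + n') \<and> snd ?M (\<rho> s) as = map_prod \<rho> id (\<delta> s as)" if "s < n" for s as
    using that cd by (simp add: \<rho>_def[abs_def])
  from flow_embed[OF 1(2) this] have "(flow ?M)\<^sup>*\<^sup>* (\<rho> 0, ts) (\<rho> n, ts1)"
    by (simp add: cd)
  ultimately have "(flow ?M)\<^sup>*\<^sup>* (0, ts) (\<rho> n, ts1)"
    by (rule converse_rtranclp_into_rtranclp)
  moreover have "\<rho> n = fst ?M" using cd by (simp add: \<rho>_def)
  ultimately show ?case using 1(1) by metis
next
  case (CondF b \<sigma> d \<sigma>' c)
  obtain n \<delta> n' \<delta>' where cd: "compile G c = (n, \<delta>)" "compile G d = (n', \<delta>')"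
    by fastforce
  let ?M = "compile G (Cond b c d)" and ?\<rho> = "\<lambda>t. Suc (n + t)"
  obtain ts1 where 1: "store_tapes N \<sigma>' ts1" "(flow (n', \<delta>'))\<^sup>*\<^sup>* (0, ts) (n', ts1)"
    using CondF.IH[of ts] CondF.prems cd by auto
  have "flow ?M (0, ts) (Suc n, ts)"
    using CondF.hyps CondF.prems cd by (simp add: flow_def step_def store_tapes_tops)
  moreover have "(flow ?M)\<^sup>*\<^sup>* (Suc n, ts) (Suc (n + n'), ts1)"
    using flow_embed[OF 1(2), of ?\<rho> "Suc (n + n')" "snd ?M"] cd by simp
  ultimately have "(flow ?M)\<^sup>*\<^sup>* (0, ts) (Suc (n + n'), ts1)"
    by (rule converse_rtranclp_into_rtranclp)
  moreover have "Suc (n + n') = fst ?M" using cd by simp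
  ultimately show ?case using 1(1) by metis
next
  case (LoopF b \<sigma> c)
  have "flow (compile G (Loop b c)) (0, ts) (fst (compile G (Loop b c)), ts)"
    using LoopF by (auto simp: flow_def step_def store_tapes_tops split: prod.splits)
  then show ?case using LoopF by blast
next
  case (LoopT b \<sigma> c \<sigma>' \<sigma>'')
  obtain n \<delta> where c: "compile G c = (n, \<delta>)"
    by fastforce
  let ?M = "compile G (Loop b c)"
  \<comment> \<open>The exit of the body is identified with state 0, the test of the loop.\<close>
  define \<rho> where "\<rho> t = (if t = n then 0 else Suc t)" for t
  obtain ts1 where 1: "store_tapes N \<sigma>' ts1" "(flow (n, \<delta>))\<^sup>*\<^sup>* (0, ts) (n, ts1)"
    using LoopT.IH(1)[of ts] LoopT.prems c by auto
  obtain ts2 where 2: "store_tapes N \<sigma>'' ts2" "(flow ?M)\<^sup>*\<^sup>* (0, ts1) (fst ?M, ts2)"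
    using LoopT.IH(2)[of ts1] LoopT.prems 1 by auto
  have "flow ?M (0, ts) (\<rho> 0, ts)"
    using LoopT.hyps LoopT.prems c by (simp add: flow_def step_def store_tapes_tops \<rho>_def)
  moreover have "\<rho> s < Suc n \<and> snd ?M (\<rho> s) as = map_prod \<rho> id (\<delta> s as)" if "s < n" for s as
    using that c by (simp add: \<rho>_def[abs_def])
  from flow_embed[OF 1(2) this] have "(flow ?M)\<^sup>*\<^sup>* (\<rho> 0, ts) (\<rho> n, ts1)"
    by (simp add: c)
  moreover have "\<rho> n = 0" by (simp add: \<rho>_def)
  ultimately have "(flow ?M)\<^sup>*\<^sup>* (0, ts) (0, ts1)"
    by (metis converse_rtranclp_into_rtranclp)
  then show ?case
    using 2 by (blast intro: rtranclp_trans)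
qed


text \<open>This is what \<open>wf_tm\<close> asks of a transition table; successors may reach the
  exit, which \<open>machine\<close> adds as one more state.\<close>

lemma compile_bounds:
  assumes "s < fst (compile G c)" "width c \<le> N" "0 < G"
    and "length as = Suc N" "set as \<subseteq> {..<G}" "snd (compile G c) s as = (s', acts)"
  shows "s' \<le> fst (compile G c) \<and> length acts = Suc N \<and> fst ` set acts \<subseteq> {..<G}"
proof -
  have idle: "fst ` set (idle as) \<subseteq> {..<G}"
    using assms(5) by (auto simp: idle_def)
  have upd: "a < G" if "(a, b) \<in> set ((idle as)[j := (v, m)])" "v < G" for a b j v m
    using that idle set_update_subset_insert[of "idle as" j "(v, m)"] by fastforce
  have nth: "as ! j < G" if "j < Suc N" for j
    using assms(4,5) nth_mem[of j as] that by (metis lessThan_iff subsetD)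
  show ?thesis
    using assms(1,2,6)
  proof (induction c arbitrary: s s')
    case Skip
    then show ?case by simp
  next
    case (Push i f)
    then show ?case
      using idle nth[of "tape_of i"] assms(3,4)
      by (auto simp: Let_def split: if_splits dest: upd)
  next
    case (Pop i)
    then show ?case
      using idle assms(3,4) by (auto split: if_splits dest: upd)
  next
    case (Seq c d)
    obtain n \<delta> n' \<delta>' where cd: "compile G c = (n, \<delta>)" "compile G d = (n', \<delta>')"
      by fastforce
    show ?case
    proof (cases "s < n")
      case True
      then show ?thesis using Seq.IH(1)[of s s'] Seq.prems cd by simp
    next
      case False
      then show ?thesis
        using Seq.IH(2)[of "s - n" "s' - n"] Seq.prems cd
        by (cases "\<delta>' (s - n) as") auto
    qed
  next
    case (Cond b c d)
    obtain n \<delta> n' \<delta>' where cd: "compile G c = (n, \<delta>)" "compile G d = (n', \<delta>')"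
      by fastforce
    consider "s = 0" | "0 < s" "s \<le> n" | "n < s" by linarith
    then show ?case
    proof cases
      case 1
      then show ?thesis using Cond.prems cd idle assms(4) by (auto split: if_splits)
    next
      case 2
      obtain t where t: "\<delta> (s - 1) as = (t, acts)" "s' = (if t = n then Suc (n + n') else Suc t)"
        using 2 Cond.prems cd by (cases "\<delta> (s - 1) as") auto
      moreover have "s - 1 < n" using 2 by simp
      ultimately show ?thesis
        using Cond.IH(1)[of "s - 1" t] Cond.prems cd by auto
    next
      case 3
      then show ?thesis
        using Cond.IH(2)[of "s - Suc n" "fst (\<delta>' (s - Suc n) as)"] Cond.prems cd
        by (cases "\<delta>' (s - Suc n) as") auto
    qed
  next
    case (Loop b c)
    obtain n \<delta> where c: "compile G c = (n, \<delta>)"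
      by fastforce
    show ?case
    proof (cases "s = 0")
      case True
      then show ?thesis using Loop.prems c idle assms(4) by (auto split: if_splits)
    next
      case False
      then show ?thesis
        using Loop.IH[of "s - 1" "fst (\<delta> (s - 1) as)"] Loop.prems c
        by (cases "\<delta> (s - 1) as") (auto split: if_splits)
    qed
  qed
qed

section \<open>From programs to Turing machines: the output phase\<close>

abbreviation out_reg :: reg where "out_reg \<equiv> Aux 2"

text \<open>At the exit state the machine copies \<open>out_reg\<close> to the separate last tape
  \<open>N\<close>. The copy is needed because a stack begins wherever pushing has left its top,
  whereas \<open>tm_computes\<close> wants the output to begin in cell 0.\<close>

definition machine :: "nat \<Rightarrow> nat \<Rightarrow> com \<Rightarrow> tm" where
  "machine G N c =
     \<lparr>num_states = Suc (fst (compile G c)), num_symbols = G, num_tapes = Suc N,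
      trans = \<lambda>s as.
        if s < fst (compile G c) then Some (snd (compile G c) s as)
        else if s = fst (compile G c) \<and> as ! tape_of out_reg \<noteq> 0
        then Some (s, (idle as)[tape_of out_reg := (0, MoveRight),
                                N := (as ! tape_of out_reg, MoveRight)])
        else None\<rparr>"

text \<open>The bound \<open>8 < N\<close> separates tape 8, which belongs to
  \<open>out_reg\<close>, from the output tape.\<close>

lemma wf_machine:
  assumes "3 \<le> G" "width c \<le> N" "8 < N"
  shows "wf_tm (machine G N c)"
  unfolding wf_tm_def
proof (intro conjI allI impI)
  fix s as s' acts
  assume *: "s < num_states (machine G N c) \<and> length as = num_tapes (machine G N c) \<and>
    set as \<subseteq> {..<num_symbols (machine G N c)} \<and> trans (machine G N c) s as = Some (s', acts)"
  have "s' < num_states (machine G N c) \<and> length acts = num_tapes (machine G N c) \<and>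
    fst ` set acts \<subseteq> {..<num_symbols (machine G N c)}"
  proof (cases "s < fst (compile G c)")
    case True
    then show ?thesis
      using * compile_bounds[OF True assms(2), of as s' acts] assms(1) by (auto simp: machine_def)
  next
    case False
    have "set as \<subseteq> {..<G}" "tape_of out_reg < length as"
      using * assms(3) by (auto simp: machine_def)
    then have "as ! tape_of out_reg < G"
      by (metis lessThan_iff nth_mem subsetD)
    moreover have "fst ` set (idle as) \<subseteq> {..<G}"
      using * by (auto simp: machine_def idle_def)
    moreover have "set ((idle as)[tape_of out_reg := a, N := b]) \<subseteq> insert a (insert b (set (idle as)))"
      for a b
      using set_update_subset_insert[of "(idle as)[tape_of out_reg := a]" N b]
        set_update_subset_insert[of "idle as" "tape_of out_reg" a] by blast
    ultimately have "fst ` set ((idle as)[tape_of out_reg := (0, MoveRight),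
        N := (as ! tape_of out_reg, MoveRight)]) \<subseteq> {..<G}"
      using assms(1) by fastforce
    then show ?thesis
      using * False by (auto simp: machine_def split: if_splits)
  qed
  then show "s' < num_states (machine G N c)" "length acts = num_tapes (machine G N c)"
    "fst ` set acts \<subseteq> {..<num_symbols (machine G N c)}" by auto
qed (use assms in \<open>auto simp: machine_def\<close>)

abbreviation tm_steps :: "tm \<Rightarrow> config \<Rightarrow> config \<Rightarrow> bool" where
  "tm_steps M \<equiv> (\<lambda>c c'. tm_step M c = Some c')\<^sup>*\<^sup>*"

lemma tm_steps_halt_unique:
  assumes "tm_steps M c c1" "tm_step M c1 = None" "tm_steps M c c2" "tm_step M c2 = None"
  shows "c1 = c2"
  using assms(1,3)
proof (induction rule: converse_rtranclp_induct)
  case base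
  then show ?case using assms(2) by (cases rule: converse_rtranclpE) auto
next
  case (step c c')
  from step.prems show ?case
    by (cases rule: converse_rtranclpE) (use step assms(4) in auto)
qed

text \<open>By determinism one halting run settles all outputs, including the absence of
  any.\<close>

lemma tm_computes_iff:
  assumes "tm_steps M (init_config M xs) c" "tm_step M c = None"
  shows "tm_computes M xs z \<longleftrightarrow> fst (last (snd c)) = cells z"
  unfolding tm_computes_def using assms tm_steps_halt_unique[OF assms] by blast

definition bits :: "bool list \<Rightarrow> nat list" where
  "bits = map (\<lambda>b. if b then 2 else 1)"

lemma bits_simps [simp]:
  "bits [] = []" "bits (b # xs) = (if b then 2 else 1) # bits xs"
  "bits (xs @ ys) = bits xs @ bits ys" "length (bits xs) = length xs"
  "rev (bits xs) = bits (rev xs)"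
  by (auto simp: bits_def rev_map)

lemma set_bits: "set (bits xs) \<subseteq> {1, 2}"
  by (auto simp: bits_def)

text \<open>Generalizes \<open>cells\<close> to words over the tape alphabet, because a rejecting
  run emits the symbol 3.\<close>

definition word_cells :: "nat list \<Rightarrow> int \<Rightarrow> nat" where
  "word_cells xs k = (if 0 \<le> k \<and> k < int (length xs) then xs ! nat k else 0)"

lemma cells_eq: "cells z = word_cells (bits z)"
  by (auto simp: cells_def word_cells_def bits_def fun_eq_iff)

lemma word_cells_inject:
  assumes "0 \<notin> set xs" "0 \<notin> set ys" "word_cells xs = word_cells ys"
  shows "xs = ys"
proof (rule nth_equalityI)
  have le: "length us \<le> length vs"
    if "0 \<notin> set us" "word_cells us = word_cells vs" for us vs
  proof (rule ccontr)
    assume "\<not> length us \<le> length vs"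
    moreover have "word_cells us (int (length vs)) = word_cells vs (int (length vs))"
      using that by simp
    ultimately show False using that(1) nth_mem[of "length vs" us] by (simp add: word_cells_def)
  qed
  show "length xs = length ys"
    using le[of xs ys] le[of ys xs] assms by auto
  fix i assume "i < length xs"
  then show "xs ! i = ys ! i"
    using fun_cong[OF assms(3), of "int i"] \<open>length xs = length ys\<close> by (simp add: word_cells_def)
qed

text \<open>The induction generalizes over the part \<open>ys\<close> already copied. The stack is
  read top first and the output is written rightwards, so the order is kept.\<close>

lemma output_phase:
  assumes "length ts = Suc N" "8 < N" "stack_tape xs (ts ! tape_of out_reg)"
    and "ts ! N = (word_cells ys, int (length ys))"
  shows "\<exists>ts'. tm_steps (machine G N c) (fst (compile G c), ts) (fst (compile G c), ts') \<and>
    tm_step (machine G N c) (fst (compile G c), ts') = None \<and> length ts' = Suc N \<and>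
    fst (ts' ! N) = word_cells (ys @ xs)"
  using assms(1,3,4)
proof (induction xs arbitrary: ts ys)
  case Nil
  then have "tm_step (machine G N c) (fst (compile G c), ts) = None"
    using stack_tape_read[OF Nil(2)] assms(2) by (simp add: tm_step_def machine_def)
  then show ?case using Nil by auto
next
  case (Cons x xs)
  let ?o = "tape_of out_reg"
  define ts1 where "ts1 = ts[?o := act (0, MoveRight) (ts ! ?o), N := act (x, MoveRight) (ts ! N)]"
  have x: "fst (ts ! ?o) (snd (ts ! ?o)) = x"
    using stack_tape_read[OF Cons(3)] by simp
  have "x \<noteq> 0" using Cons(3) by (auto simp: stack_tape_def)
  let ?as = "map (\<lambda>t. fst t (snd t)) ts"
  have "map2 act ((idle ?as)[?o := (0, MoveRight), N := (x, MoveRight)]) ts = ts1"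
    using Cons(2) assms(2) unfolding ts1_def
    by (intro nth_equalityI) (auto simp: idle_def act_def nth_list_update)
  then have "tm_step (machine G N c) (fst (compile G c), ts) = Some (fst (compile G c), ts1)"
    using x \<open>x \<noteq> 0\<close> Cons(2) assms(2) by (simp add: tm_step_def machine_def)
  moreover have "stack_tape xs (ts1 ! ?o)"
    using stack_tape_pop[OF Cons(3)] Cons(2) assms(2) by (simp add: ts1_def nth_list_update)
  moreover have "ts1 ! N = (word_cells (ys @ [x]), int (length (ys @ [x])))"
    using Cons(2,4) assms(2)
    by (auto simp: ts1_def act_def word_cells_def fun_eq_iff nth_append)
  ultimately show ?case
    using Cons.IH[of ts1 "ys @ [x]"] Cons(2)
    by (auto simp: ts1_def intro: converse_rtranclp_into_rtranclp)
qed

definition input_store :: "bool list \<Rightarrow> bool list \<Rightarrow> store" where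
  "input_store p y = (\<lambda>_. [])(Aux 0 := bits p, Rgt 0 := bits y)"

text \<open>The equivalence is used in both directions: to exhibit outputs, and to see that a run
  leaving a symbol other than a bit on \<open>out_reg\<close> has no output.\<close>

theorem machine_computes:
  assumes "exec G c (input_store p y) \<sigma>" "width c \<le> N" "8 < N"
  shows "tm_computes (machine G N c) [p, y] z \<longleftrightarrow> \<sigma> out_reg = bits z"
proof -
  let ?V = "machine G N c" and ?n = "fst (compile G c)"
  define ts where "ts = snd (init_config ?V [p, y])"
  have stack: "stack_tape (bits x) (cells x, 0)" for x
    using set_bits[of x] by (auto simp: stack_tape_def cells_eq word_cells_def)
  have nth: "ts ! j = (cells (if j = 0 then p else if j = 1 then y else []), 0)" if "j \<le> N" for j
    using that nth_upt[of 0 j "Suc N"] by (auto simp: ts_def init_config_def machine_def simp del: upt_Suc)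
  have empty: "cells [] = (\<lambda>_. 0)"
    by (auto simp: cells_def)
  have tape0: "tape_of i = 0 \<longleftrightarrow> i = Aux 0" and tape1: "tape_of i = 1 \<longleftrightarrow> i = Rgt 0" for i
    using tape_of_inject[of i "Aux 0"] tape_of_inject[of i "Rgt 0"] by auto
  have "store_tapes N (input_store p y) ts"
    unfolding store_tapes_def
  proof (intro conjI allI)
    show "length ts = Suc N" by (simp add: ts_def init_config_def machine_def)
    show "ts ! N = (\<lambda>_. 0, 0)" using nth[of N] assms(3) empty by simp
    fix i
    show "if tape_of i < N then stack_tape (input_store p y i) (ts ! tape_of i)
      else input_store p y i = []"
      using nth[of "tape_of i"] stack[of p] stack[of y] stack[of "[]"] assms(3) tape0[of i] tape1[of i]
      by (auto simp: input_store_def)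
  qed
  then obtain ts1 where ts1: "store_tapes N \<sigma> ts1"
    "(flow (compile G c))\<^sup>*\<^sup>* (0, ts) (?n, ts1)"
    using compile_correct[OF assms(1,2)] by blast
  have flow: "flow (compile G c) a b \<Longrightarrow> tm_step ?V a = Some b" for a b
    by (auto simp: flow_def step_def tm_step_def machine_def split: prod.splits)
  have "tm_steps ?V a b" if "(flow (compile G c))\<^sup>*\<^sup>* a b" for a b
    using that
  proof induction
    case (step b b')
    show ?case using step.IH flow[OF step.hyps(2)] by (rule rtranclp.rtrancl_into_rtrancl)
  qed simp
  then have "tm_steps ?V (0, ts) (?n, ts1)"
    using ts1(2) .
  moreover have "if tape_of out_reg < N then stack_tape (\<sigma> out_reg) (ts1 ! tape_of out_reg)
      else \<sigma> out_reg = []"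
    using ts1(1) unfolding store_tapes_def by blast
  then have out: "length ts1 = Suc N" "stack_tape (\<sigma> out_reg) (ts1 ! tape_of out_reg)"
    "ts1 ! N = (word_cells [], int (length []))"
    using ts1(1) assms(3) by (simp_all add: store_tapes_def word_cells_def fun_eq_iff)
  then obtain ts2 where ts2: "tm_steps ?V (?n, ts1) (?n, ts2)"
    "tm_step ?V (?n, ts2) = None" "length ts2 = Suc N" "fst (ts2 ! N) = word_cells (\<sigma> out_reg)"
    using output_phase[OF out(1) assms(3) out(2,3)] by auto
  moreover have "init_config ?V [p, y] = (0, ts)"
    by (simp add: ts_def init_config_def)
  ultimately have "tm_steps ?V (init_config ?V [p, y]) (?n, ts2)"
    by simp
  then have "tm_computes ?V [p, y] z \<longleftrightarrow> word_cells (\<sigma> out_reg) = word_cells (bits z)"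
    using tm_computes_iff[OF _ ts2(2)] ts2(3,4) by (simp add: last_conv_nth cells_eq flip: length_greater_0_conv)
  moreover have "0 \<notin> set (\<sigma> out_reg)"
    using out(2) by (simp add: stack_tape_def)
  moreover have "0 \<notin> set (bits z)"
    using set_bits[of z] by auto
  ultimately show ?thesis
    using word_cells_inject by metis
qed

section \<open>Derived commands\<close>

lemma exec_push:
  assumes "v = f (\<lambda>r. peek (\<sigma> r))" "0 < v" "v < G" "\<sigma>' = \<sigma>(i := v # \<sigma> i)"
  shows "exec G (Push i f) \<sigma> \<sigma>'"
  using assms exec.Push by blast

lemma exec_pop: "\<sigma>' = \<sigma>(i := tl (\<sigma> i)) \<Longrightarrow> exec G (Pop i) \<sigma> \<sigma>'"
  using exec.Pop by blast

definition seqs :: "com list \<Rightarrow> com" where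
  "seqs cs = foldr (;;) cs Skip"

lemma exec_seqs_Nil: "exec G (seqs []) \<sigma> \<sigma>"
  by (simp add: seqs_def exec.Skip)

text \<open>Programs over a range of tapes are verified by induction on the upper end of the range,
  hence the extension at the end.\<close>

lemma exec_seqs_snoc:
  assumes "exec G (seqs cs) \<sigma> \<sigma>'" "exec G c \<sigma>' \<sigma>''"
  shows "exec G (seqs (cs @ [c])) \<sigma> \<sigma>''"
  using assms
proof (induction cs arbitrary: \<sigma>)
  case Nil
  then show ?case by (auto simp: seqs_def intro: exec.intros elim: exec.cases)
next
  case (Cons d cs)
  from Cons.prems(1) obtain \<tau> where "exec G d \<sigma> \<tau>" "exec G (seqs cs) \<tau> \<sigma>'"
    by (auto simp: seqs_def elim: exec.cases)
  then show ?case using Cons by (auto simp: seqs_def intro: exec.Seq)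
qed

definition clear :: "reg \<Rightarrow> com" where
  "clear i = Loop (\<lambda>t. t i \<noteq> 0) (Pop i)"

lemma exec_clear:
  assumes "0 \<notin> set (\<sigma> i)"
  shows "exec G (clear i) \<sigma> (\<sigma>(i := []))"
  using assms
proof (induction "\<sigma> i" arbitrary: \<sigma>)
  case Nil
  then have "\<sigma>(i := []) = \<sigma>" by auto
  then show ?case using Nil by (auto simp: clear_def intro: exec.LoopF)
next
  case (Cons x xs)
  have "exec G (clear i) (\<sigma>(i := xs)) ((\<sigma>(i := xs))(i := []))"
    using Cons(1)[of "\<sigma>(i := xs)"] Cons(2,3) by (metis fun_upd_same list.set_intros(2))
  moreover have "exec G (Pop i) \<sigma> (\<sigma>(i := xs))"
    by (rule exec_pop) (simp flip: Cons(2))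
  moreover have "peek (\<sigma> i) \<noteq> 0"
    using Cons(2,3) by (metis list.set_intros(1) peek.simps(2))
  ultimately show ?case
    unfolding clear_def by (auto intro: exec.LoopT)
qed

text \<open>The stack arrives reversed on top of \<open>j\<close>. Symbols that \<open>g\<close>
  sends to 0 are dropped, as pushing 0 has no effect; the command thus also works as a
  filter.\<close>

definition move_map :: "reg \<Rightarrow> reg \<Rightarrow> (nat \<Rightarrow> nat) \<Rightarrow> com" where
  "move_map i j g = Loop (\<lambda>t. t i \<noteq> 0) (Push j (\<lambda>t. g (t i)) ;; Pop i)"

lemma exec_move_map:
  assumes "i \<noteq> j" "0 \<notin> set (\<sigma> i)"
  shows "exec G (move_map i j g) \<sigma>
    (\<sigma>(i := [], j := rev (filter (\<lambda>v. 0 < v \<and> v < G) (map g (\<sigma> i))) @ \<sigma> j))"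
  using assms
proof (induction "\<sigma> i" arbitrary: \<sigma>)
  case Nil
  then have "\<sigma>(i := []) = \<sigma>" by auto
  then show ?case using Nil by (auto simp: move_map_def intro: exec.LoopF)
next
  case (Cons x xs)
  define \<sigma>1 where "\<sigma>1 = (if 0 < g x \<and> g x < G then \<sigma>(j := g x # \<sigma> j) else \<sigma>)"
  define \<sigma>2 where "\<sigma>2 = \<sigma>1(i := xs)"
  have x: "x \<noteq> 0" using Cons(2,4) by (metis list.set_intros(1))
  have push: "exec G (Push j (\<lambda>t. g (t i))) \<sigma> \<sigma>1"
    using Cons(2)[symmetric] by (auto simp: \<sigma>1_def intro: exec.NoPush exec_push)
  have pop: "exec G (Pop i) \<sigma>1 \<sigma>2"
    using Cons(2)[symmetric] assms(1) by (auto simp: \<sigma>1_def \<sigma>2_def intro!: exec_pop)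
  have rest: "exec G (move_map i j g) \<sigma>2
      (\<sigma>2(i := [], j := rev (filter (\<lambda>v. 0 < v \<and> v < G) (map g (\<sigma>2 i))) @ \<sigma>2 j))"
    using Cons(2,4) by (intro Cons(1) assms(1)) (auto simp: \<sigma>2_def simp flip: Cons(2))
  have eq: "\<sigma>2(i := [], j := rev (filter (\<lambda>v. 0 < v \<and> v < G) (map g (\<sigma>2 i))) @ \<sigma>2 j) =
      \<sigma>(i := [], j := rev (filter (\<lambda>v. 0 < v \<and> v < G) (map g (\<sigma> i))) @ \<sigma> j)"
    using assms(1) by (auto simp: \<sigma>2_def \<sigma>1_def fun_eq_iff simp flip: Cons(2))
  have "peek (\<sigma> i) \<noteq> 0"
    using x by (simp flip: Cons(2))
  then show ?case
    using rest unfolding eq unfolding move_map_def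
    by (rule exec.LoopT[OF _ exec.Seq[OF push pop]])
qed

lemma exec_move:
  assumes "i \<noteq> j" "0 \<notin> set (\<sigma> i)" "\<And>v. v \<in> set (\<sigma> i) \<Longrightarrow> 0 < g v \<and> g v < G"
    and "\<sigma>' = \<sigma>(i := [], j := rev (map g (\<sigma> i)) @ \<sigma> j)"
  shows "exec G (move_map i j g) \<sigma> \<sigma>'"
proof -
  have "filter (\<lambda>v. 0 < v \<and> v < G) (map g (\<sigma> i)) = map g (\<sigma> i)"
    using assms(3) by (auto simp: filter_id_conv)
  then show ?thesis using exec_move_map[of i j \<sigma> G g] assms by simp
qed


section \<open>Running a Turing machine on stacks\<close>

definition nth_sym :: "nat list \<Rightarrow> nat \<Rightarrow> nat" where
  "nth_sym xs i = (if i < length xs then xs ! i - 1 else 0)"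

lemma nth_sym_simps [simp]:
  "nth_sym [] i = 0" "nth_sym (x # xs) 0 = x - 1" "nth_sym (x # xs) (Suc i) = nth_sym xs i"
  "nth_sym (tl xs) i = nth_sym xs (Suc i)" "nth_sym xs 0 = peek xs - 1"
  by (cases xs; auto simp: nth_sym_def)+

text \<open>
  The stacks \<open>ls\<close> and \<open>rs\<close> hold the part of the tape visited so far, left of the head and from the
  head on; a symbol \<open>a\<close> is stored as \<open>a + 1\<close>, since 0 marks the end of a stack.
\<close>

definition zipper :: "nat \<Rightarrow> nat list \<Rightarrow> nat list \<Rightarrow> tape \<Rightarrow> bool" where
  "zipper n ls rs t \<longleftrightarrow> set ls \<subseteq> {1..n} \<and> set rs \<subseteq> {1..n} \<and>
     (\<forall>i. fst t (snd t + int i) = nth_sym rs i) \<and> (\<forall>i. fst t (snd t - 1 - int i) = nth_sym ls i)"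

lemma zipper_read: "zipper n ls rs t \<Longrightarrow> fst t (snd t) = peek rs - 1"
  by (auto simp: zipper_def dest!: spec[where x = 0])

text \<open>Moving left beyond the visited part exposes a blank, stored as 1: \<open>max 1\<close>
  produces it from the 0 read on an empty left stack. Moving right needs no such care, since an
  empty right stack already reads as blanks.\<close>

lemma zipper_act:
  assumes "zipper n ls rs t" "a < n"
  shows "zipper n ls (Suc a # tl rs) (act (a, Stay) t)"
    and "zipper n (Suc a # ls) (tl rs) (act (a, MoveRight) t)"
    and "zipper n (tl ls) (max 1 (peek ls) # Suc a # tl rs) (act (a, MoveLeft) t)"
proof -
  have sub: "set (tl xs) \<subseteq> set xs" for xs :: "nat list" by (cases xs) auto
  have pk: "xs = [] \<or> peek xs \<in> set xs" for xs by (cases xs) auto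
  have r: "fst t (snd t + int i) = nth_sym rs i" and l: "fst t (snd t - 1 - int i) = nth_sym ls i" for i
    using assms(1) by (auto simp: zipper_def)
  have r': "fst t (snd t + 1 + int i) = nth_sym rs (Suc i)" for i
    using r[of "Suc i"] by (simp add: algebra_simps)
  have l': "fst t (snd t - 1 - 1 - int i) = nth_sym ls (Suc i)" for i
    using l[of "Suc i"] by (simp add: algebra_simps)
  have s: "set ls \<subseteq> {1..n}" "set rs \<subseteq> {1..n}" "set (tl ls) \<subseteq> {1..n}" "set (tl rs) \<subseteq> {1..n}"
    using assms(1) sub by (auto simp: zipper_def)
  have m: "max 1 (peek ls) \<in> {1..n}"
    using s(1) pk[of ls] assms(2) by auto
  show "zipper n ls (Suc a # tl rs) (act (a, Stay) t)"
    unfolding zipper_def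
  proof (intro conjI allI)
    fix i
    show "fst (act (a, Stay) t) (snd (act (a, Stay) t) + int i) = nth_sym (Suc a # tl rs) i"
      using r' by (cases i) (auto simp: act_def algebra_simps)
    show "fst (act (a, Stay) t) (snd (act (a, Stay) t) - 1 - int i) = nth_sym ls i"
      using l by (auto simp: act_def)
  qed (use s assms(2) in auto)
  show "zipper n (Suc a # ls) (tl rs) (act (a, MoveRight) t)"
    unfolding zipper_def
  proof (intro conjI allI)
    fix i
    show "fst (act (a, MoveRight) t) (snd (act (a, MoveRight) t) + int i) = nth_sym (tl rs) i"
      using r' by (auto simp: act_def)
    show "fst (act (a, MoveRight) t) (snd (act (a, MoveRight) t) - 1 - int i) = nth_sym (Suc a # ls) i"
    proof (cases i)
      case (Suc i')
      then show ?thesis using l[of i'] by (auto simp: act_def algebra_simps)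
    qed (simp add: act_def)
  qed (use s assms(2) in auto)
  show "zipper n (tl ls) (max 1 (peek ls) # Suc a # tl rs) (act (a, MoveLeft) t)"
    unfolding zipper_def
  proof (intro conjI allI)
    fix i
    consider "i = 0" | "i = 1" | i' where "i = Suc (Suc i')"
      by (metis One_nat_def not0_implies_Suc)
    then show "fst (act (a, MoveLeft) t) (snd (act (a, MoveLeft) t) + int i) =
      nth_sym (max 1 (peek ls) # Suc a # tl rs) i"
    proof cases
      case 1
      then show ?thesis using l[of 0] by (auto simp: act_def max_def)
    next
      case (3 i')
      then show ?thesis using r'[of i'] by (auto simp: act_def algebra_simps)
    qed (simp add: act_def)
    show "fst (act (a, MoveLeft) t) (snd (act (a, MoveLeft) t) - 1 - int i) = nth_sym (tl ls) i"
      using l'[of i] by (auto simp: act_def)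
  qed (use s assms(2) m in auto)
qed

lemma zipper_init: "3 \<le> n \<Longrightarrow> zipper n [] (map Suc (bits x)) (cells x, 0)"
  by (auto simp: zipper_def cells_def bits_def nth_sym_def)

text \<open>The visited window \<open>W\<close>, starting in cell \<open>h\<close>, contains every
  nonblank cell. A bit string has no blanks inside, so deleting the stored blanks, the entries 1,
  leaves exactly the output.\<close>

lemma zipper_word:
  assumes "zipper n ls rs t" "fst t = cells z"
  shows "filter (\<lambda>v. v \<noteq> 1) (rev ls @ rs) = map Suc (bits z)"
proof -
  define W where "W = rev ls @ rs"
  define h where "h = snd t - int (length ls)"
  have pos: "v \<ge> 1" if "v \<in> set W" for v
    using assms(1) that by (auto simp: zipper_def W_def)
  have inside: "cells z (h + int i) = W ! i - 1" if "i < length W" for i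
  proof (cases "i < length ls")
    case True
    then show ?thesis
      using assms spec[of "\<lambda>i. fst t (snd t - 1 - int i) = nth_sym ls i" "length ls - 1 - i"]
      by (auto simp: zipper_def W_def h_def nth_sym_def nth_append rev_nth of_nat_diff algebra_simps)
  next
    case False
    then show ?thesis
      using assms that spec[of "\<lambda>i. fst t (snd t + int i) = nth_sym rs i" "i - length ls"]
      by (auto simp: zipper_def W_def h_def nth_sym_def nth_append of_nat_diff algebra_simps)
  qed
  have right: "cells z (h + int i) = 0" if "length W \<le> i" for i
    using assms that spec[of "\<lambda>i. fst t (snd t + int i) = nth_sym rs i" "i - length ls"]
    by (auto simp: zipper_def W_def h_def nth_sym_def of_nat_diff algebra_simps)
  have left: "cells z k = 0" if "k < h" for k
    using assms that spec[of "\<lambda>i. fst t (snd t - 1 - int i) = nth_sym ls i" "nat (snd t - 1 - k)"]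
    by (auto simp: zipper_def h_def nth_sym_def algebra_simps)
  show ?thesis
  proof (cases "z = []")
    case True
    then have "cells z k = 0" for k
      by (auto simp: cells_def)
    then have "W ! i = 1" if "i < length W" for i
      using inside[OF that] pos[of "W ! i"] nth_mem[OF that] by simp
    then have "\<forall>v \<in> set W. v = 1" by (metis in_set_conv_nth)
    then show ?thesis using True by (auto simp: filter_empty_conv W_def[symmetric])
  next
    case False
    \<comment> \<open>Cell 0 is nonblank, so the window starts there or further left;
      \<open>a\<close> is the number of blanks in front of the word.\<close>
    have "cells z 0 \<noteq> 0"
      using False by (simp add: cells_def)
    then have "h \<le> 0"
      using left[of 0] by linarith
    define a where "a = nat (- h)"
    have h: "h = - int a" using \<open>h \<le> 0\<close> by (simp add: a_def)
    have len: "a + length z \<le> length W"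
    proof (rule ccontr)
      assume "\<not> ?thesis"
      then have "cells z (h + int (a + length z - 1)) = 0"
        by (intro right) simp
      moreover have "int (a + length z - 1) = int a + int (length z) - 1"
        using False by (cases z) auto
      ultimately have "cells z (int (length z) - 1) = 0"
        using h by simp
      then show False using False by (cases z) (auto simp: cells_def split: if_splits)
    qed
    have W: "W = take a W @ take (length z) (drop a W) @ drop (length z) (drop a W)"
      by (metis append_take_drop_id)
    have one: "W ! i = 1" if "i < length W" "i < a \<or> a + length z \<le> i" for i
      using inside[OF that(1)] pos[of "W ! i"] that h by (auto simp: cells_def)
    have "\<forall>v \<in> set (take a W). v = 1"
      using one len by (auto simp: in_set_conv_nth)
    moreover have "\<forall>v \<in> set (drop (length z) (drop a W)). v = 1"
      using one len by (auto simp: in_set_conv_nth)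
    moreover have mid: "take (length z) (drop a W) = map Suc (bits z)"
    proof (rule nth_equalityI)
      fix i assume "i < length (take (length z) (drop a W))"
      then have i: "i < length z" "a + i < length W" using len by auto
      then show "take (length z) (drop a W) ! i = map Suc (bits z) ! i"
        using inside[of "a + i"] pos[of "W ! (a + i)"] h
        by (auto simp: cells_def bits_def split: if_splits)
    qed (use len in auto)
    ultimately have "filter (\<lambda>v. v \<noteq> 1) W = filter (\<lambda>v. v \<noteq> 1) (map Suc (bits z))"
      by (subst W) (auto simp: filter_empty_conv)
    also have "\<dots> = map Suc (bits z)"
      by (auto simp: bits_def filter_id_conv)
    finally show ?thesis by (simp add: W_def)
  qed
qed


section \<open>Simulation of a single step\<close>

abbreviation state_reg :: reg where "state_reg \<equiv> Aux 3"

text \<open>The tops alone determine the move: they show the state and the scanned symbols, each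
  shifted by one. Truncated subtraction reads an empty stack as a blank.\<close>

definition next_move :: "tm \<Rightarrow> (reg \<Rightarrow> nat) \<Rightarrow> (nat \<times> (nat \<times> move) list) option" where
  "next_move M t = trans M (t state_reg - 1) (map (\<lambda>j. t (Rgt j) - 1) [0..<num_tapes M])"

primrec move_code :: "move \<Rightarrow> nat" where
  "move_code MoveLeft = 0"
| "move_code Stay = 1"
| "move_code MoveRight = 2"

text \<open>An action packed into one nonzero symbol. Dividing by 3 gives the written symbol already
  shifted by one, the remainder gives the move.\<close>

definition act_code :: "nat \<times> move \<Rightarrow> nat" where
  "act_code a = 3 * Suc (fst a) + move_code (snd a)"

definition perform :: "nat \<Rightarrow> com" where
  "perform j =
     Pop (Rgt j) ;; Push (Rgt j) (\<lambda>t. t (Cmd j) div 3) ;;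
     Cond (\<lambda>t. t (Cmd j) mod 3 = 2) (Push (Lft j) (\<lambda>t. t (Rgt j)) ;; Pop (Rgt j))
       (Cond (\<lambda>t. t (Cmd j) mod 3 = 0) (Push (Rgt j) (\<lambda>t. max 1 (t (Lft j))) ;; Pop (Lft j)) Skip) ;;
     Pop (Cmd j)"

lemma exec_perform:
  assumes "zipper n (\<sigma> (Lft j)) (\<sigma> (Rgt j)) t" "\<sigma> (Cmd j) = [act_code a]" "fst a < n" "n < G"
  shows "\<exists>ls rs. exec G (perform j) \<sigma> (\<sigma>(Rgt j := rs, Lft j := ls, Cmd j := [])) \<and>
    zipper n ls rs (act a t)"
proof -
  obtain s m where a: "a = (s, m)" by fastforce
  let ?ls = "\<sigma> (Lft j)" and ?rs = "\<sigma> (Rgt j)"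
  define \<sigma>1 where "\<sigma>1 = \<sigma>(Rgt j := tl ?rs)"
  define \<sigma>2 where "\<sigma>2 = \<sigma>(Rgt j := Suc s # tl ?rs)"
  have code: "act_code a div 3 = Suc s" "act_code a mod 3 = move_code m"
    by (cases m; simp add: act_code_def a)+
  have 1: "exec G (Pop (Rgt j)) \<sigma> \<sigma>1"
    by (simp add: exec_pop \<sigma>1_def)
  have 2: "exec G (Push (Rgt j) (\<lambda>t. t (Cmd j) div 3)) \<sigma>1 \<sigma>2"
    by (rule exec_push) (use assms code a in \<open>auto simp: \<sigma>1_def \<sigma>2_def\<close>)
  let ?c = "Cond (\<lambda>t. t (Cmd j) mod 3 = 2) (Push (Lft j) (\<lambda>t. t (Rgt j)) ;; Pop (Rgt j))
       (Cond (\<lambda>t. t (Cmd j) mod 3 = 0) (Push (Rgt j) (\<lambda>t. max 1 (t (Lft j))) ;; Pop (Lft j)) Skip)"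
  have "\<exists>ls rs. exec G ?c \<sigma>2 (\<sigma>(Rgt j := rs, Lft j := ls)) \<and> zipper n ls rs (act a t)"
  proof (cases m)
    case MoveLeft
    define \<sigma>3 where "\<sigma>3 = \<sigma>(Rgt j := max 1 (peek ?ls) # Suc s # tl ?rs)"
    have "max 1 (peek ?ls) < G"
      using assms by (cases ?ls) (auto simp: zipper_def)
    then have "exec G (Push (Rgt j) (\<lambda>t. max 1 (t (Lft j)))) \<sigma>2 \<sigma>3"
      by (intro exec_push) (auto simp: \<sigma>2_def \<sigma>3_def)
    moreover have "exec G (Pop (Lft j)) \<sigma>3
        (\<sigma>(Rgt j := max 1 (peek ?ls) # Suc s # tl ?rs, Lft j := tl ?ls))"
      by (rule exec_pop) (auto simp: \<sigma>3_def)
    ultimately have "exec G ?c \<sigma>2 (\<sigma>(Rgt j := max 1 (peek ?ls) # Suc s # tl ?rs, Lft j := tl ?ls))"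
      using assms(2) code MoveLeft by (intro exec.CondF exec.CondT exec.Seq) (auto simp: \<sigma>2_def)
    then show ?thesis using zipper_act(3)[OF assms(1), of s] assms(3) a MoveLeft by auto
  next
    case Stay
    have "\<sigma>2 = \<sigma>(Rgt j := Suc s # tl ?rs, Lft j := ?ls)"
      by (auto simp: \<sigma>2_def)
    moreover have "exec G ?c \<sigma>2 \<sigma>2"
      using assms(2) code Stay by (intro exec.CondF exec.Skip) (auto simp: \<sigma>2_def)
    ultimately have "exec G ?c \<sigma>2 (\<sigma>(Rgt j := Suc s # tl ?rs, Lft j := ?ls))"
      by simp
    moreover have "zipper n ?ls (Suc s # tl ?rs) (act a t)"
      using zipper_act(1)[OF assms(1), of s] assms(3) a Stay by simp
    ultimately show ?thesis by blast
  next
    case MoveRight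
    define \<sigma>3 where "\<sigma>3 = \<sigma>2(Lft j := Suc s # ?ls)"
    have "exec G (Push (Lft j) (\<lambda>t. t (Rgt j))) \<sigma>2 \<sigma>3"
      using assms a by (intro exec_push) (auto simp: \<sigma>2_def \<sigma>3_def)
    moreover have "exec G (Pop (Rgt j)) \<sigma>3 (\<sigma>(Rgt j := tl ?rs, Lft j := Suc s # ?ls))"
      by (rule exec_pop) (auto simp: \<sigma>3_def \<sigma>2_def)
    ultimately have "exec G ?c \<sigma>2 (\<sigma>(Rgt j := tl ?rs, Lft j := Suc s # ?ls))"
      using assms(2) code MoveRight by (intro exec.CondT exec.Seq) (auto simp: \<sigma>2_def)
    then show ?thesis using zipper_act(2)[OF assms(1), of s] assms(3) a MoveRight by auto
  qed
  then obtain ls rs where 3: "exec G ?c \<sigma>2 (\<sigma>(Rgt j := rs, Lft j := ls))" "zipper n ls rs (act a t)"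
    by blast
  have "exec G (Pop (Cmd j)) (\<sigma>(Rgt j := rs, Lft j := ls)) (\<sigma>(Rgt j := rs, Lft j := ls, Cmd j := []))"
    by (rule exec_pop) (use assms in auto)
  then have "exec G (perform j) \<sigma> (\<sigma>(Rgt j := rs, Lft j := ls, Cmd j := []))"
    unfolding perform_def using 1 2 3(1) by (blast intro: exec.Seq)
  then show ?thesis using 3(2) by blast
qed

text \<open>Every command sees only the current tops, so all actions are put on \<open>Cmd\<close>
  before the state or any tape changes; \<open>perform\<close> then relies on these records.\<close>

definition step_com :: "tm \<Rightarrow> com" where
  "step_com M =
     seqs (map (\<lambda>j. Push (Cmd j) (\<lambda>t. act_code (snd (the (next_move M t)) ! j))) [0..<num_tapes M]) ;;
     Push state_reg (\<lambda>t. Suc (fst (the (next_move M t)))) ;;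
     seqs (map perform [0..<num_tapes M])"

text \<open>Earlier states are left below the current one on the state stack.\<close>

definition simulates :: "tm \<Rightarrow> store \<Rightarrow> config \<Rightarrow> store \<Rightarrow> bool" where
  "simulates M \<sigma>\<^sub>0 c \<sigma> \<longleftrightarrow> fst c < num_states M \<and> length (snd c) = num_tapes M \<and>
     peek (\<sigma> state_reg) = Suc (fst c) \<and> 0 \<notin> set (\<sigma> state_reg) \<and>
     (\<forall>j<num_tapes M. zipper (num_symbols M) (\<sigma> (Lft j)) (\<sigma> (Rgt j)) (snd c ! j)) \<and>
     (\<forall>r. r \<noteq> state_reg \<longrightarrow> (\<forall>j<num_tapes M. r \<noteq> Lft j \<and> r \<noteq> Rgt j) \<longrightarrow> \<sigma> r = \<sigma>\<^sub>0 r)"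

lemma simulates_next_move:
  assumes "simulates M \<sigma>\<^sub>0 c \<sigma>"
  shows "next_move M (\<lambda>r. peek (\<sigma> r)) = trans M (fst c) (map (\<lambda>t. fst t (snd t)) (snd c))"
proof -
  have "map (\<lambda>j. peek (\<sigma> (Rgt j)) - 1) [0..<num_tapes M] = map (\<lambda>t. fst t (snd t)) (snd c)"
    using assms by (intro nth_equalityI) (auto simp: simulates_def zipper_read)
  then show ?thesis using assms by (simp add: next_move_def simulates_def)
qed

lemma simulates_read:
  assumes "simulates M \<sigma>\<^sub>0 c \<sigma>" "wf_tm M"
  shows "set (map (\<lambda>t. fst t (snd t)) (snd c)) \<subseteq> {..<num_symbols M}"
proof
  fix v assume "v \<in> set (map (\<lambda>t. fst t (snd t)) (snd c))"
  then obtain j where j: "j < num_tapes M" "v = fst (snd c ! j) (snd (snd c ! j))"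
    using assms(1) by (auto simp: in_set_conv_nth simulates_def)
  then have z: "zipper (num_symbols M) (\<sigma> (Lft j)) (\<sigma> (Rgt j)) (snd c ! j)"
    using assms(1) by (auto simp: simulates_def)
  have "0 < num_symbols M" using assms(2) by (auto simp: wf_tm_def)
  then show "v \<in> {..<num_symbols M}"
    using zipper_read[OF z] z j(2) by (cases "\<sigma> (Rgt j)") (auto simp: zipper_def)
qed

text \<open>The bounds on \<open>G\<close> leave room for a shifted state, at most
  \<open>num_states M\<close>, and for a packed action, at most
  \<open>3 * num_symbols M + 2\<close>.\<close>

lemma exec_step_com:
  assumes sim: "simulates M \<sigma>\<^sub>0 c \<sigma>" and step: "tm_step M c = Some c'" and wf: "wf_tm M"
    and cmd: "\<And>j. \<sigma>\<^sub>0 (Cmd j) = []"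
    and G: "Suc (num_states M) < G" "3 * num_symbols M + 3 < G"
  shows "\<exists>\<sigma>'. exec G (step_com M) \<sigma> \<sigma>' \<and> simulates M \<sigma>\<^sub>0 c' \<sigma>'"
proof -
  let ?T = "num_tapes M" and ?n = "num_symbols M"
  obtain s' acts where tr: "trans M (fst c) (map (\<lambda>t. fst t (snd t)) (snd c)) = Some (s', acts)"
    and c': "c' = (s', map2 act acts (snd c))"
    using step by (auto simp: tm_step_def split: option.splits)
  have bnd: "s' < num_states M" "length acts = ?T" "fst ` set acts \<subseteq> {..<?n}"
    using wf sim tr simulates_read[OF sim wf] unfolding wf_tm_def simulates_def
    by (metis length_map)+
  have act_lt: "fst (acts ! j) < ?n" if "j < ?T" for j
    using bnd(2,3) that nth_mem[of j acts] by (metis imageI lessThan_iff subsetD)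
  have code_lt: "act_code (acts ! j) < G" if "j < ?T" for j
    using act_lt[OF that] G(2) by (cases "snd (acts ! j)") (auto simp: act_code_def)
  define push where "push = (\<lambda>j. Push (Cmd j) (\<lambda>t. act_code (snd (the (next_move M t)) ! j)))"
  \<comment> \<open>The store after the first \<open>k\<close> actions have been recorded. As
    \<open>next_move\<close> does not read the \<open>Cmd\<close> registers, it yields the same move
    for every \<open>k\<close>.\<close>
  define \<tau> where "\<tau> k r = (case r of Cmd j \<Rightarrow> if j < k then [act_code (acts ! j)] else [] | _ \<Rightarrow> \<sigma> r)"
    for k r
  have cmd\<sigma>: "\<sigma> (Cmd j) = []" for j
    using sim cmd by (simp add: simulates_def)
  have next\<tau>: "next_move M (\<lambda>r. peek (\<tau> k r)) = Some (s', acts)" for k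
    using simulates_next_move[OF sim] tr by (simp add: next_move_def \<tau>_def)
  have 1: "exec G (seqs (map push [0..<k])) \<sigma> (\<tau> k)" if "k \<le> ?T" for k
    using that
  proof (induction k)
    case 0
    have "\<tau> 0 = \<sigma>" using cmd\<sigma> by (auto simp: \<tau>_def fun_eq_iff split: reg.splits)
    then show ?case by (simp add: exec_seqs_Nil)
  next
    case (Suc k)
    have "exec G (push k) (\<tau> k) (\<tau> (Suc k))"
      unfolding push_def
    proof (rule exec_push)
      show "act_code (acts ! k) = act_code (snd (the (next_move M (\<lambda>r. peek (\<tau> k r)))) ! k)"
        by (simp add: next\<tau>)
    qed (use code_lt[of k] Suc.prems in \<open>auto simp: \<tau>_def fun_eq_iff act_code_def split: reg.splits\<close>)
    then show ?case using Suc by (auto intro: exec_seqs_snoc)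
  qed
  define \<upsilon> where "\<upsilon> = (\<tau> ?T)(state_reg := Suc s' # \<sigma> state_reg)"
  have 2: "exec G (Push state_reg (\<lambda>t. Suc (fst (the (next_move M t))))) (\<tau> ?T) \<upsilon>"
    using next\<tau> bnd G by (intro exec_push) (auto simp: \<upsilon>_def \<tau>_def)
  have 3: "\<exists>\<sigma>'. exec G (seqs (map perform [0..<k])) \<upsilon> \<sigma>' \<and>
      (\<forall>j<k. zipper ?n (\<sigma>' (Lft j)) (\<sigma>' (Rgt j)) (act (acts ! j) (snd c ! j)) \<and> \<sigma>' (Cmd j) = []) \<and>
      (\<forall>r. (\<forall>j<k. r \<noteq> Lft j \<and> r \<noteq> Rgt j \<and> r \<noteq> Cmd j) \<longrightarrow> \<sigma>' r = \<upsilon> r)" if "k \<le> ?T" for k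
    using that
  proof (induction k)
    case 0
    then show ?case using exec_seqs_Nil by auto
  next
    case (Suc k)
    then obtain \<sigma>' where IH: "exec G (seqs (map perform [0..<k])) \<upsilon> \<sigma>'"
      "\<And>j. j < k \<Longrightarrow> zipper ?n (\<sigma>' (Lft j)) (\<sigma>' (Rgt j)) (act (acts ! j) (snd c ! j)) \<and> \<sigma>' (Cmd j) = []"
      "\<And>r. (\<forall>j<k. r \<noteq> Lft j \<and> r \<noteq> Rgt j \<and> r \<noteq> Cmd j) \<Longrightarrow> \<sigma>' r = \<upsilon> r"
      by auto
    have k: "\<sigma>' (Lft k) = \<sigma> (Lft k)" "\<sigma>' (Rgt k) = \<sigma> (Rgt k)" "\<sigma>' (Cmd k) = [act_code (acts ! k)]"
      using Suc.prems by (subst IH(3); simp add: \<upsilon>_def \<tau>_def)+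
    have "zipper ?n (\<sigma>' (Lft k)) (\<sigma>' (Rgt k)) (snd c ! k)"
      using sim Suc.prems by (simp add: k simulates_def)
    then obtain ls rs where
      p: "exec G (perform k) \<sigma>' (\<sigma>'(Rgt k := rs, Lft k := ls, Cmd k := []))"
        "zipper ?n ls rs (act (acts ! k) (snd c ! k))"
      using exec_perform[of ?n \<sigma>' k "snd c ! k" "acts ! k" G] k act_lt[of k] Suc.prems G by auto
    let ?\<sigma> = "\<sigma>'(Rgt k := rs, Lft k := ls, Cmd k := [])"
    have "exec G (seqs (map perform [0..<Suc k])) \<upsilon> ?\<sigma>"
      using exec_seqs_snoc[OF IH(1) p(1)] by simp
    moreover have "zipper ?n (?\<sigma> (Lft j)) (?\<sigma> (Rgt j)) (act (acts ! j) (snd c ! j)) \<and> ?\<sigma> (Cmd j) = []"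
      if "j < Suc k" for j
      using IH(2)[of j] p(2) that by (cases "j = k") auto
    moreover have "?\<sigma> r = \<upsilon> r" if "\<forall>j<Suc k. r \<noteq> Lft j \<and> r \<noteq> Rgt j \<and> r \<noteq> Cmd j" for r
      using IH(3)[of r] that by simp
    ultimately show ?case by blast
  qed
  obtain \<sigma>' where \<sigma>': "exec G (seqs (map perform [0..<?T])) \<upsilon> \<sigma>'"
    "\<And>j. j < ?T \<Longrightarrow> zipper ?n (\<sigma>' (Lft j)) (\<sigma>' (Rgt j)) (act (acts ! j) (snd c ! j)) \<and> \<sigma>' (Cmd j) = []"
    "\<And>r. (\<forall>j<?T. r \<noteq> Lft j \<and> r \<noteq> Rgt j \<and> r \<noteq> Cmd j) \<Longrightarrow> \<sigma>' r = \<upsilon> r"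
    using 3[of ?T] by auto
  have "exec G (step_com M) \<sigma> \<sigma>'"
    unfolding step_com_def using 1[of ?T] 2 \<sigma>'(1) by (auto simp: push_def intro: exec.Seq)
  moreover have "simulates M \<sigma>\<^sub>0 c' \<sigma>'"
    unfolding simulates_def
  proof (intro conjI allI impI)
    have "\<sigma>' state_reg = Suc s' # \<sigma> state_reg"
      by (subst \<sigma>'(3)) (simp_all add: \<upsilon>_def)
    then show "peek (\<sigma>' state_reg) = Suc (fst c')" "0 \<notin> set (\<sigma>' state_reg)"
      using sim c' by (auto simp: simulates_def)
    show "fst c' < num_states M" "length (snd c') = ?T"
      using bnd c' sim by (auto simp: simulates_def)
    fix j assume "j < ?T"
    then show "zipper ?n (\<sigma>' (Lft j)) (\<sigma>' (Rgt j)) (snd c' ! j)"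
      using \<sigma>'(2) bnd c' sim by (auto simp: simulates_def)
  next
    fix r assume r: "r \<noteq> state_reg" "\<forall>j<?T. r \<noteq> Lft j \<and> r \<noteq> Rgt j"
    show "\<sigma>' r = \<sigma>\<^sub>0 r"
    proof (cases "\<exists>j<?T. r = Cmd j")
      case True
      then show ?thesis using \<sigma>'(2) cmd by auto
    next
      case False
      then have "\<sigma>' r = \<upsilon> r" using r by (intro \<sigma>'(3)) auto
      also have "\<dots> = \<sigma> r"
        using r(1) False cmd\<sigma> by (auto simp: \<upsilon>_def \<tau>_def split: reg.splits)
      also have "\<dots> = \<sigma>\<^sub>0 r" using sim r by (simp add: simulates_def)
      finally show ?thesis .
    qed
  qed
  ultimately show ?thesis by blast
qed

text \<open>After the loop the right half of the last tape is moved onto the left half, which lines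
  up the whole window in reverse; the transfer to \<open>dst\<close> restores the order and drops
  the blanks. The rest is cleared for the next call.\<close>

definition run_machine :: "tm \<Rightarrow> reg \<Rightarrow> com" where
  "run_machine M dst =
     Push state_reg (\<lambda>_. 1) ;;
     Loop (\<lambda>t. next_move M t \<noteq> None) (step_com M) ;;
     move_map (Rgt (num_tapes M - 1)) (Lft (num_tapes M - 1)) id ;;
     move_map (Lft (num_tapes M - 1)) dst (\<lambda>a. if a = 1 then 0 else a) ;;
     seqs (map (\<lambda>j. clear (Lft j) ;; clear (Rgt j)) [0..<num_tapes M]) ;;
     clear state_reg"

lemma exec_simulation_loop:
  assumes "tm_steps M c c'" "tm_step M c' = None" "simulates M \<sigma>\<^sub>0 c \<sigma>" "wf_tm M"
    and "\<And>j. \<sigma>\<^sub>0 (Cmd j) = []" "Suc (num_states M) < G" "3 * num_symbols M + 3 < G"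
  shows "\<exists>\<sigma>'. exec G (Loop (\<lambda>t. next_move M t \<noteq> None) (step_com M)) \<sigma> \<sigma>' \<and> simulates M \<sigma>\<^sub>0 c' \<sigma>'"
  using assms(1,3)
proof (induction arbitrary: \<sigma> rule: converse_rtranclp_induct)
  case base
  then have "next_move M (\<lambda>r. peek (\<sigma> r)) = None"
    using simulates_next_move assms(2) by (fastforce simp: tm_step_def split: option.splits)
  then have "exec G (Loop (\<lambda>t. next_move M t \<noteq> None) (step_com M)) \<sigma> \<sigma>"
    by (intro exec.LoopF) simp
  then show ?case using base by blast
next
  case (step c c1)
  then have "next_move M (\<lambda>r. peek (\<sigma> r)) \<noteq> None"
    using simulates_next_move by (fastforce simp: tm_step_def split: option.splits)
  moreover obtain \<sigma>1 where "exec G (step_com M) \<sigma> \<sigma>1" "simulates M \<sigma>\<^sub>0 c1 \<sigma>1"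
    using exec_step_com[OF step.prems step.hyps(1) assms(4-7)] by blast
  moreover obtain \<sigma>' where "exec G (Loop (\<lambda>t. next_move M t \<noteq> None) (step_com M)) \<sigma>1 \<sigma>'"
    "simulates M \<sigma>\<^sub>0 c' \<sigma>'"
    using step.IH calculation by blast
  ultimately show ?case by (blast intro: exec.LoopT)
qed

lemma exec_clear_tapes:
  assumes "\<And>j. j < n \<Longrightarrow> 0 \<notin> set (\<sigma> (Lft j)) \<and> 0 \<notin> set (\<sigma> (Rgt j))"
  shows "exec G (seqs (map (\<lambda>j. clear (Lft j) ;; clear (Rgt j)) [0..<n])) \<sigma>
    (\<lambda>r. if \<exists>j<n. r = Lft j \<or> r = Rgt j then [] else \<sigma> r)"
  using assms
proof (induction n)
  case 0
  then show ?case by (simp add: exec_seqs_Nil)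
next
  case (Suc n)
  define \<tau> where "\<tau> = (\<lambda>r. if \<exists>j<n. r = Lft j \<or> r = Rgt j then [] else \<sigma> r)"
  have "exec G (clear (Lft n)) \<tau> (\<tau>(Lft n := []))"
    by (rule exec_clear) (use Suc.prems in \<open>auto simp: \<tau>_def\<close>)
  moreover have "exec G (clear (Rgt n)) (\<tau>(Lft n := [])) (\<tau>(Lft n := [], Rgt n := []))"
    by (rule exec_clear) (use Suc.prems in \<open>auto simp: \<tau>_def\<close>)
  moreover have "(\<lambda>r. if \<exists>j<Suc n. r = Lft j \<or> r = Rgt j then [] else \<sigma> r) =
      \<tau>(Lft n := [], Rgt n := [])"
    by (auto simp: \<tau>_def fun_eq_iff less_Suc_eq)
  ultimately show ?case
    using Suc.IH Suc.prems by (auto simp: \<tau>_def intro!: exec_seqs_snoc exec.Seq)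
qed

abbreviation stored :: "bool list \<Rightarrow> nat list" where
  "stored x \<equiv> map Suc (bits x)"

lemma stored_bounds: "v \<in> set (stored x) \<Longrightarrow> v = 2 \<or> v = 3"
  using set_bits[of x] by auto

text \<open>The exact final store shows that only the input is consumed and only \<open>dst\<close>
  is extended, so calls can follow one another on the same registers.\<close>

lemma exec_run_machine:
  assumes wf: "wf_tm M" and comp: "tm_computes M [x] z"
    and in0: "\<sigma> (Rgt 0) = stored x" and Rgt: "\<And>j. 0 < j \<Longrightarrow> \<sigma> (Rgt j) = []"
    and Lft: "\<And>j. \<sigma> (Lft j) = []" and Cmd: "\<And>j. \<sigma> (Cmd j) = []" and st: "\<sigma> state_reg = []"
    and dst: "dst = Aux i" "dst \<noteq> state_reg"
    and G: "Suc (num_states M) < G" "3 * num_symbols M + 3 < G"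
  shows "exec G (run_machine M dst) \<sigma> (\<sigma>(Rgt 0 := [], dst := stored z @ \<sigma> dst))"
proof -
  define T where "T = num_tapes M"
  let ?n = "num_symbols M"
  have T: "0 < T" "T - 1 < T" "3 \<le> ?n" and ns: "0 < num_states M"
    using wf by (auto simp: wf_tm_def T_def)
  define \<sigma>1 where "\<sigma>1 = \<sigma>(state_reg := [1])"
  have 1: "exec G (Push state_reg (\<lambda>_. 1)) \<sigma> \<sigma>1"
    by (rule exec_push) (use G st in \<open>auto simp: \<sigma>1_def\<close>)
  obtain c where c: "tm_steps M (init_config M [x]) c" "tm_step M c = None"
    "fst (last (snd c)) = cells z"
    using comp by (auto simp: tm_computes_def)
  have "simulates M \<sigma> (init_config M [x]) \<sigma>1"
    unfolding simulates_def
  proof (intro conjI allI impI)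
    fix j assume "j < num_tapes M"
    then show "zipper ?n (\<sigma>1 (Lft j)) (\<sigma>1 (Rgt j)) (snd (init_config M [x]) ! j)"
      using zipper_init[OF T(3), of x] zipper_init[OF T(3), of "[]"] in0 Rgt[of j] Lft
      by (cases "j = 0") (auto simp: init_config_def \<sigma>1_def)
  qed (auto simp: init_config_def \<sigma>1_def ns)
  then obtain \<sigma>2 where 2: "exec G (Loop (\<lambda>t. next_move M t \<noteq> None) (step_com M)) \<sigma>1 \<sigma>2"
    "simulates M \<sigma> c \<sigma>2"
    using exec_simulation_loop[OF c(1,2) _ wf _ G, of \<sigma>] Cmd by blast
  define ls where "ls = \<sigma>2 (Lft (T - 1))"
  define rs where "rs = \<sigma>2 (Rgt (T - 1))"
  have zip: "zipper ?n (\<sigma>2 (Lft j)) (\<sigma>2 (Rgt j)) (snd c ! j)" if "j < T" for j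
    using 2(2) that by (auto simp: simulates_def T_def)
  have bd: "v \<in> set (\<sigma>2 (Lft j)) \<union> set (\<sigma>2 (Rgt j)) \<Longrightarrow> 0 < v \<and> v < G" if "j < T" for j v
    using zip[OF that] G by (auto simp: zipper_def)
  have lenc: "length (snd c) = T" using 2(2) by (simp add: simulates_def T_def)
  have "last (snd c) = snd c ! (T - 1)"
    using T(1) lenc by (subst last_conv_nth) auto
  then have word: "filter (\<lambda>v. v \<noteq> 1) (rev ls @ rs) = stored z"
    using zipper_word[OF zip[OF T(2)]] c(3) by (simp add: ls_def rs_def)
  define \<sigma>3 where "\<sigma>3 = \<sigma>2(Rgt (T - 1) := [], Lft (T - 1) := rev rs @ ls)"
  have 3: "exec G (move_map (Rgt (T - 1)) (Lft (T - 1)) id) \<sigma>2 \<sigma>3"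
    by (rule exec_move) (use bd[OF T(2)] in \<open>auto simp: \<sigma>3_def ls_def rs_def\<close>)
  define g where "g = (\<lambda>a :: nat. if a = 1 then 0 else a)"
  define \<sigma>4 where "\<sigma>4 = \<sigma>3(Lft (T - 1) := [], dst := stored z @ \<sigma> dst)"
  have "filter (\<lambda>v. 0 < v \<and> v < G) (map g xs) = filter (\<lambda>v. v \<noteq> 1) xs"
    if "\<forall>v \<in> set xs. 0 < v \<and> v < G" for xs
    using that by (induction xs) (auto simp: g_def)
  moreover have bd3: "\<forall>v \<in> set (rev rs @ ls). 0 < v \<and> v < G"
    using bd[OF T(2)] by (auto simp: ls_def rs_def)
  ultimately have "rev (filter (\<lambda>v. 0 < v \<and> v < G) (map g (rev rs @ ls))) = stored z"
    using word by (simp add: rev_filter)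
  moreover have "\<sigma>3 dst = \<sigma> dst"
    using 2(2) dst by (simp add: \<sigma>3_def simulates_def)
  ultimately have 4: "exec G (move_map (Lft (T - 1)) dst g) \<sigma>3 \<sigma>4"
    using exec_move_map[of "Lft (T - 1)" dst \<sigma>3 G g] bd3 dst by (auto simp: \<sigma>4_def \<sigma>3_def)
  define \<sigma>5 where "\<sigma>5 = (\<lambda>r. if \<exists>j<T. r = Lft j \<or> r = Rgt j then [] else \<sigma>4 r)"
  have "0 \<notin> set (\<sigma>4 (Lft j)) \<and> 0 \<notin> set (\<sigma>4 (Rgt j))" if "j < T" for j
    using bd[OF that] dst by (auto simp: \<sigma>4_def \<sigma>3_def)
  then have 5: "exec G (seqs (map (\<lambda>j. clear (Lft j) ;; clear (Rgt j)) [0..<T])) \<sigma>4 \<sigma>5"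
    unfolding \<sigma>5_def by (rule exec_clear_tapes)
  have "\<sigma>5 state_reg = \<sigma>2 state_reg"
    using dst by (auto simp: \<sigma>5_def \<sigma>4_def \<sigma>3_def)
  then have 6: "exec G (clear state_reg) \<sigma>5 (\<sigma>5(state_reg := []))"
    using 2(2) by (intro exec_clear) (simp add: simulates_def)
  have "\<sigma>5(state_reg := []) = \<sigma>(Rgt 0 := [], dst := stored z @ \<sigma> dst)"
  proof
    fix r
    consider "r = state_reg" | "r = dst" | j where "r = Lft j \<or> r = Rgt j" "j < T"
      | "r \<noteq> state_reg" "r \<noteq> dst" "\<forall>j<T. r \<noteq> Lft j \<and> r \<noteq> Rgt j"
      by blast
    then show "(\<sigma>5(state_reg := [])) r = (\<sigma>(Rgt 0 := [], dst := stored z @ \<sigma> dst)) r"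
    proof cases
      case 1
      then show ?thesis using dst st by simp
    next
      case 2
      then show ?thesis using dst by (simp add: \<sigma>5_def \<sigma>4_def)
    next
      case (3 j)
      then show ?thesis using dst Lft Rgt[of j] by (auto simp: \<sigma>5_def)
    next
      case 4
      then have "r \<noteq> Lft (T - 1)" "r \<noteq> Rgt (T - 1)" "r \<noteq> Rgt 0" using T by auto
      moreover have "\<sigma>2 r = \<sigma> r" using 2(2) 4 by (simp add: simulates_def T_def)
      ultimately show ?thesis using 4 by (auto simp: \<sigma>5_def \<sigma>4_def \<sigma>3_def)
    qed
  qed
  then show ?thesis
    unfolding run_machine_def T_def[symmetric] g_def[symmetric]
    using exec.Seq[OF 1 exec.Seq[OF 2(1) exec.Seq[OF 3 exec.Seq[OF 4 exec.Seq[OF 5 6]]]]] by simp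
qed

lemma exec_eq: "exec G c \<sigma> \<tau> \<Longrightarrow> \<tau> = \<sigma>' \<Longrightarrow> exec G c \<sigma> \<sigma>'"
  by simp

lemma exec_Loop_step:
  "exec G c \<sigma> \<sigma>1 \<Longrightarrow> b (\<lambda>r. peek (\<sigma> r)) \<Longrightarrow> exec G (Loop b c) \<sigma>1 \<sigma>' \<Longrightarrow> exec G (Loop b c) \<sigma> \<sigma>'"
  using exec.LoopT by blast

lemma exec_Push_Seq:
  "0 < f (\<lambda>r. peek (\<sigma> r)) \<Longrightarrow> f (\<lambda>r. peek (\<sigma> r)) < G \<Longrightarrow>
    exec G d (\<sigma>(i := f (\<lambda>r. peek (\<sigma> r)) # \<sigma> i)) \<sigma>' \<Longrightarrow> exec G (Push i f ;; d) \<sigma> \<sigma>'"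
  using exec.Push exec.Seq by blast

lemmas exec_intros = exec_Push_Seq exec.Seq[OF exec.Pop] exec_pop


section \<open>A self-delimiting code for token streams\<close>

text \<open>Tokens are unary with a closing \<open>False\<close>. For nonzero tokens, a
  \<open>False\<close> where a token should begin can only be the end of the stream.\<close>

definition token_code :: "nat list \<Rightarrow> bool list" where
  "token_code ts = concat (map (\<lambda>j. replicate j True @ [False]) ts) @ [False]"

lemma token_code_simps [simp]:
  "token_code [] = [False]" "token_code (t # ts) = replicate t True @ False # token_code ts"
  by (simp_all add: token_code_def)

text \<open>
  States of the automaton accepting token streams with nonzero tokens: 0 and 1 between tokens,
  2 inside a token, 3 at the end of the stream, 4 beyond it.
\<close>

definition scan :: "nat \<Rightarrow> nat \<Rightarrow> nat" where
  "scan s a = (if s \<le> 1 then (if a = 2 then 2 else 3)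
     else if s = 2 then (if a = 2 then 2 else 1) else 4)"

lemma scan_replicate: "foldl scan 2 (replicate n 2) = 2"
  by (induction n) (auto simp: scan_def)

lemma bits_replicate [simp]: "bits (replicate n b) = replicate n (if b then 2 else 1)"
  by (simp add: bits_def)

lemma scan_token_code:
  assumes "0 \<notin> set ts" "s \<le> 1"
  shows "foldl scan s (bits (token_code ts)) = 3"
  using assms
proof (induction ts arbitrary: s)
  case Nil
  then show ?case by (simp add: scan_def)
next
  case (Cons t ts)
  then obtain n where t: "t = Suc n" by (cases t) auto
  have "scan s 2 = 2" "scan 2 1 = 1" using Cons.prems by (simp_all add: scan_def)
  then show ?case using Cons.IH[of 1] Cons.prems by (simp add: t scan_replicate)
qed

text \<open>State 3 is left for the dead state 4 by any further symbol.\<close>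

lemma scan_prefix_free:
  assumes "foldl scan s (xs @ ys) = 3" "foldl scan s xs = 3"
  shows "ys = []"
proof -
  have "foldl scan 4 zs = 4" for zs
    by (induction zs) (auto simp: scan_def)
  then show ?thesis
    using assms by (cases ys) (auto simp: scan_def)
qed

text \<open>The state is the top of \<open>Aux 4\<close>, with earlier states below it. The initial
  state 0 is the empty stack; since 0 cannot be pushed, \<open>scan\<close> returns to state 1
  between tokens. The program is saved, reversed, on \<open>Aux 5\<close>.\<close>

definition read_code :: com where
  "read_code = Loop (\<lambda>t. t (Aux 0) \<noteq> 0)
     (Push (Aux 5) (\<lambda>t. t (Aux 0)) ;; Push (Aux 4) (\<lambda>t. scan (t (Aux 4)) (t (Aux 0))) ;; Pop (Aux 0))"

lemma exec_read_code:
  assumes "\<sigma> (Aux 0) = xs" "set xs \<subseteq> {1, 2}" "0 \<notin> set (\<sigma> (Aux 4))" "4 < G"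
  shows "\<exists>hs. 0 \<notin> set hs \<and> peek hs = foldl scan (peek (\<sigma> (Aux 4))) xs \<and>
    exec G read_code \<sigma> (\<sigma>(Aux 0 := [], Aux 5 := rev xs @ \<sigma> (Aux 5), Aux 4 := hs))"
  using assms(1-3)
proof (induction xs arbitrary: \<sigma>)
  case Nil
  have e: "exec G read_code \<sigma> (\<sigma>(Aux 0 := [], Aux 5 := rev [] @ \<sigma> (Aux 5), Aux 4 := \<sigma> (Aux 4)))"
    unfolding read_code_def by (rule exec_eq[OF exec.LoopF]) (use Nil in \<open>auto simp: fun_eq_iff\<close>)
  show ?case
    by (rule exI[of _ "\<sigma> (Aux 4)"]) (use Nil in \<open>intro conjI e; simp\<close>)
next
  case (Cons x xs)
  have s: "0 < scan s x" "scan s x \<le> 4" for s by (auto simp: scan_def)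
  define \<sigma>1 where "\<sigma>1 = \<sigma>(Aux 5 := x # \<sigma> (Aux 5),
    Aux 4 := scan (peek (\<sigma> (Aux 4))) x # \<sigma> (Aux 4), Aux 0 := xs)"
  have body: "exec G (Push (Aux 5) (\<lambda>t. t (Aux 0)) ;; Push (Aux 4) (\<lambda>t. scan (t (Aux 4)) (t (Aux 0))) ;;
      Pop (Aux 0)) \<sigma> \<sigma>1"
    by (intro exec_intros)
      (use Cons.prems s[of "peek (\<sigma> (Aux 4))"] assms(4) in \<open>auto simp: \<sigma>1_def fun_eq_iff\<close>)
  moreover have \<sigma>1: "\<sigma>1 (Aux 0) = xs" "set xs \<subseteq> {1, 2}" "0 \<notin> set (\<sigma>1 (Aux 4))"
    using Cons.prems s(1)[of "peek (\<sigma> (Aux 4))"] by (auto simp: \<sigma>1_def)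
  moreover obtain hs where hs: "0 \<notin> set hs" "peek hs = foldl scan (peek (\<sigma>1 (Aux 4))) xs"
    "exec G read_code \<sigma>1 (\<sigma>1(Aux 0 := [], Aux 5 := rev xs @ \<sigma>1 (Aux 5), Aux 4 := hs))"
    using Cons.IH[OF \<sigma>1] by blast
  moreover have "peek (\<sigma> (Aux 0)) \<noteq> 0"
    using Cons.prems by auto
  moreover have eq: "\<sigma>1(Aux 0 := [], Aux 5 := rev xs @ \<sigma>1 (Aux 5), Aux 4 := hs) =
      \<sigma>(Aux 0 := [], Aux 5 := rev (x # xs) @ \<sigma> (Aux 5), Aux 4 := hs)"
    by (auto simp: \<sigma>1_def fun_eq_iff)
  ultimately have e: "exec G read_code \<sigma> (\<sigma>(Aux 0 := [], Aux 5 := rev (x # xs) @ \<sigma> (Aux 5), Aux 4 := hs))"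
    unfolding read_code_def
    by (intro exec_Loop_step[OF body _ hs(3)[unfolded eq read_code_def]])
  show ?case
    by (rule exI[of _ hs]) (use hs in \<open>intro conjI e; simp add: \<sigma>1_def\<close>)
qed


section \<open>The trace interpreter\<close>

text \<open>Bits are stored as 2 and 3, which leaves 1 free as an end marker.\<close>

definition pool_code :: "bool list list \<Rightarrow> nat list" where
  "pool_code xs = concat (map (\<lambda>x. stored x @ [1]) xs)"

lemma pool_code_simps [simp]:
  "pool_code [] = []" "pool_code (x # xs) = stored x @ 1 # pool_code xs"
  "pool_code (xs @ ys) = pool_code xs @ pool_code ys"
  by (simp_all add: pool_code_def)

lemma pool_code_bounds: "v \<in> set (pool_code xs) \<Longrightarrow> 0 < v \<and> v \<le> 3"
proof (induction xs)
  case (Cons x xs)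
  then show ?case using set_bits[of x] by auto
qed simp

lemma list_code_Cons [simp]: "list_code (x # xs) = replicate (length x) True @ False # x @ list_code xs"
  by (simp add: list_code_def)

lemma list_code_Nil [simp]: "list_code [] = []"
  by (simp add: list_code_def)

section \<open>Stack programs for indices, pool access and argument lists\<close>

definition double :: com where
  "double = Loop (\<lambda>t. t (Aux 7) \<noteq> 0) (Push (Aux 9) (\<lambda>_. 1) ;; Push (Aux 9) (\<lambda>_. 1) ;; Pop (Aux 7)) ;;
     move_map (Aux 9) (Aux 7) id"

lemma exec_double:
  assumes "\<sigma> (Aux 7) = replicate u 1" "\<sigma> (Aux 9) = []" "1 < G"
  shows "exec G double \<sigma> (\<sigma>(Aux 7 := replicate (2 * u) 1))"
proof -
  let ?l = "Loop (\<lambda>t. t (Aux 7) \<noteq> 0) (Push (Aux 9) (\<lambda>_. 1) ;; Push (Aux 9) (\<lambda>_. 1) ;; Pop (Aux 7))"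
  have loop: "exec G ?l \<sigma> (\<sigma>(Aux 7 := [], Aux 9 := replicate (2 * u) 1 @ \<sigma> (Aux 9)))"
    if "\<sigma> (Aux 7) = replicate u 1" for \<sigma>
    using that
  proof (induction u arbitrary: \<sigma>)
    case 0
    then show ?case by (intro exec_eq[OF exec.LoopF]) (auto simp: fun_eq_iff)
  next
    case (Suc u)
    define \<sigma>1 where "\<sigma>1 = \<sigma>(Aux 7 := replicate u 1, Aux 9 := 1 # 1 # \<sigma> (Aux 9))"
    have body: "exec G (Push (Aux 9) (\<lambda>_. 1) ;; Push (Aux 9) (\<lambda>_. 1) ;; Pop (Aux 7)) \<sigma> \<sigma>1"
      by (intro exec_intros)
        (use Suc.prems assms(3) in \<open>auto simp: \<sigma>1_def fun_eq_iff\<close>)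
    have rest: "exec G ?l \<sigma>1 (\<sigma>(Aux 7 := [], Aux 9 := replicate (2 * Suc u) 1 @ \<sigma> (Aux 9)))"
      by (rule exec_eq[OF Suc.IH])
        (auto simp: \<sigma>1_def fun_eq_iff replicate_app_Cons_same)
    show ?case
      by (rule exec_Loop_step[OF body _ rest]) (use Suc.prems in simp)
  qed
  show ?thesis
    unfolding double_def
    by (rule exec.Seq[OF loop[where \<sigma> = \<sigma>, OF assms(1)] exec_move]) (use assms in \<open>auto simp: fun_eq_iff\<close>)
qed

text \<open>Reading destroys a stack, so each symbol goes both to the result on \<open>Aux 8\<close>
  and to \<open>Aux 9\<close>, from which the pool is rebuilt.\<close>

definition copy_item :: com where
  "copy_item = Loop (\<lambda>t. t (Aux 6) \<noteq> 1)
     (Push (Aux 9) (\<lambda>t. t (Aux 6)) ;; Push (Aux 8) (\<lambda>t. t (Aux 6)) ;; Pop (Aux 6))"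

lemma exec_copy_item:
  assumes "\<sigma> (Aux 6) = xs @ 1 # ys" "\<forall>v \<in> set xs. 1 < v \<and> v < G"
  shows "exec G copy_item \<sigma> (\<sigma>(Aux 6 := 1 # ys, Aux 9 := rev xs @ \<sigma> (Aux 9), Aux 8 := rev xs @ \<sigma> (Aux 8)))"
  using assms
proof (induction xs arbitrary: \<sigma>)
  case Nil
  then show ?case unfolding copy_item_def by (intro exec_eq[OF exec.LoopF]) (auto simp: fun_eq_iff)
next
  case (Cons x xs)
  define \<sigma>1 where "\<sigma>1 = \<sigma>(Aux 6 := xs @ 1 # ys, Aux 9 := x # \<sigma> (Aux 9), Aux 8 := x # \<sigma> (Aux 8))"
  have body: "exec G (Push (Aux 9) (\<lambda>t. t (Aux 6)) ;; Push (Aux 8) (\<lambda>t. t (Aux 6)) ;; Pop (Aux 6)) \<sigma> \<sigma>1"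
    by (intro exec_intros) (use Cons.prems in \<open>auto simp: \<sigma>1_def fun_eq_iff\<close>)
  have rest: "exec G copy_item \<sigma>1 (\<sigma>(Aux 6 := 1 # ys, Aux 9 := rev (x # xs) @ \<sigma> (Aux 9),
      Aux 8 := rev (x # xs) @ \<sigma> (Aux 8)))"
    by (rule exec_eq[OF Cons.IH]) (use Cons.prems in \<open>auto simp: \<sigma>1_def fun_eq_iff\<close>)
  have pk: "peek (\<sigma> (Aux 6)) \<noteq> 1"
    using Cons.prems by auto
  show ?case unfolding copy_item_def
    by (rule exec_Loop_step[OF body _ rest[unfolded copy_item_def]]) (use pk in simp)
qed

text \<open>Skipped items pass through \<open>copy_item\<close> as well, their copies on
  \<open>Aux 8\<close> being discarded. The last item keeps its end marker on \<open>Aux 6\<close>,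
  and moving \<open>Aux 9\<close> back restores the pool.\<close>

definition fetch :: com where
  "fetch =
     Loop (\<lambda>t. t (Aux 7) \<noteq> 0)
       (Pop (Aux 7) ;; copy_item ;; clear (Aux 8) ;; Push (Aux 9) (\<lambda>_. 1) ;; Pop (Aux 6)) ;;
     copy_item ;; move_map (Aux 9) (Aux 6) id"

lemma exec_fetch:
  assumes "\<sigma> (Aux 7) = replicate u 1" "\<sigma> (Aux 6) = pool_code xs" "u < length xs"
    and "\<sigma> (Aux 8) = []" "\<sigma> (Aux 9) = []" "3 < G"
  shows "exec G fetch \<sigma> (\<sigma>(Aux 7 := [], Aux 8 := rev (stored (xs ! u))))"
proof -
  let ?b = "Pop (Aux 7) ;; copy_item ;; clear (Aux 8) ;; Push (Aux 9) (\<lambda>_. 1) ;; Pop (Aux 6)"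
  let ?l = "Loop (\<lambda>t. t (Aux 7) \<noteq> 0) ?b"
  have item: "\<forall>v \<in> set (stored x). 1 < v \<and> v < G" for x
    using stored_bounds[of _ x] assms(6) by fastforce
  have loop: "exec G ?l \<sigma> (\<sigma>(Aux 7 := [], Aux 6 := pool_code (drop u xs),
      Aux 9 := rev (pool_code (take u xs)) @ \<sigma> (Aux 9)))"
    if "\<sigma> (Aux 7) = replicate u 1" "\<sigma> (Aux 6) = pool_code xs" "u < length xs" "\<sigma> (Aux 8) = []" for \<sigma>
    using that
  proof (induction u arbitrary: \<sigma> xs)
    case 0
    then show ?case by (intro exec_eq[OF exec.LoopF]) (auto simp: fun_eq_iff)
  next
    case (Suc u)
    then obtain x xs' where xs: "xs = x # xs'" by (cases xs) auto
    define \<sigma>1 where "\<sigma>1 = \<sigma>(Aux 7 := replicate u 1)"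
    define \<sigma>2 where "\<sigma>2 = \<sigma>1(Aux 6 := 1 # pool_code xs', Aux 9 := rev (stored x) @ \<sigma> (Aux 9),
      Aux 8 := rev (stored x))"
    define \<sigma>3 where "\<sigma>3 = \<sigma>2(Aux 8 := [])"
    define \<sigma>4 where "\<sigma>4 = \<sigma>3(Aux 9 := 1 # \<sigma>3 (Aux 9), Aux 6 := pool_code xs')"
    have 1: "exec G (Pop (Aux 7)) \<sigma> \<sigma>1"
      by (rule exec_pop) (simp add: \<sigma>1_def Suc.prems)
    have 2: "exec G copy_item \<sigma>1 \<sigma>2"
      by (rule exec_eq[OF exec_copy_item[where xs = "stored x" and ys = "pool_code xs'"]])
        (use Suc.prems item in \<open>auto simp: \<sigma>1_def \<sigma>2_def xs fun_eq_iff\<close>)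
    have 3: "exec G (clear (Aux 8)) \<sigma>2 \<sigma>3"
      unfolding \<sigma>3_def by (rule exec_clear) (auto simp: \<sigma>2_def dest: stored_bounds)
    have 4: "exec G (Push (Aux 9) (\<lambda>_. 1) ;; Pop (Aux 6)) \<sigma>3 \<sigma>4"
      by (intro exec_intros) (use assms(6) in \<open>auto simp: \<sigma>4_def \<sigma>3_def \<sigma>2_def fun_eq_iff\<close>)
    have body: "exec G ?b \<sigma> \<sigma>4"
      by (rule exec.Seq[OF 1 exec.Seq[OF 2 exec.Seq[OF 3 4]]])
    have rest: "exec G ?l \<sigma>4 (\<sigma>(Aux 7 := [], Aux 6 := pool_code (drop (Suc u) xs),
      Aux 9 := rev (pool_code (take (Suc u) xs)) @ \<sigma> (Aux 9)))"
      by (rule exec_eq[OF Suc.IH[of _ xs']])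
        (use Suc.prems in \<open>auto simp: \<sigma>4_def \<sigma>3_def \<sigma>2_def \<sigma>1_def xs fun_eq_iff\<close>)
    show ?case
      by (rule exec_Loop_step[OF body _ rest]) (use Suc.prems in simp)
  qed
  define \<sigma>1 where "\<sigma>1 = \<sigma>(Aux 7 := [], Aux 6 := pool_code (drop u xs),
      Aux 9 := rev (pool_code (take u xs)))"
  define \<sigma>2 where "\<sigma>2 = \<sigma>1(Aux 6 := 1 # pool_code (drop (Suc u) xs),
      Aux 9 := rev (stored (xs ! u)) @ rev (pool_code (take u xs)), Aux 8 := rev (stored (xs ! u)))"
  have drop: "drop u xs = xs ! u # drop (Suc u) xs"
    using assms(3) by (simp add: Cons_nth_drop_Suc)
  have pool: "pool_code xs = pool_code (take u xs) @ stored (xs ! u) @ 1 # pool_code (drop (Suc u) xs)"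
    by (metis append_take_drop_id drop pool_code_simps(2,3))
  have 1: "exec G ?l \<sigma> \<sigma>1"
    by (rule exec_eq[OF loop]) (use assms in \<open>auto simp: \<sigma>1_def\<close>)
  have 2: "exec G copy_item \<sigma>1 \<sigma>2"
    by (rule exec_eq[OF exec_copy_item[where xs = "stored (xs ! u)" and ys = "pool_code (drop (Suc u) xs)"]])
      (use assms item in \<open>auto simp: \<sigma>1_def \<sigma>2_def drop fun_eq_iff\<close>)
  have bd: "\<forall>v \<in> set (\<sigma>2 (Aux 9)). 0 < v \<and> v < G"
    using item[of "xs ! u"] pool_code_bounds[of _ "take u xs"] assms(6)
    by (fastforce simp: \<sigma>2_def simp del: set_map)
  have 3: "exec G (move_map (Aux 9) (Aux 6) id) \<sigma>2 (\<sigma>(Aux 7 := [], Aux 8 := rev (stored (xs ! u))))"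
    by (rule exec_move) (use bd assms in \<open>auto simp: \<sigma>1_def \<sigma>2_def fun_eq_iff pool\<close>)
  show ?thesis
    unfolding fetch_def by (rule exec.Seq[OF 1 exec.Seq[OF 2 3]])
qed

text \<open>Prepends an item to a \<open>list_code\<close>. Its symbols are pushed while
  \<open>Aux 10\<close> counts them; then come the separator and the length in unary. In stored form
  2 is \<open>False\<close> and 3 is \<open>True\<close>.\<close>

definition pass_argument :: com where
  "pass_argument =
     Loop (\<lambda>t. t (Aux 8) \<noteq> 0)
       (Push (Rgt 0) (\<lambda>t. t (Aux 8)) ;; Push (Aux 10) (\<lambda>_. 1) ;; Pop (Aux 8)) ;;
     Push (Rgt 0) (\<lambda>_. 2) ;; move_map (Aux 10) (Rgt 0) (\<lambda>_. 3)"

lemma exec_pass_argument: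
  assumes "\<sigma> (Aux 8) = rev (stored x)" "\<sigma> (Rgt 0) = stored (list_code xs)" "\<sigma> (Aux 10) = []" "3 < G"
  shows "exec G pass_argument \<sigma> (\<sigma>(Aux 8 := [], Rgt 0 := stored (list_code (x # xs))))"
proof -
  let ?b = "Push (Rgt 0) (\<lambda>t. t (Aux 8)) ;; Push (Aux 10) (\<lambda>_. 1) ;; Pop (Aux 8)"
  let ?l = "Loop (\<lambda>t. t (Aux 8) \<noteq> 0) ?b"
  have loop: "exec G ?l \<sigma> (\<sigma>(Aux 8 := [], Rgt 0 := rev ys @ \<sigma> (Rgt 0),
      Aux 10 := replicate (length ys) 1 @ \<sigma> (Aux 10)))"
    if "\<sigma> (Aux 8) = ys" "\<forall>v \<in> set ys. 0 < v \<and> v < G" for \<sigma> ys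
    using that
  proof (induction ys arbitrary: \<sigma>)
    case Nil
    then show ?case by (intro exec_eq[OF exec.LoopF]) (auto simp: fun_eq_iff)
  next
    case (Cons y ys)
    define \<sigma>1 where "\<sigma>1 = \<sigma>(Aux 8 := ys, Rgt 0 := y # \<sigma> (Rgt 0), Aux 10 := 1 # \<sigma> (Aux 10))"
    have body: "exec G ?b \<sigma> \<sigma>1"
      by (intro exec_intros)
        (use Cons.prems assms(4) in \<open>auto simp: \<sigma>1_def fun_eq_iff\<close>)
    have rest: "exec G ?l \<sigma>1 (\<sigma>(Aux 8 := [], Rgt 0 := rev (y # ys) @ \<sigma> (Rgt 0),
      Aux 10 := replicate (length (y # ys)) 1 @ \<sigma> (Aux 10)))"
      by (rule exec_eq[OF Cons.IH])
        (use Cons.prems in \<open>auto simp: \<sigma>1_def fun_eq_iff replicate_app_Cons_same\<close>)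
    have pk: "peek (\<sigma> (Aux 8)) \<noteq> 0"
      using Cons.prems by auto
    show ?case
      by (rule exec_Loop_step[OF body _ rest]) (use pk in simp)
  qed
  define \<sigma>1 where "\<sigma>1 = \<sigma>(Aux 8 := [], Rgt 0 := stored (x @ list_code xs),
      Aux 10 := replicate (length x) 1)"
  define \<sigma>2 where "\<sigma>2 = \<sigma>1(Rgt 0 := 2 # stored (x @ list_code xs))"
  have bd: "\<forall>v \<in> set (stored x). 0 < v \<and> v < G"
    using stored_bounds[of _ x] assms(4) by fastforce
  have 1: "exec G ?l \<sigma> \<sigma>1"
    by (rule exec_eq[OF loop[where \<sigma> = \<sigma>, OF assms(1)]])
      (use assms bd in \<open>auto simp: \<sigma>1_def fun_eq_iff simp del: set_map\<close>)
  have 2: "exec G (Push (Rgt 0) (\<lambda>_. 2)) \<sigma>1 \<sigma>2"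
    by (rule exec_push) (use assms(4) in \<open>auto simp: \<sigma>1_def \<sigma>2_def\<close>)
  have 3: "exec G (move_map (Aux 10) (Rgt 0) (\<lambda>_. 3)) \<sigma>2
      (\<sigma>(Aux 8 := [], Rgt 0 := stored (list_code (x # xs))))"
    by (rule exec_move) (use assms in \<open>auto simp: \<sigma>1_def \<sigma>2_def fun_eq_iff\<close>)
  show ?thesis
    unfolding pass_argument_def by (rule exec.Seq[OF 1 exec.Seq[OF 2 3]])
qed

text \<open>The unary header, collected on \<open>Aux 10\<close>, tells how many symbols belong to
  the item; the detour through \<open>Aux 9\<close> preserves their order.\<close>

definition parse_item :: com where
  "parse_item =
     Loop (\<lambda>t. t (Aux 12) = 3) (Push (Aux 10) (\<lambda>_. 1) ;; Pop (Aux 12)) ;;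
     Pop (Aux 12) ;; Push (Aux 6) (\<lambda>_. 1) ;;
     Loop (\<lambda>t. t (Aux 10) \<noteq> 0) (Push (Aux 9) (\<lambda>t. t (Aux 12)) ;; Pop (Aux 12) ;; Pop (Aux 10)) ;;
     move_map (Aux 9) (Aux 6) id"

lemma exec_parse_item:
  assumes "\<sigma> (Aux 12) = stored (list_code (x # xs))" "\<sigma> (Aux 9) = []" "\<sigma> (Aux 10) = []" "3 < G"
  shows "exec G parse_item \<sigma> (\<sigma>(Aux 12 := stored (list_code xs), Aux 6 := stored x @ 1 # \<sigma> (Aux 6)))"
proof -
  let ?l1 = "Loop (\<lambda>t. t (Aux 12) = 3) (Push (Aux 10) (\<lambda>_. 1) ;; Pop (Aux 12))"
  let ?b = "Push (Aux 9) (\<lambda>t. t (Aux 12)) ;; Pop (Aux 12) ;; Pop (Aux 10)"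
  let ?l2 = "Loop (\<lambda>t. t (Aux 10) \<noteq> 0) ?b"
  have loop1: "exec G ?l1 \<sigma> (\<sigma>(Aux 12 := 2 # ys, Aux 10 := replicate n 1 @ \<sigma> (Aux 10)))"
    if "\<sigma> (Aux 12) = replicate n 3 @ 2 # ys" for \<sigma> n ys
    using that
  proof (induction n arbitrary: \<sigma>)
    case 0
    then show ?case by (intro exec_eq[OF exec.LoopF]) (auto simp: fun_eq_iff)
  next
    case (Suc n)
    define \<sigma>1 where "\<sigma>1 = \<sigma>(Aux 12 := replicate n 3 @ 2 # ys, Aux 10 := 1 # \<sigma> (Aux 10))"
    have body: "exec G (Push (Aux 10) (\<lambda>_. 1) ;; Pop (Aux 12)) \<sigma> \<sigma>1"
      by (intro exec_intros)
        (use Suc.prems assms(4) in \<open>auto simp: \<sigma>1_def fun_eq_iff\<close>)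
    have rest: "exec G ?l1 \<sigma>1 (\<sigma>(Aux 12 := 2 # ys, Aux 10 := replicate (Suc n) 1 @ \<sigma> (Aux 10)))"
      by (rule exec_eq[OF Suc.IH])
        (use Suc.prems in \<open>auto simp: \<sigma>1_def fun_eq_iff replicate_app_Cons_same\<close>)
    show ?case
      by (rule exec_Loop_step[OF body _ rest]) (use Suc.prems in simp)
  qed
  have loop2: "exec G ?l2 \<sigma> (\<sigma>(Aux 12 := zs, Aux 10 := [], Aux 9 := rev ys @ \<sigma> (Aux 9)))"
    if "\<sigma> (Aux 12) = ys @ zs" "\<sigma> (Aux 10) = replicate (length ys) 1"
      "\<forall>v \<in> set ys. 0 < v \<and> v < G" for \<sigma> ys zs
    using that
  proof (induction ys arbitrary: \<sigma>)
    case Nil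
    then show ?case by (intro exec_eq[OF exec.LoopF]) (auto simp: fun_eq_iff)
  next
    case (Cons y ys)
    define \<sigma>1 where "\<sigma>1 = \<sigma>(Aux 12 := ys @ zs, Aux 10 := replicate (length ys) 1, Aux 9 := y # \<sigma> (Aux 9))"
    have body: "exec G ?b \<sigma> \<sigma>1"
      by (intro exec_intros)
        (use Cons.prems assms(4) in \<open>auto simp: \<sigma>1_def fun_eq_iff\<close>)
    have rest: "exec G ?l2 \<sigma>1 (\<sigma>(Aux 12 := zs, Aux 10 := [], Aux 9 := rev (y # ys) @ \<sigma> (Aux 9)))"
      by (rule exec_eq[OF Cons.IH]) (use Cons.prems in \<open>auto simp: \<sigma>1_def fun_eq_iff\<close>)
    show ?case
      by (rule exec_Loop_step[OF body _ rest]) (use Cons.prems in simp)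
  qed
  define \<sigma>1 where "\<sigma>1 = \<sigma>(Aux 12 := 2 # stored (x @ list_code xs), Aux 10 := replicate (length x) 1)"
  define \<sigma>2 where "\<sigma>2 = \<sigma>1(Aux 12 := stored (x @ list_code xs), Aux 6 := 1 # \<sigma> (Aux 6))"
  define \<sigma>3 where "\<sigma>3 = \<sigma>2(Aux 12 := stored (list_code xs), Aux 10 := [], Aux 9 := rev (stored x))"
  have bd: "\<forall>v \<in> set (stored x). 0 < v \<and> v < G"
    using stored_bounds[of _ x] assms(4) by fastforce
  have 1: "exec G ?l1 \<sigma> \<sigma>1"
    by (rule exec_eq[OF loop1[where n = "length x" and ys = "stored (x @ list_code xs)"]])
      (use assms in \<open>auto simp: \<sigma>1_def fun_eq_iff\<close>)
  have 2: "exec G (Pop (Aux 12)) \<sigma>1 (\<sigma>1(Aux 12 := stored (x @ list_code xs)))"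
    by (rule exec_pop) (simp add: \<sigma>1_def)
  have 3: "exec G (Push (Aux 6) (\<lambda>_. 1)) (\<sigma>1(Aux 12 := stored (x @ list_code xs))) \<sigma>2"
    by (rule exec_push) (use assms(4) in \<open>auto simp: \<sigma>1_def \<sigma>2_def\<close>)
  have 4: "exec G ?l2 \<sigma>2 \<sigma>3"
    by (rule exec_eq[OF loop2[where ys = "stored x" and zs = "stored (list_code xs)"]])
      (use assms bd in \<open>auto simp: \<sigma>1_def \<sigma>2_def \<sigma>3_def fun_eq_iff simp del: set_map\<close>)
  have 5: "exec G (move_map (Aux 9) (Aux 6) id) \<sigma>3
      (\<sigma>(Aux 12 := stored (list_code xs), Aux 6 := stored x @ 1 # \<sigma> (Aux 6)))"
    by (rule exec_move) (use assms bd in \<open>auto simp: \<sigma>1_def \<sigma>2_def \<sigma>3_def fun_eq_iff simp del: set_map\<close>)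
  show ?thesis
    unfolding parse_item_def
    by (rule exec.Seq[OF 1 exec.Seq[OF 2 exec.Seq[OF 3 exec.Seq[OF 4 5]]]])
qed

definition parse_pool :: com where
  "parse_pool = Loop (\<lambda>t. t (Aux 12) \<noteq> 0) parse_item"

text \<open>Items are pushed in list order, so the last one ends on top. In this reversed order new
  conclusions are simply pushed as well.\<close>

lemma exec_parse_pool:
  assumes "\<sigma> (Aux 12) = stored (list_code xs)" "\<sigma> (Aux 9) = []" "\<sigma> (Aux 10) = []" "3 < G"
    and "\<sigma> (Aux 6) = pool_code ys"
  shows "exec G parse_pool \<sigma> (\<sigma>(Aux 12 := [], Aux 6 := pool_code (rev xs @ ys)))"
  using assms
proof (induction xs arbitrary: \<sigma> ys)
  case Nil
  then show ?case unfolding parse_pool_def by (intro exec_eq[OF exec.LoopF]) (auto simp: fun_eq_iff)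
next
  case (Cons x xs)
  define \<sigma>1 where "\<sigma>1 = \<sigma>(Aux 12 := stored (list_code xs), Aux 6 := stored x @ 1 # \<sigma> (Aux 6))"
  have body: "exec G parse_item \<sigma> \<sigma>1"
    unfolding \<sigma>1_def using Cons.prems by (intro exec_parse_item)
  have rest: "exec G parse_pool \<sigma>1 (\<sigma>(Aux 12 := [], Aux 6 := pool_code (rev (x # xs) @ ys)))"
    by (rule exec_eq[OF Cons.IH[where ys = "x # ys"]])
      (use Cons.prems in \<open>auto simp: \<sigma>1_def fun_eq_iff\<close>)
  have pk: "peek (\<sigma> (Aux 12)) \<noteq> 0"
    using Cons.prems(1) by (cases x) auto
  show ?case unfolding parse_pool_def
    by (rule exec_Loop_step[OF body _ rest[unfolded parse_pool_def]]) (use pk in simp)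
qed

section \<open>The interpreter and its instructions\<close>

type_synonym vm_state = "bool list list \<times> nat \<times> bool list \<times> bool list list"

text \<open>
  The components of a state are the pool, most recent formula first, an index register in
  unary, the formula fetched last and the premises collected for the next rule application.
\<close>

fun vm :: "bool list \<Rightarrow> vm_state \<Rightarrow> store" where
  "vm p (xs, u, z, args) = (\<lambda>_. [])(Aux 0 := bits p, Aux 6 := pool_code xs,
     Aux 7 := replicate u 1, Aux 8 := rev (stored z), Rgt 0 := stored (list_code args))"

text \<open>Incrementing pushes the top plus one, so a count sits on top of all smaller positive
  counts.\<close>

definition counter :: "nat \<Rightarrow> nat list" where
  "counter n = rev [1..<Suc n]"

lemma counter_simps [simp]:
  "counter 0 = []" "counter (Suc n) = Suc n # counter n" "peek (counter n) = n" "0 \<notin> set (counter n)"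
  by (cases n; simp add: counter_def)+

text \<open>The pushed 1 ends the new pool item. A conclusion comes from \<open>option_code\<close>
  with a leading \<open>True\<close>, which the final \<open>Pop\<close> removes.\<close>

definition apply_rule :: "tm \<Rightarrow> com" where
  "apply_rule M = Push (Aux 6) (\<lambda>_. 1) ;; run_machine M (Aux 6) ;; Pop (Aux 6)"

definition select_rule :: "(nat \<Rightarrow> tm) \<Rightarrow> nat list \<Rightarrow> com" where
  "select_rule Ms rs = foldr (\<lambda>r. Cond (\<lambda>t. t (Aux 11) = 5 + r) (apply_rule (Ms r))) rs Skip"

text \<open>Tokens 1 and 2 append a binary digit to the index. Count 0 belongs to the end marker of
  a stream: the formula fetched last is then output, shifted back from stored form to bits.\<close>

definition dispatch :: "(nat \<Rightarrow> tm) \<Rightarrow> nat list \<Rightarrow> com" where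
  "dispatch Ms rs =
     Cond (\<lambda>t. t (Aux 11) = 0) (move_map (Aux 8) out_reg (\<lambda>a. a - 1))
    (Cond (\<lambda>t. t (Aux 11) = 1) double
    (Cond (\<lambda>t. t (Aux 11) = 2) (double ;; Push (Aux 7) (\<lambda>_. 1))
    (Cond (\<lambda>t. t (Aux 11) = 3) fetch
    (Cond (\<lambda>t. t (Aux 11) = 4) pass_argument (select_rule Ms rs)))))"

lemma exec_dispatch:
  "peek (\<sigma> (Aux 11)) = 0 \<Longrightarrow> exec G (move_map (Aux 8) out_reg (\<lambda>a. a - 1)) \<sigma> \<sigma>' \<Longrightarrow>
    exec G (dispatch Ms rs) \<sigma> \<sigma>'"
  "peek (\<sigma> (Aux 11)) = 1 \<Longrightarrow> exec G double \<sigma> \<sigma>' \<Longrightarrow> exec G (dispatch Ms rs) \<sigma> \<sigma>'"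
  "peek (\<sigma> (Aux 11)) = 2 \<Longrightarrow> exec G (double ;; Push (Aux 7) (\<lambda>_. 1)) \<sigma> \<sigma>' \<Longrightarrow>
    exec G (dispatch Ms rs) \<sigma> \<sigma>'"
  "peek (\<sigma> (Aux 11)) = 3 \<Longrightarrow> exec G fetch \<sigma> \<sigma>' \<Longrightarrow> exec G (dispatch Ms rs) \<sigma> \<sigma>'"
  "peek (\<sigma> (Aux 11)) = 4 \<Longrightarrow> exec G pass_argument \<sigma> \<sigma>' \<Longrightarrow> exec G (dispatch Ms rs) \<sigma> \<sigma>'"
  "5 \<le> peek (\<sigma> (Aux 11)) \<Longrightarrow> exec G (select_rule Ms rs) \<sigma> \<sigma>' \<Longrightarrow>
    exec G (dispatch Ms rs) \<sigma> \<sigma>'"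
  unfolding dispatch_def by (simp_all add: exec.CondF exec.CondT)

definition run_tokens :: "(nat \<Rightarrow> tm) \<Rightarrow> nat list \<Rightarrow> com" where
  "run_tokens Ms rs = Loop (\<lambda>t. t (Aux 0) \<noteq> 0)
     (Cond (\<lambda>t. t (Aux 0) = 2)
        (Push (Aux 11) (\<lambda>t. Suc (t (Aux 11))) ;; Pop (Aux 0))
        (Pop (Aux 0) ;; dispatch Ms rs ;; clear (Aux 11)))"

text \<open>Rejection leaves the symbol 3, which occurs in no bit string. The two transfers through
  \<open>Aux 9\<close> bring the encoding of the base into stored form without changing its
  order.\<close>

definition decompressor :: "tm \<Rightarrow> (nat \<Rightarrow> tm) \<Rightarrow> nat list \<Rightarrow> com" where
  "decompressor Mb Ms rs =
     read_code ;;
     Cond (\<lambda>t. t (Aux 4) = 3)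
       (clear (Aux 4) ;; move_map (Aux 5) (Aux 0) id ;;
        move_map (Rgt 0) (Aux 9) Suc ;; move_map (Aux 9) (Rgt 0) id ;;
        run_machine Mb (Aux 12) ;; parse_pool ;; run_tokens Ms rs)
       (Push out_reg (\<lambda>_. 3))"

definition fits :: "nat \<Rightarrow> tm \<Rightarrow> bool" where
  "fits G M \<longleftrightarrow> wf_tm M \<and> Suc (num_states M) < G \<and> 3 * num_symbols M + 3 < G"

text \<open>The unread program \<open>p\<close> is arbitrary, so the relation concerns the
  interpreter state alone. The count on \<open>Aux 11\<close> is left for the main loop to
  clear.\<close>

definition instr :: "nat \<Rightarrow> (nat \<Rightarrow> tm) \<Rightarrow> nat list \<Rightarrow> nat \<Rightarrow> vm_state \<Rightarrow> vm_state \<Rightarrow> bool" where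
  "instr G Ms rs j s s' \<longleftrightarrow> 0 < j \<and> j < G \<and>
     (\<forall>p. exec G (dispatch Ms rs) ((vm p s)(Aux 11 := counter j)) ((vm p s')(Aux 11 := counter j)))"

lemma instr_double:
  assumes "4 < G"
  shows "instr G Ms rs 1 (xs, u, z, args) (xs, 2 * u, z, args)"
  unfolding instr_def
proof (intro conjI allI)
  fix p
  have "exec G double ((vm p (xs, u, z, args))(Aux 11 := counter 1))
      ((vm p (xs, 2 * u, z, args))(Aux 11 := counter 1))"
    by (rule exec_eq[OF exec_double[where u = u]]) (use assms in \<open>auto simp: fun_eq_iff\<close>)
  then show "exec G (dispatch Ms rs) ((vm p (xs, u, z, args))(Aux 11 := counter 1))
      ((vm p (xs, 2 * u, z, args))(Aux 11 := counter 1))"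
    by (rule exec_dispatch(2)[rotated]) simp
qed (use assms in auto)

lemma instr_double_Suc:
  assumes "4 < G"
  shows "instr G Ms rs 2 (xs, u, z, args) (xs, Suc (2 * u), z, args)"
  unfolding instr_def
proof (intro conjI allI)
  fix p
  have "exec G double ((vm p (xs, u, z, args))(Aux 11 := counter 2))
      ((vm p (xs, 2 * u, z, args))(Aux 11 := counter 2))"
    by (rule exec_eq[OF exec_double[where u = u]]) (use assms in \<open>auto simp: fun_eq_iff\<close>)
  moreover have "exec G (Push (Aux 7) (\<lambda>_. 1)) ((vm p (xs, 2 * u, z, args))(Aux 11 := counter 2))
      ((vm p (xs, Suc (2 * u), z, args))(Aux 11 := counter 2))"
    by (rule exec_push) (use assms in \<open>auto simp: fun_eq_iff\<close>)
  ultimately have "exec G (double ;; Push (Aux 7) (\<lambda>_. 1)) ((vm p (xs, u, z, args))(Aux 11 := counter 2))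
      ((vm p (xs, Suc (2 * u), z, args))(Aux 11 := counter 2))"
    by (rule exec.Seq)
  then show "exec G (dispatch Ms rs) ((vm p (xs, u, z, args))(Aux 11 := counter 2))
      ((vm p (xs, Suc (2 * u), z, args))(Aux 11 := counter 2))"
    by (rule exec_dispatch(3)[rotated]) simp
qed (use assms in auto)

text \<open>The formula register starts empty because \<open>fetch\<close> collects its copy on
  \<open>Aux 8\<close>.\<close>

lemma instr_fetch:
  assumes "4 < G" "u < length xs"
  shows "instr G Ms rs 3 (xs, u, [], args) (xs, 0, xs ! u, args)"
  unfolding instr_def
proof (intro conjI allI)
  fix p
  have "exec G fetch ((vm p (xs, u, [], args))(Aux 11 := counter 3))
      ((vm p (xs, 0, xs ! u, args))(Aux 11 := counter 3))"
    by (rule exec_eq[OF exec_fetch[where u = u and xs = xs]]) (use assms in \<open>auto simp: fun_eq_iff\<close>)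
  then show "exec G (dispatch Ms rs) ((vm p (xs, u, [], args))(Aux 11 := counter 3))
      ((vm p (xs, 0, xs ! u, args))(Aux 11 := counter 3))"
    by (rule exec_dispatch(4)[rotated]) simp
qed (use assms in auto)

lemma instr_pass_argument:
  assumes "4 < G"
  shows "instr G Ms rs 4 (xs, u, z, args) (xs, u, [], z # args)"
  unfolding instr_def
proof (intro conjI allI)
  fix p
  have "exec G pass_argument ((vm p (xs, u, z, args))(Aux 11 := counter 4))
      ((vm p (xs, u, [], z # args))(Aux 11 := counter 4))"
    by (rule exec_eq[OF exec_pass_argument[where x = z and xs = args]])
      (use assms in \<open>auto simp: fun_eq_iff\<close>)
  then show "exec G (dispatch Ms rs) ((vm p (xs, u, z, args))(Aux 11 := counter 4))
      ((vm p (xs, u, [], z # args))(Aux 11 := counter 4))"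
    by (rule exec_dispatch(5)[rotated]) simp
qed (use assms in auto)

lemma exec_select_rule:
  assumes "r \<in> set rs" "peek (\<sigma> (Aux 11)) = 5 + r" "exec G (apply_rule (Ms r)) \<sigma> \<sigma>'"
  shows "exec G (select_rule Ms rs) \<sigma> \<sigma>'"
  using assms(1)
proof (induction rs)
  case (Cons r' rs)
  show ?case
  proof (cases "r' = r")
    case True
    then show ?thesis using assms by (simp add: select_rule_def exec.CondT)
  next
    case False
    then show ?thesis using assms Cons by (simp add: select_rule_def exec.CondF)
  qed
qed simp

lemma instr_apply_rule:
  assumes "fits G (Ms r)" "r \<in> set rs" "5 + r < G" "tm_computes (Ms r) [list_code args] (True # x)"
  shows "instr G Ms rs (5 + r) (xs, u, z, args) (x # xs, u, z, [])"
  unfolding instr_def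
proof (intro conjI allI)
  fix p
  define \<sigma> where "\<sigma> = (vm p (xs, u, z, args))(Aux 11 := counter (5 + r))"
  define \<sigma>1 where "\<sigma>1 = \<sigma>(Aux 6 := 1 # pool_code xs)"
  define \<sigma>2 where "\<sigma>2 = \<sigma>1(Rgt 0 := [], Aux 6 := stored (True # x) @ 1 # pool_code xs)"
  have 1: "exec G (Push (Aux 6) (\<lambda>_. 1)) \<sigma> \<sigma>1"
    by (rule exec_push) (use assms in \<open>auto simp: \<sigma>_def \<sigma>1_def\<close>)
  have 2: "exec G (run_machine (Ms r) (Aux 6)) \<sigma>1 \<sigma>2"
    by (rule exec_eq[OF exec_run_machine[where x = "list_code args" and z = "True # x" and i = 6]])
      (use assms in \<open>auto simp: fits_def \<sigma>_def \<sigma>1_def \<sigma>2_def fun_eq_iff\<close>)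
  have 3: "exec G (Pop (Aux 6)) \<sigma>2 ((vm p (x # xs, u, z, []))(Aux 11 := counter (5 + r)))"
    by (rule exec_pop) (auto simp: \<sigma>_def \<sigma>1_def \<sigma>2_def fun_eq_iff)
  have "exec G (apply_rule (Ms r)) \<sigma> ((vm p (x # xs, u, z, []))(Aux 11 := counter (5 + r)))"
    unfolding apply_rule_def by (rule exec.Seq[OF 1 exec.Seq[OF 2 3]])
  then have "exec G (select_rule Ms rs) \<sigma> ((vm p (x # xs, u, z, []))(Aux 11 := counter (5 + r)))"
    by (rule exec_select_rule[OF assms(2), rotated]) (simp add: \<sigma>_def)
  then show "exec G (dispatch Ms rs) ((vm p (xs, u, z, args))(Aux 11 := counter (5 + r)))
      ((vm p (x # xs, u, z, []))(Aux 11 := counter (5 + r)))"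
    unfolding \<sigma>_def by (rule exec_dispatch(6)[rotated]) simp
qed (use assms in auto)

primrec instrs :: "nat \<Rightarrow> (nat \<Rightarrow> tm) \<Rightarrow> nat list \<Rightarrow> nat list \<Rightarrow> vm_state \<Rightarrow> vm_state \<Rightarrow> bool" where
  "instrs G Ms rs [] s s' \<longleftrightarrow> s = s'"
| "instrs G Ms rs (j # js) s s'' \<longleftrightarrow> (\<exists>s'. instr G Ms rs j s s' \<and> instrs G Ms rs js s' s'')"

lemma instrs_append:
  "instrs G Ms rs is s s' \<Longrightarrow> instrs G Ms rs js s' s'' \<Longrightarrow> instrs G Ms rs (is @ js) s s''"
proof (induction "is" arbitrary: s)
  case (Cons i "is")
  then show ?case by (simp del: split_paired_Ex) blast
qed simp

text \<open>In continuation form: counting a unary block prepends iterations to the execution that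
  remains, so no partially executed loop has to be described.\<close>

lemma exec_run_tokens_count:
  assumes "\<sigma> (Aux 0) = replicate j 2 @ ys" "\<sigma> (Aux 11) = counter i" "i + j < G"
    and "exec G (run_tokens Ms rs) (\<sigma>(Aux 0 := ys, Aux 11 := counter (i + j))) \<sigma>'"
  shows "exec G (run_tokens Ms rs) \<sigma> \<sigma>'"
  using assms
proof (induction j arbitrary: i \<sigma>)
  case 0
  then have eq: "\<sigma>(Aux 0 := ys, Aux 11 := counter (i + 0)) = \<sigma>" by (auto simp: fun_eq_iff)
  from 0(4)[unfolded eq] show ?case .
next
  case (Suc j)
  define \<sigma>1 where "\<sigma>1 = \<sigma>(Aux 11 := counter (Suc i), Aux 0 := replicate j 2 @ ys)"
  have "exec G (Push (Aux 11) (\<lambda>t. Suc (t (Aux 11))) ;; Pop (Aux 0)) \<sigma> \<sigma>1"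
    by (intro exec_intros) (use Suc.prems in \<open>auto simp: \<sigma>1_def fun_eq_iff\<close>)
  then have body: "exec G (Cond (\<lambda>t. t (Aux 0) = 2)
        (Push (Aux 11) (\<lambda>t. Suc (t (Aux 11))) ;; Pop (Aux 0))
        (Pop (Aux 0) ;; dispatch Ms rs ;; clear (Aux 11))) \<sigma> \<sigma>1"
    using Suc.prems(1) by (intro exec.CondT) simp_all
  have "\<sigma>1(Aux 0 := ys, Aux 11 := counter (Suc i + j)) = \<sigma>(Aux 0 := ys, Aux 11 := counter (i + Suc j))"
    by (auto simp: \<sigma>1_def fun_eq_iff)
  then have rest: "exec G (run_tokens Ms rs) \<sigma>1 \<sigma>'"
    using Suc.prems(3,4) by (intro Suc.IH[of \<sigma>1 "Suc i"]) (simp_all only:, simp_all add: \<sigma>1_def)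
  show ?case
    unfolding run_tokens_def
    by (rule exec_Loop_step[OF body _ rest[unfolded run_tokens_def]]) (use Suc.prems(1) in simp)
qed

lemma exec_run_tokens_token:
  assumes "j < G" "exec G (dispatch Ms rs) ((vm p s)(Aux 11 := counter j)) \<sigma>"
    and "0 \<notin> set (\<sigma> (Aux 11))" "exec G (run_tokens Ms rs) (\<sigma>(Aux 11 := [])) \<sigma>'"
  shows "exec G (run_tokens Ms rs) (vm (replicate j True @ False # p) s) \<sigma>'"
proof -
  obtain xs u z args where s: "s = (xs, u, z, args)" by (cases s)
  define \<sigma>0 where "\<sigma>0 = (vm (False # p) s)(Aux 11 := counter j)"
  have 1: "exec G (Pop (Aux 0)) \<sigma>0 ((vm p s)(Aux 11 := counter j))"
    by (rule exec_pop) (auto simp: \<sigma>0_def s fun_eq_iff)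
  have "exec G (Pop (Aux 0) ;; dispatch Ms rs ;; clear (Aux 11)) \<sigma>0 (\<sigma>(Aux 11 := []))"
    by (rule exec.Seq[OF 1 exec.Seq[OF assms(2) exec_clear[of \<sigma> "Aux 11", OF assms(3)]]])
  then have body: "exec G (Cond (\<lambda>t. t (Aux 0) = 2)
        (Push (Aux 11) (\<lambda>t. Suc (t (Aux 11))) ;; Pop (Aux 0))
        (Pop (Aux 0) ;; dispatch Ms rs ;; clear (Aux 11))) \<sigma>0 (\<sigma>(Aux 11 := []))"
    by (intro exec.CondF) (simp_all add: \<sigma>0_def s)
  have run: "exec G (run_tokens Ms rs) \<sigma>0 \<sigma>'"
    unfolding run_tokens_def
    by (rule exec_Loop_step[OF body _ assms(4)[unfolded run_tokens_def]]) (simp add: \<sigma>0_def s)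
  have eq: "(vm (replicate j True @ False # p) s)(Aux 0 := bits (False # p), Aux 11 := counter (0 + j)) = \<sigma>0"
    by (auto simp: \<sigma>0_def s fun_eq_iff)
  show ?thesis
    by (rule exec_run_tokens_count[OF _ _ _ run[folded eq]])
      (use assms(1) in \<open>simp_all add: s\<close>)
qed

lemma exec_run_tokens:
  assumes "instrs G Ms rs ts s (xs, u, z, args)" "4 < G"
  shows "\<exists>\<sigma>. exec G (run_tokens Ms rs) (vm (token_code ts) s) \<sigma> \<and> \<sigma> out_reg = bits z"
  using assms(1)
proof (induction ts arbitrary: s)
  case Nil
  define \<sigma> where "\<sigma> = (vm [] (xs, u, z, args))(Aux 8 := [], out_reg := bits z)"
  have "exec G (move_map (Aux 8) out_reg (\<lambda>a. a - 1)) (vm [] (xs, u, z, args)) \<sigma>"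
  proof (rule exec_move)
    show "0 < v - 1 \<and> v - 1 < G" if "v \<in> set (vm [] (xs, u, z, args) (Aux 8))" for v
      using that stored_bounds[of v z] assms(2) by (auto simp del: set_map)
  qed (auto simp: \<sigma>_def fun_eq_iff rev_map[symmetric] comp_def)
  then have "exec G (dispatch Ms rs) (vm [] (xs, u, z, args)) \<sigma>"
    by (rule exec_dispatch(1)[rotated]) simp
  moreover have "(vm [] (xs, u, z, args))(Aux 11 := counter 0) = vm [] (xs, u, z, args)"
    by (auto simp: fun_eq_iff)
  moreover have "exec G (run_tokens Ms rs) (\<sigma>(Aux 11 := [])) (\<sigma>(Aux 11 := []))"
    unfolding run_tokens_def by (rule exec.LoopF) (simp add: \<sigma>_def)
  \<comment> \<open>The end marker is read as a token of value 0, so the lemma on a single token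
    covers it.\<close>
  ultimately have "exec G (run_tokens Ms rs) (vm (replicate 0 True @ False # []) s) (\<sigma>(Aux 11 := []))"
    using Nil assms(2) by (intro exec_run_tokens_token[where \<sigma> = \<sigma>]) (simp_all add: \<sigma>_def)
  then have "exec G (run_tokens Ms rs) (vm (token_code []) s) (\<sigma>(Aux 11 := []))"
    by (simp only: token_code_simps replicate.simps append.simps)
  moreover have "(\<sigma>(Aux 11 := [])) out_reg = bits z"
    by (simp add: \<sigma>_def)
  ultimately show ?case by blast
next
  case (Cons j ts)
  then obtain s' where s': "instr G Ms rs j s s'" "instrs G Ms rs ts s' (xs, u, z, args)"
    by (auto simp del: split_paired_Ex)
  obtain \<sigma> where \<sigma>: "exec G (run_tokens Ms rs) (vm (token_code ts) s') \<sigma>" "\<sigma> out_reg = bits z"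
    using Cons.IH[OF s'(2)] by blast
  have "((vm (token_code ts) s')(Aux 11 := counter j))(Aux 11 := []) = vm (token_code ts) s'"
    by (cases s') (auto simp: fun_eq_iff)
  then have "exec G (run_tokens Ms rs) (vm (replicate j True @ False # token_code ts) s) \<sigma>"
    using s'(1) \<sigma>(1)
    by (intro exec_run_tokens_token[where \<sigma> = "(vm (token_code ts) s')(Aux 11 := counter j)"])
      (simp_all add: instr_def)
  then show ?case using \<sigma>(2) unfolding token_code_simps by blast
qed

lemma exec_decompressor_reject:
  assumes "foldl scan 0 (bits p) \<noteq> 3" "4 < G"
  shows "\<exists>\<sigma>. exec G (decompressor Mb Ms rs) (input_store p y) \<sigma> \<and> \<sigma> out_reg = [3]"
proof -
  obtain hs where hs: "peek hs = foldl scan 0 (bits p)"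
    "exec G read_code (input_store p y) ((input_store p y)(Aux 0 := [],
      Aux 5 := rev (bits p) @ input_store p y (Aux 5), Aux 4 := hs))"
    using exec_read_code[of "input_store p y" "bits p" G] set_bits[of p] assms(2)
    by (auto simp: input_store_def)
  let ?\<sigma> = "(input_store p y)(Aux 0 := [],
      Aux 5 := rev (bits p) @ input_store p y (Aux 5), Aux 4 := hs)"
  have "exec G (Push out_reg (\<lambda>_. 3)) ?\<sigma> (?\<sigma>(out_reg := [3]))"
    by (rule exec_push) (use assms(2) in \<open>auto simp: input_store_def\<close>)
  then have "exec G (decompressor Mb Ms rs) (input_store p y) (?\<sigma>(out_reg := [3]))"
    unfolding decompressor_def using assms(1) hs(1)
    by (intro exec.Seq[OF hs(2)] exec.CondF) simp_all
  then show ?thesis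
    by (intro exI[of _ "?\<sigma>(out_reg := [3])"]) simp
qed

lemma exec_decompressor_accept:
  assumes "instrs G Ms rs ts (rev xs, 0, [], []) (xs', u, z, args)" "0 \<notin> set ts"
    and "fits G Mb" "tm_computes Mb [y] (list_code xs)" "4 < G"
  shows "\<exists>\<sigma>. exec G (decompressor Mb Ms rs) (input_store (token_code ts) y) \<sigma> \<and> \<sigma> out_reg = bits z"
proof -
  let ?p = "token_code ts"
  obtain hs where hs: "0 \<notin> set hs" "peek hs = foldl scan 0 (bits ?p)"
    "exec G read_code (input_store ?p y) ((input_store ?p y)(Aux 0 := [],
      Aux 5 := rev (bits ?p) @ input_store ?p y (Aux 5), Aux 4 := hs))"
    using exec_read_code[of "input_store ?p y" "bits ?p" G] set_bits[of ?p] assms(5)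
    by (auto simp: input_store_def)
  define \<sigma>1 where "\<sigma>1 = (input_store ?p y)(Aux 0 := [],
      Aux 5 := rev (bits ?p) @ input_store ?p y (Aux 5), Aux 4 := hs)"
  have acc: "peek (\<sigma>1 (Aux 4)) = 3"
    using hs(2) scan_token_code[OF assms(2), of 0] by (simp add: \<sigma>1_def)
  define \<sigma>2 where "\<sigma>2 = (\<lambda>_. [])(Aux 5 := rev (bits ?p), Rgt 0 := bits y)"
  define \<sigma>3 where "\<sigma>3 = (\<lambda>_. [])(Aux 0 := bits ?p, Rgt 0 := bits y)"
  define \<sigma>4 where "\<sigma>4 = (\<lambda>_. [])(Aux 0 := bits ?p, Aux 9 := rev (stored y))"
  define \<sigma>5 where "\<sigma>5 = (\<lambda>_. [])(Aux 0 := bits ?p, Rgt 0 := stored y)"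
  define \<sigma>6 where "\<sigma>6 = (\<lambda>_. [])(Aux 0 := bits ?p, Aux 12 := stored (list_code xs))"
  have bd: "\<forall>v \<in> set (bits x). 0 < v \<and> v < G \<and> Suc v < G" for x
    using set_bits[of x] assms(5) by fastforce
  have 2: "exec G (clear (Aux 4)) \<sigma>1 \<sigma>2"
    by (rule exec_eq[OF exec_clear])
      (use hs(1) in \<open>auto simp: \<sigma>1_def \<sigma>2_def input_store_def fun_eq_iff\<close>)
  have 3: "exec G (move_map (Aux 5) (Aux 0) id) \<sigma>2 \<sigma>3"
    by (rule exec_move) (use bd in \<open>auto simp: \<sigma>2_def \<sigma>3_def fun_eq_iff simp del: bits_simps(5)\<close>)
  have 4: "exec G (move_map (Rgt 0) (Aux 9) Suc) \<sigma>3 \<sigma>4"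
    by (rule exec_move) (use bd in \<open>auto simp: \<sigma>3_def \<sigma>4_def fun_eq_iff\<close>)
  have 5: "exec G (move_map (Aux 9) (Rgt 0) id) \<sigma>4 \<sigma>5"
    by (rule exec_move) (use bd in \<open>auto simp: \<sigma>4_def \<sigma>5_def fun_eq_iff\<close>)
  have 6: "exec G (run_machine Mb (Aux 12)) \<sigma>5 \<sigma>6"
    by (rule exec_eq[OF exec_run_machine[where x = y and z = "list_code xs" and i = 12]])
      (use assms(3,4) in \<open>auto simp: fits_def \<sigma>5_def \<sigma>6_def fun_eq_iff\<close>)
  have 7: "exec G parse_pool \<sigma>6 (vm ?p (rev xs, 0, [], []))"
    by (rule exec_eq[OF exec_parse_pool[where xs = xs and ys = "[]"]])
      (use assms(5) in \<open>auto simp: \<sigma>6_def fun_eq_iff\<close>)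
  obtain \<sigma> where 8: "exec G (run_tokens Ms rs) (vm ?p (rev xs, 0, [], [])) \<sigma>" "\<sigma> out_reg = bits z"
    using exec_run_tokens[OF assms(1,5)] by blast
  have "exec G (decompressor Mb Ms rs) (input_store ?p y) \<sigma>"
    unfolding decompressor_def
    by (rule exec.Seq[OF hs(3)[folded \<sigma>1_def] exec.CondT[OF _ exec.Seq[OF 2 exec.Seq[OF 3
            exec.Seq[OF 4 exec.Seq[OF 5 exec.Seq[OF 6 exec.Seq[OF 7 8(1)]]]]]]]]) (rule acc)
  then show ?thesis using 8(2) by blast
qed

section \<open>Derivability and traces\<close>

lemma replay_append:
  "replay P pool steps = Some pool' \<Longrightarrow> replay P pool (steps @ steps') = replay P pool' steps'"
  by (induction P pool steps rule: replay.induct) (auto split: if_splits option.splits)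

lemma replay_extends:
  "replay P pool steps = Some pool' \<Longrightarrow> \<exists>zs. pool' = pool @ zs \<and> length zs = length steps"
proof (induction P pool steps rule: replay.induct)
  case (2 P pool r "is" steps)
  then obtain \<phi> where "rule_app P r (map (\<lambda>i. pool ! i) is) = Some \<phi>"
    "replay P (pool @ [\<phi>]) steps = Some pool'" "r \<in> rule_ids P \<and> (\<forall>i \<in> set is. i < length pool)"
    by (auto split: if_splits option.splits)
  then show ?case using 2 by fastforce
qed simp

text \<open>The pool is arbitrary in the induction: the premises of a rule are derived one after the
  other on a growing pool that keeps all earlier formulas, and the rule itself is the last
  step.\<close>

lemma Cn_replay:
  assumes "\<phi> \<in> Cn P \<Gamma>" "\<Gamma> \<subseteq> set pool"
  shows "\<exists>steps pool'. replay P pool steps = Some pool' \<and> \<phi> \<in> set pool'"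
  using assms
proof (induction arbitrary: pool)
  case (premise \<phi>)
  then show ?case by (intro exI[of _ "[]"] exI[of _ pool]) auto
next
  case (rule r \<psi>s \<phi>)
  have "\<exists>steps pool'. replay P pool steps = Some pool' \<and> set xs \<subseteq> set pool'"
    if "set xs \<subseteq> set \<psi>s" for xs
    using that
  proof (induction xs)
    case Nil
    then show ?case by (intro exI[of _ "[]"] exI[of _ pool]) auto
  next
    case (Cons x xs)
    then obtain steps pool' where 1: "replay P pool steps = Some pool'" "set xs \<subseteq> set pool'"
      by auto
    have "\<Gamma> \<subseteq> set pool'" using rule.prems replay_extends[OF 1(1)] by auto
    then obtain steps' pool'' where 2: "replay P pool' steps' = Some pool''" "x \<in> set pool''"
      using rule.IH Cons.prems by (meson list.set_intros(1) subsetD)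
    have "replay P pool (steps @ steps') = Some pool''"
      using replay_append[OF 1(1)] 2(1) by simp
    moreover have "set (x # xs) \<subseteq> set pool''"
      using 1(2) 2(2) replay_extends[OF 2(1)] by auto
    ultimately show ?case by blast
  qed
  then obtain steps pool' where 1: "replay P pool steps = Some pool'" "set \<psi>s \<subseteq> set pool'"
    by blast
  define "is" where "is = map (\<lambda>\<psi>. SOME i. i < length pool' \<and> pool' ! i = \<psi>) \<psi>s"
  have ex: "(SOME i. i < length pool' \<and> pool' ! i = \<psi>) < length pool' \<and>
      pool' ! (SOME i. i < length pool' \<and> pool' ! i = \<psi>) = \<psi>" if "\<psi> \<in> set \<psi>s" for \<psi>
    by (rule someI_ex) (use 1(2) that in \<open>auto simp flip: in_set_conv_nth\<close>)
  have "map (\<lambda>i. pool' ! i) is = \<psi>s"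
    using ex by (auto simp: is_def intro: map_idI)
  moreover have "\<forall>i \<in> set is. i < length pool'"
    using ex by (auto simp: is_def)
  ultimately have "replay P pool' [(r, is)] = Some (pool' @ [\<phi>])"
    using rule.hyps by simp
  then have "replay P pool (steps @ [(r, is)]) = Some (pool' @ [\<phi>])"
    using replay_append[OF 1(1)] by simp
  then show ?case by (intro exI[of _ "steps @ [(r, is)]"] exI[of _ "pool' @ [\<phi>]"]) simp
qed

text \<open>Derivability provides a trace, and by well-ordering the infimum over a nonempty set of
  lengths is attained; in particular it is finite.\<close>

lemma shortest_trace:
  assumes "q \<in> Cn P B" "set (lst B) = B"
  shows "\<exists>\<pi>. valid_trace P lst B q \<pi> \<and> trace_length \<pi> = Dd P lst B q \<and>
    min_trace P lst B q = enat (Dd P lst B q)"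
proof -
  let ?A = "(\<lambda>\<pi>. enat (trace_length \<pi>)) ` {\<pi>. valid_trace P lst B q \<pi>}"
  obtain steps pool where "replay P (lst B) steps = Some pool" "q \<in> set pool"
    using Cn_replay[OF assms(1), of "lst B"] assms(2) by auto
  then obtain i where "valid_trace P lst B q (steps, i)"
    by (auto simp: valid_trace_def in_set_conv_nth)
  then have "?A \<noteq> {}" by blast
  then have "Inf ?A \<in> ?A"
    by (meson ex_in_conv wellorder_InfI)
  then obtain \<pi> where "valid_trace P lst B q \<pi>" "min_trace P lst B q = enat (trace_length \<pi>)"
    by (auto simp: min_trace_def)
  then show ?thesis by (intro exI[of _ \<pi>]) (simp add: Dd_def)
qed


section \<open>Coding traces as token streams\<close>

text \<open>Binary notation, most significant digit first, with tokens 1 and 2 for the digits 0 and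
  1, since 0 would end the stream.\<close>

fun index_code :: "nat \<Rightarrow> nat list" where
  "index_code n = (if n = 0 then [] else index_code (n div 2) @ [if even n then 1 else 2])"

declare index_code.simps [simp del]

lemma instrs_index_code:
  assumes "4 < G"
  shows "instrs G Ms rs (index_code n) (xs, 0, z, args) (xs, n, z, args)"
proof (induction n rule: index_code.induct)
  case (1 n)
  show ?case
  proof (cases "n = 0")
    case True
    then show ?thesis by (simp add: index_code.simps)
  next
    case False
    have "instr G Ms rs (if even n then 1 else 2) (xs, n div 2, z, args) (xs, n, z, args)"
      using instr_double[OF assms, of Ms rs xs "n div 2" z args]
        instr_double_Suc[OF assms, of Ms rs xs "n div 2" z args] by auto
    then have "instrs G Ms rs [if even n then 1 else 2] (xs, n div 2, z, args) (xs, n, z, args)"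
      by simp
    then show ?thesis
      using instrs_append[OF 1[OF False]] False by (subst index_code.simps) simp
  qed
qed

lemma length_index_code: "n < 2 ^ b \<Longrightarrow> length (index_code n) \<le> b"
proof (induction b arbitrary: n)
  case 0
  then show ?case by (simp add: index_code.simps)
next
  case (Suc b)
  then show ?case using Suc.IH[of "n div 2"] by (subst index_code.simps) auto
qed

lemma set_index_code: "set (index_code n) \<subseteq> {1, 2}"
  by (induction n rule: index_code.induct) (subst index_code.simps, auto)

text \<open>Both reversals undo the stack order: the interpreter holds the pool most recent first,
  whence \<open>n - 1 - i\<close>, and each argument is prepended to those passed before.\<close>

definition arguments_code :: "nat \<Rightarrow> nat list \<Rightarrow> nat list" where
  "arguments_code n is = concat (map (\<lambda>i. index_code (n - 1 - i) @ [3, 4]) (rev is))"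

primrec steps_code :: "nat \<Rightarrow> (nat \<times> nat list) list \<Rightarrow> nat list" where
  "steps_code n [] = []"
| "steps_code n (s # steps) = arguments_code n (snd s) @ [5 + fst s] @ steps_code (Suc n) steps"

lemma instrs_arguments_code:
  assumes "4 < G" "\<forall>i \<in> set is. i < length xs"
  shows "instrs G Ms rs (arguments_code (length xs) is) (rev xs, 0, [], []) (rev xs, 0, [], map ((!) xs) is)"
  using assms(2)
proof (induction "is")
  case Nil
  then show ?case by (simp add: arguments_code_def)
next
  case (Cons i "is")
  let ?j = "length xs - 1 - i" and ?as = "map ((!) xs) is"
  have j: "?j < length (rev xs)" "rev xs ! ?j = xs ! i"
    using Cons.prems by (auto simp: rev_nth)
  have "instrs G Ms rs [3, 4] (rev xs, ?j, [], ?as) (rev xs, 0, [], map ((!) xs) (i # is))"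
    using instr_fetch[OF assms(1) j(1), of Ms rs ?as]
      instr_pass_argument[OF assms(1), of Ms rs "rev xs" 0 "xs ! i" ?as] j(2)
    by (auto simp del: split_paired_Ex)
  then have "instrs G Ms rs (index_code ?j @ [3, 4]) (rev xs, 0, [], ?as)
      (rev xs, 0, [], map ((!) xs) (i # is))"
    by (rule instrs_append[OF instrs_index_code[OF assms(1)]])
  moreover have "instrs G Ms rs (arguments_code (length xs) is) (rev xs, 0, [], []) (rev xs, 0, [], ?as)"
    using Cons by simp
  ultimately have "instrs G Ms rs (arguments_code (length xs) is @ index_code ?j @ [3, 4])
      (rev xs, 0, [], []) (rev xs, 0, [], map ((!) xs) (i # is))"
    by (rule instrs_append[rotated])
  then show ?case by (simp add: arguments_code_def)
qed

definition rule_machines ::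
  "('s, 'f, 'r) signature \<Rightarrow> (('s, 'f, 'r) fm \<Rightarrow> bool list) \<Rightarrow> ('s, 'f, 'r) proof_system \<Rightarrow>
   (nat \<Rightarrow> tm) \<Rightarrow> nat \<Rightarrow> bool" where
  "rule_machines sg enc P Ms G \<longleftrightarrow> 4 < G \<and> (\<forall>r \<in> rule_ids P. fits G (Ms r) \<and> 5 + r < G \<and>
     (\<forall>\<psi>s. set \<psi>s \<subseteq> language sg \<longrightarrow>
        tm_computes (Ms r) [list_code (map enc \<psi>s)] (option_code (map_option enc (rule_app P r \<psi>s)))))"

text \<open>The induction keeps the pool inside \<open>language sg\<close>, where the rule machines
  are specified.\<close>

lemma instrs_steps_code:
  assumes "effective_proof_system sg enc P k" "rule_machines sg enc P Ms G" "set rs = rule_ids P"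
    and "replay P pool steps = Some pool'" "set pool \<subseteq> language sg"
  shows "instrs G Ms rs (steps_code (length pool) steps)
    (rev (map enc pool), 0, [], []) (rev (map enc pool'), 0, [], [])"
  using assms(4,5)
proof (induction steps arbitrary: pool)
  case Nil
  then show ?case by simp
next
  case (Cons s steps)
  obtain r "is" where s: "s = (r, is)" by fastforce
  let ?\<psi>s = "map (\<lambda>i. pool ! i) is"
  obtain \<phi> where r: "r \<in> rule_ids P" "\<forall>i \<in> set is. i < length pool" "rule_app P r ?\<psi>s = Some \<phi>"
    and rest: "replay P (pool @ [\<phi>]) steps = Some pool'"
    using Cons.prems(1) s by (auto split: if_splits option.splits)
  have \<psi>s: "set ?\<psi>s \<subseteq> language sg"
    using r(2) Cons.prems(2) by (auto dest!: nth_mem)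
  then have "\<phi> \<in> language sg"
    using assms(1) r(1,3) unfolding effective_proof_system_def by blast
  then have IH: "instrs G Ms rs (steps_code (Suc (length pool)) steps)
      (enc \<phi> # rev (map enc pool), 0, [], []) (rev (map enc pool'), 0, [], [])"
    using Cons.IH[OF rest] Cons.prems(2) by simp
  have prems: "map ((!) (map enc pool)) is = map enc ?\<psi>s"
    using r(2) by simp
  have "4 < G" "\<forall>i \<in> set is. i < length (map enc pool)"
    using r(2) assms(2) by (simp_all add: rule_machines_def)
  from instrs_arguments_code[OF this]
  have args: "instrs G Ms rs (arguments_code (length pool) is)
      (rev (map enc pool), 0, [], []) (rev (map enc pool), 0, [], map enc ?\<psi>s)"
    unfolding prems length_map .
  have "tm_computes (Ms r) [list_code (map enc ?\<psi>s)] (option_code (map_option enc (rule_app P r ?\<psi>s)))"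
    using assms(2) r(1) \<psi>s unfolding rule_machines_def by blast
  then have "instr G Ms rs (5 + r) (rev (map enc pool), 0, [], map enc ?\<psi>s)
      (enc \<phi> # rev (map enc pool), 0, [], [])"
    using assms(2,3) r unfolding rule_machines_def by (intro instr_apply_rule) simp_all
  then have "instrs G Ms rs ([5 + r] @ steps_code (Suc (length pool)) steps)
      (rev (map enc pool), 0, [], map enc ?\<psi>s) (rev (map enc pool'), 0, [], [])"
    using IH by (auto simp del: split_paired_Ex)
  from instrs_append[OF args this] show ?case by (simp add: s)
qed

section \<open>The length of a coded trace\<close>

lemma length_token_code: "length (token_code ts) = Suc (sum_list (map Suc ts))"
  by (induction ts) auto

text \<open>A digit is a token 1 or 2 and costs at most three bits.\<close>

lemma index_code_size: "n < 2 ^ b \<Longrightarrow> sum_list (map Suc (index_code n)) \<le> 3 * b"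
proof -
  assume "n < 2 ^ b"
  have "sum_list (map Suc (index_code n)) \<le> sum_list (map (\<lambda>_. 3) (index_code n))"
    using set_index_code[of n] by (intro sum_list_mono) auto
  also have "\<dots> = 3 * length (index_code n)"
    by (simp add: sum_list_triv)
  also have "\<dots> \<le> 3 * b"
    using length_index_code[OF \<open>n < 2 ^ b\<close>] by simp
  finally show ?thesis .
qed

text \<open>The 9 pays for the tokens 3 and 4 that follow each index, of four and five bits.\<close>

lemma arguments_code_size:
  assumes "n \<le> 2 ^ b"
  shows "sum_list (map Suc (arguments_code n is)) \<le> length is * (3 * b + 9)"
proof (induction "is")
  case (Cons i "is")
  have "n - 1 - i < 2 ^ b"
    using assms by (cases n) (auto intro: le_less_trans[of _ "n - 1"])
  then show ?case
    using Cons index_code_size[of "n - 1 - i" b] by (simp add: arguments_code_def)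
qed (simp add: arguments_code_def)

text \<open>Each step has at most \<open>k\<close> arguments, and its rule token
  \<open>5 + r\<close> costs \<open>6 + r\<close> bits.\<close>

lemma steps_code_size:
  assumes "replay P pool steps = Some pool'" "effective_proof_system sg enc P k"
    and "length pool + length steps \<le> 2 ^ b" "\<forall>r \<in> rule_ids P. r \<le> R"
  shows "sum_list (map Suc (steps_code (length pool) steps)) \<le> length steps * (k * (3 * b + 9) + 6 + R)"
  using assms(1,3)
proof (induction steps arbitrary: pool)
  case (Cons s steps)
  obtain r "is" where s: "s = (r, is)" by fastforce
  obtain \<phi> where r: "r \<in> rule_ids P" "rule_app P r (map (\<lambda>i. pool ! i) is) = Some \<phi>"
    and rest: "replay P (pool @ [\<phi>]) steps = Some pool'"
    using Cons.prems(1) s by (auto split: if_splits option.splits)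
  have "length is \<le> k"
    using assms(2) r by (metis effective_proof_system_def length_map)
  then have "sum_list (map Suc (arguments_code (length pool) is)) \<le> k * (3 * b + 9)"
    using arguments_code_size[of "length pool" b "is"] Cons.prems(2)
    by (meson add_leD1 le_trans mult_le_mono1)
  moreover have "sum_list (map Suc (steps_code (Suc (length pool)) steps)) \<le>
      length steps * (k * (3 * b + 9) + 6 + R)"
    using Cons.IH[OF rest] Cons.prems(2) by simp
  moreover have "r \<le> R"
    using assms(4) r(1) by blast
  ultimately show ?case
    by (simp add: s)
qed simp

lemma set_steps_code: "0 \<notin> set (steps_code n steps)"
proof (induction steps arbitrary: n)
  case (Cons s steps)
  have "0 \<notin> set (index_code i)" for i
    using set_index_code[of i] by auto
  then show ?case using Cons by (auto simp: arguments_code_def)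
qed simp


section \<open>The prefix machine reading coded traces\<close>

text \<open>Here \<open>b\<close> bounds the number of digits of a pool index. The summand
  \<open>3 * b + 5\<close> pays for the index of the result, the fetch token of four bits and the
  end marker.\<close>

lemma exists_decompressor:
  assumes eff: "effective_proof_system sg enc P k" and amb: "ambient_formulas sg enc AQ S"
    and can: "canonical_base_encoding enc S lst encB"
  shows "\<exists>V R. wf_tm V \<and> prefix_free_tm V \<and>
    (\<forall>B q \<pi> b. premise_base S B \<and> valid_trace P lst B q \<pi> \<and> length (lst B) + trace_length \<pi> \<le> 2 ^ b \<longrightarrow>
      (\<exists>p. tm_computes V [p, encB B] (enc q) \<and>
        length p \<le> trace_length \<pi> * (k * (3 * b + 9) + 6 + R) + 3 * b + 5))"
proof -
  have fin: "finite (rule_ids P)"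
    using eff by (simp add: effective_proof_system_def)
  obtain Mb where Mb: "wf_tm Mb"
    "\<And>B. premise_base S B \<Longrightarrow> tm_computes Mb [encB B] (list_code (map enc (lst B)))"
    using can by (auto simp: canonical_base_encoding_def)
  have "\<forall>r \<in> rule_ids P. \<exists>M. wf_tm M \<and> (\<forall>\<psi>s. set \<psi>s \<subseteq> language sg \<longrightarrow>
      tm_computes M [list_code (map enc \<psi>s)] (option_code (map_option enc (rule_app P r \<psi>s))))"
    using eff by (simp add: effective_proof_system_def)
  then obtain Ms where Ms: "\<forall>r \<in> rule_ids P. wf_tm (Ms r) \<and> (\<forall>\<psi>s. set \<psi>s \<subseteq> language sg \<longrightarrow>
      tm_computes (Ms r) [list_code (map enc \<psi>s)] (option_code (map_option enc (rule_app P r \<psi>s))))"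
    by metis
  \<comment> \<open>Collects the quantities of a rule that must be bounded; as there are finitely
    many rules, their sum \<open>R\<close> is a single bound for all.\<close>
  define w where "w r = r + num_states (Ms r) + 3 * num_symbols (Ms r)" for r
  define R where "R = sum w (rule_ids P)"
  have w: "w r \<le> R" if "r \<in> rule_ids P" for r
    unfolding R_def using fin that by (simp add: member_le_sum)
  \<comment> \<open>An alphabet with room for the states, the packed actions and the token counts of
    all given machines; the 10 absorbs the additive constants.\<close>
  define G where "G = 10 + num_states Mb + 3 * num_symbols Mb + R"
  have fits: "fits G Mb" "4 < G"
    using Mb(1) by (simp_all add: fits_def G_def)
  have "fits G (Ms r) \<and> 5 + r < G" if "r \<in> rule_ids P" for r
    using w[OF that] Ms that by (simp add: fits_def G_def w_def)
  then have rules: "rule_machines sg enc P Ms G"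
    using Ms fits(2) by (simp add: rule_machines_def)
  obtain rs where rs: "set rs = rule_ids P"
    using finite_list[OF fin] by blast
  define c where "c = decompressor Mb Ms rs"
  define N where "N = max 9 (width c)"
  define V where "V = machine G N c"
  have "wf_tm V"
    unfolding V_def using fits(2) by (intro wf_machine) (auto simp: N_def)
  \<comment> \<open>Only rejected programs need analysis: their runs end with a 3 on
    \<open>out_reg\<close>. Accepted ones may diverge or output anything, as acceptance alone
    excludes proper extensions.\<close>
  have accept: "foldl scan 0 (bits p) = 3" if computes: "tm_computes V [p, y] z" for p y z
  proof (rule ccontr)
    assume "foldl scan 0 (bits p) \<noteq> 3"
    then obtain \<sigma> where "exec G c (input_store p y) \<sigma>" "\<sigma> out_reg = [3]"
      using exec_decompressor_reject[OF _ fits(2)] unfolding c_def by blast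
    then have "[3] = bits z"
      using machine_computes[of G c p y \<sigma> N z] computes by (simp add: V_def N_def)
    then have "3 \<in> set (bits z)"
      by (metis list.set_intros(1))
    then show False using set_bits[of z] by auto
  qed
  have "prefix_free_tm V"
    unfolding prefix_free_tm_def
  proof (intro allI impI)
    fix y p p' z z'
    assume *: "tm_computes V [p, y] z \<and> tm_computes V [p', y] z' \<and> prefix p p'"
    then obtain e where "p' = p @ e" by (auto simp: prefix_def)
    then have "bits e = []"
      using scan_prefix_free[of 0 "bits p" "bits e"] accept * by (metis bits_simps(3))
    then show "p = p'" using \<open>p' = p @ e\<close> by (simp add: bits_def)
  qed
  have "\<exists>p. tm_computes V [p, encB B] (enc q) \<and>
      length p \<le> trace_length \<pi> * (k * (3 * b + 9) + 6 + R) + 3 * b + 5"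
    if B: "premise_base S B" and \<pi>: "valid_trace P lst B q \<pi>"
      and b: "length (lst B) + trace_length \<pi> \<le> 2 ^ b" for B q \<pi> b
  proof -
    obtain steps i where \<pi>_eq: "\<pi> = (steps, i)" by fastforce
    obtain pool where pool: "replay P (lst B) steps = Some pool" "i < length pool" "pool ! i = q"
      using \<pi> by (auto simp: valid_trace_def \<pi>_eq)
    have lang: "set (lst B) \<subseteq> language sg"
      using B can amb by (auto simp: canonical_base_encoding_def premise_base_def ambient_formulas_def)
    let ?j = "length pool - 1 - i"
    \<comment> \<open>After the steps of the trace, the position of \<open>q\<close> in the reversed
      final pool is loaded and \<open>q\<close> is fetched for output.\<close>
    define ts where "ts = steps_code (length (lst B)) steps @ index_code ?j @ [3]"
    have "instr G Ms rs 3 (rev (map enc pool), ?j, [], [])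
        (rev (map enc pool), 0, rev (map enc pool) ! ?j, [])"
      using pool(2) by (intro instr_fetch fits(2)) simp
    moreover have "rev (map enc pool) ! ?j = enc q"
      using pool(2,3) by (simp add: rev_nth)
    ultimately have "instrs G Ms rs [3] (rev (map enc pool), ?j, [], []) (rev (map enc pool), 0, enc q, [])"
      by simp
    then have "instrs G Ms rs ts (rev (map enc (lst B)), 0, [], []) (rev (map enc pool), 0, enc q, [])"
      unfolding ts_def
      by (rule instrs_append[OF instrs_steps_code[OF eff rules rs pool(1) lang]
            instrs_append[OF instrs_index_code[OF fits(2)]]])
    moreover have "0 \<notin> set ts"
      using set_steps_code set_index_code[of ?j] by (fastforce simp: ts_def)
    ultimately obtain \<sigma> where "exec G c (input_store (token_code ts) (encB B)) \<sigma>" "\<sigma> out_reg = bits (enc q)"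
      using exec_decompressor_accept[OF _ _ fits(1) Mb(2)[OF B] fits(2)] unfolding c_def by blast
    then have "tm_computes V [token_code ts, encB B] (enc q)"
      using machine_computes[of G c "token_code ts" "encB B" \<sigma> N "enc q"] by (simp add: V_def N_def)
    moreover have "length (token_code ts) \<le> trace_length \<pi> * (k * (3 * b + 9) + 6 + R) + 3 * b + 5"
    proof -
      have "length pool = length (lst B) + length steps"
        using replay_extends[OF pool(1)] by auto
      then have "?j < 2 ^ b"
        using b pool(2) by (simp add: \<pi>_eq trace_length_def)
      then have "sum_list (map Suc (index_code ?j)) \<le> 3 * b"
        by (rule index_code_size)
      moreover have "\<forall>r \<in> rule_ids P. r \<le> R"
        using w by (fastforce simp: w_def)
      then have "sum_list (map Suc (steps_code (length (lst B)) steps)) \<le>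
          length steps * (k * (3 * b + 9) + 6 + R)"
        using steps_code_size[OF pool(1) eff] b by (simp add: \<pi>_eq trace_length_def)
      ultimately show ?thesis
        by (simp add: length_token_code ts_def \<pi>_eq trace_length_def)
    qed
    ultimately show ?thesis by blast
  qed
  then show ?thesis
    using \<open>wf_tm V\<close> \<open>prefix_free_tm V\<close> by blast
qed

section \<open>Bounds on the complexity\<close>

lemma kolm_le:
  assumes "tm_computes U [p, y] x"
  shows "kolm U x y \<le> length p"
  unfolding kolm_def by (rule Least_le) (use assms in blast)

lemma complexity_upper_bound:
  assumes "effective_proof_system sg enc P k" "ambient_formulas sg enc AQ S"
    and can: "canonical_base_encoding enc S lst encB" and U: "universal_prefix_tm U"
  shows "\<exists>c>0. \<forall>pb B q. query_instance sg P AQ S lst pb B q \<longrightarrow>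
    real (kolm U (enc q) (encB B)) \<le>
      c * (real (Dd P lst B q) * log 2 (real (card B) + real (Dd P lst B q)))"
proof -
  obtain V R where V: "wf_tm V" "prefix_free_tm V" and prog:
    "\<And>B q \<pi> b. premise_base S B \<Longrightarrow> valid_trace P lst B q \<pi> \<Longrightarrow>
      length (lst B) + trace_length \<pi> \<le> 2 ^ b \<Longrightarrow>
      \<exists>p. tm_computes V [p, encB B] (enc q) \<and>
        length p \<le> trace_length \<pi> * (k * (3 * b + 9) + 6 + R) + 3 * b + 5"
    using exists_decompressor[OF assms(1-3)] by metis
  obtain w where w: "\<And>p y z. tm_computes U [w @ p, y] z \<longleftrightarrow> tm_computes V [p, y] z"
    using U V unfolding universal_prefix_tm_def by metis
  \<comment> \<open>The summands collect \<open>15 * k\<close> for the arguments,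
    \<open>R + 6\<close> for the rule tokens, 11 for the final index with its end, and the length of
    the prefix \<open>w\<close> by which \<open>U\<close> simulates \<open>V\<close>.\<close>
  define c where "c = real (15 * k + R + 17 + length w)"
  have "real (kolm U (enc q) (encB B)) \<le>
      c * (real (Dd P lst B q) * log 2 (real (card B) + real (Dd P lst B q)))"
    if inst: "query_instance sg P AQ S lst pb B q" for pb B q
  proof -
    define d where "d = Dd P lst B q"
    define \<Lambda> where "\<Lambda> = log 2 (real (card B) + real d)"
    have B: "premise_base S B" "B \<noteq> {}" "q \<in> Cn P B" "1 \<le> d"
      using inst by (auto simp: query_instance_def d_def)
    have lst: "set (lst B) = B" "distinct (lst B)"
      using can B(1) by (auto simp: canonical_base_encoding_def)
    then have len: "length (lst B) = card B" by (metis distinct_card)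
    have "1 \<le> card B"
      using B(1,2) by (simp add: premise_base_def Suc_le_eq card_gt_0_iff)
    then have two: "2 \<le> real (card B) + real d"
      using B(4) by linarith
    \<comment> \<open>This bound, which rests on \<open>B \<noteq> {}\<close> and
      \<open>d \<ge> 1\<close>, lets additive constants be absorbed into multiples of
      \<open>\<Lambda>\<close>.\<close>
    then have \<Lambda>: "1 \<le> \<Lambda>"
      unfolding \<Lambda>_def by (simp add: le_log_iff)
    obtain \<pi> where \<pi>: "valid_trace P lst B q \<pi>" "trace_length \<pi> = d"
      using shortest_trace[of q P B lst, OF B(3) lst(1)] by (auto simp: d_def)
    \<comment> \<open>The final pool has \<open>card B + d\<close> entries, at most
      \<open>2 ^ b\<close>; since \<open>\<Lambda> \<ge> 1\<close>, rounding up at most doubles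
      it.\<close>
    define b where "b = nat \<lceil>\<Lambda>\<rceil>"
    have b: "\<Lambda> \<le> real b" "real b \<le> 2 * \<Lambda>"
      using \<Lambda> by (auto simp: b_def) linarith
    have "real (card B) + real d = 2 powr \<Lambda>"
      using two by (simp add: \<Lambda>_def)
    also have "\<dots> \<le> 2 powr real b"
      using b(1) by simp
    finally have "real (card B + d) \<le> real (2 ^ b)"
      by (simp add: powr_realpow)
    then have "length (lst B) + trace_length \<pi> \<le> 2 ^ b"
      by (simp only: of_nat_le_iff len \<pi>(2))
    then obtain p where p: "tm_computes V [p, encB B] (enc q)"
      "length p \<le> d * (k * (3 * b + 9) + 6 + R) + 3 * b + 5"
      using prog[OF B(1) \<pi>(1)] \<pi>(2) by blast
    have "kolm U (enc q) (encB B) \<le> length (w @ p)"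
      using p(1) w by (intro kolm_le) blast
    then have "real (kolm U (enc q) (encB B)) \<le>
        real (length w + (d * (k * (3 * b + 9) + 6 + R) + 3 * b + 5))"
      using p(2) by (simp del: of_nat_add of_nat_mult)
    also have "\<dots> = real (length w) + real d * (real k * (3 * real b + 9) + (6 + real R)) + (3 * real b + 5)"
      by simp
    also have "\<dots> \<le> real (length w) * (real d * \<Lambda>) + real d * (real k * (15 * \<Lambda>) + (6 + real R) * \<Lambda>) +
        11 * (real d * \<Lambda>)"
    proof (intro add_mono mult_left_mono)
      have d\<Lambda>: "\<Lambda> \<le> real d * \<Lambda>"
        using B(4) \<Lambda> mult_right_mono[of 1 "real d" \<Lambda>] by simp
      show "real (length w) \<le> real (length w) * (real d * \<Lambda>)"
        using mult_left_mono[OF order_trans[OF \<Lambda> d\<Lambda>], of "real (length w)"] by simp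
      show "3 * real b + 9 \<le> 15 * \<Lambda>"
        using b(2) \<Lambda> by linarith
      show "6 + real R \<le> (6 + real R) * \<Lambda>"
        using \<Lambda> mult_left_mono[of 1 \<Lambda> "6 + real R"] by simp
      show "3 * real b + 5 \<le> 11 * (real d * \<Lambda>)"
        using b(2) \<Lambda> d\<Lambda> by linarith
    qed auto
    also have "\<dots> = c * (real d * \<Lambda>)"
      by (simp add: c_def algebra_simps)
    finally show ?thesis by (simp add: d_def \<Lambda>_def)
  qed
  moreover have "0 < c" by (simp add: c_def)
  ultimately show ?thesis by blast
qed

theorem mainTheorem4:
  fixes sg :: "('s, 'f, 'r) signature"
    and enc :: "('s, 'f, 'r) fm \<Rightarrow> bool list"
    and P :: "('s, 'f, 'r) proof_system"
    and k :: nat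
    and AQ S :: "('s, 'f, 'r) fm set"
    and lst :: "('s, 'f, 'r) fm set \<Rightarrow> ('s, 'f, 'r) fm list"
    and encB :: "('s, 'f, 'r) fm set \<Rightarrow> bool list"
    and U :: tm
  defines "D \<equiv> (\<lambda>B q. real (Dd P lst B q))"
    and "K \<equiv> (\<lambda>B q. real (kolm U (enc q) (encB B)))"
    and "\<Lambda> \<equiv> (\<lambda>B q. log 2 (real (card B) + real (Dd P lst B q)))"
  assumes "formula_encoding sg enc"
    and "effective_proof_system sg enc P k"
    and "ambient_formulas sg enc AQ S"
    and "canonical_base_encoding enc S lst encB"
    and "universal_prefix_tm U"
  shows
    "(\<exists>c\<^sub>1>0. \<forall>pb B q. query_instance sg P AQ S lst pb B q \<longrightarrow>
        K B q \<le> c\<^sub>1 * (D B q * \<Lambda> B q) \<and> D B q \<ge> K B q / (c\<^sub>1 * \<Lambda> B q)) \<and>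
     (\<forall>pb \<delta>\<^sub>0. 0 < \<delta>\<^sub>0 \<and> rich P enc S lst pb \<delta>\<^sub>0 \<longrightarrow>
        (\<exists>c\<^sub>2>0. \<forall>\<delta> B q.
           \<delta>\<^sub>0 < \<delta> \<and> \<delta> < 1 \<and> query_instance sg P AQ S lst pb B q \<and>
           incompressible U P enc lst encB \<delta> B q \<longrightarrow>
           D B q \<le> K B q / (c\<^sub>2 * (1 - \<delta>) * \<Lambda> B q))) \<and>
     (\<forall>pb \<delta>\<^sub>0 \<delta>. 0 < \<delta>\<^sub>0 \<and> rich P enc S lst pb \<delta>\<^sub>0 \<and> \<delta>\<^sub>0 < \<delta> \<and> \<delta> < 1 \<longrightarrow>
        (let F = principal {(B, q). query_instance sg P AQ S lst pb B q \<and>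
                                    incompressible U P enc lst encB \<delta> B q}
         in (\<lambda>(B, q). D B q) \<in> \<Theta>[F](\<lambda>(B, q). K B q / \<Lambda> B q) \<and>
            (\<lambda>(B, q). D B q * ln 2) \<in> \<Theta>[F](\<lambda>(B, q). K B q * ln 2 / \<Lambda> B q) \<and>
            (\<lambda>(B, q). K B q) \<in> \<Theta>[F](\<lambda>(B, q). D B q * \<Lambda> B q)))"
proof -
  obtain c where c: "c > 0" "\<And>pb B q. query_instance sg P AQ S lst pb B q \<Longrightarrow> K B q \<le> c * (D B q * \<Lambda> B q)"
    using complexity_upper_bound[OF assms(5-8)] unfolding K_def D_def \<Lambda>_def by blast
  have pos: "0 < D B q \<and> 0 < \<Lambda> B q" if "query_instance sg P AQ S lst pb B q" for pb B q
  proof -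
    have "1 \<le> Dd P lst B q" "1 \<le> card B"
      using that by (auto simp: query_instance_def premise_base_def Suc_le_eq card_gt_0_iff)
    then have "1 < real (card B) + real (Dd P lst B q)" by linarith
    then show ?thesis
      using \<open>1 \<le> Dd P lst B q\<close> by (simp add: D_def \<Lambda>_def)
  qed
  \<comment> \<open>The \<open>n\<close> in \<open>incompressible\<close> is a finite value of
    \<open>min_trace\<close>, hence equal to \<open>Dd\<close>.\<close>
  have lower: "(1 - \<delta>) * (D B q * \<Lambda> B q) \<le> K B q"
    if "incompressible U P enc lst encB \<delta> B q" for \<delta> B q
    using that by (auto simp: incompressible_def Dd_def D_def K_def \<Lambda>_def mult.assoc)
  show ?thesis
  proof (intro conjI allI impI)
    show "\<exists>c\<^sub>1>0. \<forall>pb B q. query_instance sg P AQ S lst pb B q \<longrightarrow>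
        K B q \<le> c\<^sub>1 * (D B q * \<Lambda> B q) \<and> D B q \<ge> K B q / (c\<^sub>1 * \<Lambda> B q)"
    proof (intro exI[of _ c] conjI allI impI c)
      fix pb B q
      assume inst: "query_instance sg P AQ S lst pb B q"
      show "D B q \<ge> K B q / (c * \<Lambda> B q)"
        using c(1) c(2)[OF inst] pos[OF inst] by (simp add: divide_le_eq algebra_simps)
    qed
  next
    fix pb \<delta>\<^sub>0
    show "\<exists>c\<^sub>2>0. \<forall>\<delta> B q.
           \<delta>\<^sub>0 < \<delta> \<and> \<delta> < 1 \<and> query_instance sg P AQ S lst pb B q \<and>
           incompressible U P enc lst encB \<delta> B q \<longrightarrow>
           D B q \<le> K B q / (c\<^sub>2 * (1 - \<delta>) * \<Lambda> B q)"
    \<comment> \<open>The incompressibility inequality divided by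
      \<open>(1 - \<delta>) * \<Lambda> B q\<close>, which is positive for
      \<open>\<delta> < 1\<close>; the constant 1 therefore suffices.\<close>
    proof (intro exI[of _ 1] conjI allI impI)
      fix \<delta> B q
      assume *: "\<delta>\<^sub>0 < \<delta> \<and> \<delta> < 1 \<and> query_instance sg P AQ S lst pb B q \<and>
           incompressible U P enc lst encB \<delta> B q"
      then show "D B q \<le> K B q / (1 * (1 - \<delta>) * \<Lambda> B q)"
        using lower[of \<delta> B q] pos[of pb B q] by (simp add: le_divide_eq algebra_simps)
    qed simp
  next
    fix pb \<delta>\<^sub>0 \<delta>
    assume \<delta>: "0 < \<delta>\<^sub>0 \<and> rich P enc S lst pb \<delta>\<^sub>0 \<and> \<delta>\<^sub>0 < \<delta> \<and> \<delta> < 1"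
    define F where "F = principal {(B, q). query_instance sg P AQ S lst pb B q \<and>
                                    incompressible U P enc lst encB \<delta> B q}"
    \<comment> \<open>Along a principal filter, eventually means for every member of the set. All
      three Theta statements thus follow from the uniform bounds of \<open>K\<close> between
      \<open>1 - \<delta>\<close> and \<open>c\<close> times \<open>D * \<Lambda>\<close>.\<close>
    have ev: "eventually (\<lambda>(B, q). 0 < D B q \<and> 0 < \<Lambda> B q \<and> (1 - \<delta>) * (D B q * \<Lambda> B q) \<le> K B q \<and>
        K B q \<le> c * (D B q * \<Lambda> B q)) F"
      unfolding F_def eventually_principal using pos lower c(2) by blast
    have K: "(\<lambda>(B, q). K B q) \<in> \<Theta>[F](\<lambda>(B, q). D B q * \<Lambda> B q)"
    proof (rule bigthetaI')
      show "0 < 1 - \<delta>" "0 < c" using \<delta> c by auto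
      show "\<forall>\<^sub>F x in F. (1 - \<delta>) * norm (case x of (B, q) \<Rightarrow> D B q * \<Lambda> B q) \<le> norm (case x of (B, q) \<Rightarrow> K B q) \<and>
          norm (case x of (B, q) \<Rightarrow> K B q) \<le> c * norm (case x of (B, q) \<Rightarrow> D B q * \<Lambda> B q)"
        using ev by eventually_elim (auto simp: K_def)
    qed
    \<comment> \<open>Division by \<open>\<Lambda>\<close> inverts the two constants and exchanges
      their roles.\<close>
    have D: "(\<lambda>(B, q). D B q) \<in> \<Theta>[F](\<lambda>(B, q). K B q / \<Lambda> B q)"
    proof (rule bigthetaI')
      show "0 < 1 / c" "0 < 1 / (1 - \<delta>)" using \<delta> c by auto
      show "\<forall>\<^sub>F x in F. 1 / c * norm (case x of (B, q) \<Rightarrow> K B q / \<Lambda> B q) \<le> norm (case x of (B, q) \<Rightarrow> D B q) \<and>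
          norm (case x of (B, q) \<Rightarrow> D B q) \<le> 1 / (1 - \<delta>) * norm (case x of (B, q) \<Rightarrow> K B q / \<Lambda> B q)"
        using ev by eventually_elim (use \<delta> c(1) in \<open>auto simp: K_def field_simps\<close>)
    qed
    then have "(\<lambda>(B, q). D B q * ln 2) \<in> \<Theta>[F](\<lambda>(B, q). K B q * ln 2 / \<Lambda> B q)"
      by (simp add: case_prod_unfold times_divide_eq_left[symmetric] del: times_divide_eq_left)
    then show "let F = principal {(B, q). query_instance sg P AQ S lst pb B q \<and>
                                    incompressible U P enc lst encB \<delta> B q}
         in (\<lambda>(B, q). D B q) \<in> \<Theta>[F](\<lambda>(B, q). K B q / \<Lambda> B q) \<and>
            (\<lambda>(B, q). D B q * ln 2) \<in> \<Theta>[F](\<lambda>(B, q). K B q * ln 2 / \<Lambda> B q) \<and>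
            (\<lambda>(B, q). K B q) \<in> \<Theta>[F](\<lambda>(B, q). D B q * \<Lambda> B q)"
      using D K by (simp add: F_def[symmetric] Let_def)
  qed
qed

end
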